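(* For every $x\in\mathbb R$, the map $\theta\mapsto f(x;\theta)$ is twice continuously differentiable on $\Theta_M^\circ$, and each $f_{\theta_i}$, $i=1,\ldots,4$, is continuously differentiable with respect to $x$. Moreover $f_{\theta_i}$, $f_{\theta_i}'$, $f_{\theta_i\theta_j}$, $i,j=1,\ldots,4$, are jointly continuous in $(x,\theta)$ on $\mathbb R\times\Theta_M^\circ$. For each $\theta=(\mu,\sigma,\alpha,\beta)'\in\Theta_M^\circ$, the following hold for sufficiently large $|x|$ (i.e. as $|x|\to\infty$): $$\begin{array}{lll} f=O(|x|^{-(1+\alpha)}), & f_\mu'=-f_{\mu\mu}=O(|x|^{-(3+\alpha)}), & f_{\sigma\alpha}=O(|x|^{-(1+\alpha)}\log|x|),\\ f_\mu=-f'=O(|x|^{-(2+\alpha)}), & f_\sigma'=-f_{\mu\sigma}=O(|x|^{-(2+\alpha)}), & f_{\sigma\beta}=O(|x|^{-(1+\alpha)}),\\ f_\sigma=O(|x|^{-(1+\alpha)}), & f_\alpha'=-f_{\mu\alpha}=O(|x|^{-(2+\alpha)}\log|x|), & f_{\alpha\alpha}=O(|x|^{-(1+\alpha)}\log^2|x|),\\ f_\alpha=O(|x|^{-(1+\alpha)}\log|x|), & f_\beta'=-f_{\mu\beta}=O(|x|^{-(2+\alpha)}), & f_{\alpha\beta}=O(|x|^{-(1+\alpha)}\log|x|),\\ f_\beta=O(|x|^{-(1+\alpha)}), & f_{\sigma\sigma}=O(|x|^{-(1+\alpha)}), & f_{\beta\beta}=O(|x|^{-(1+\alpha)}). \end{array}$$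 Furthermore, for $\alpha=1$ and $\beta\in(-1,1)$, $$f_{\sigma\sigma}=O(|x|^{-3}\log|x|),\qquad f_{\beta\beta}=O(|x|^{-3}\log|x|).$$
   Context: Parameters: $\theta=(\theta_1,\theta_2,\theta_3,\theta_4)'=(\mu,\sigma,\alpha,\beta)'$, with parameter space $\Theta_M=\mathbb R\times(0,\infty)\times(0,2]\times[-1,1]$ and interior $\Theta_M^\circ=\mathbb R\times(0,\infty)\times(0,2)\times(-1,1)$. The stable density in the $(M_0)$ (continuous) parameterization is $f(x;\theta)=\frac1{2\pi}\int_{-\infty}^\infty e^{-itx}\varphi(t)\,dt$, where $$\varphi(t)=\exp\Big(-|\sigma t|^\alpha\big\{1+i\beta\,\mathrm{sign}(t)\tan\tfrac{\pi\alpha}{2}\,(|\sigma t|^{1-\alpha}-1)\big\}+i\mu t\Big)\quad\text{if }\alpha\ne1,$$ $$\varphi(t)=\exp\Big(-|\sigma t|-i\sigma t\,\tfrac{2\beta}{\pi}\log|\sigma t|+i\mu t\Big)\quad\text{if }\alpha=1.$$ Primes denote derivatives in $x$; $f_{\theta_i}$, $f_{\theta_i\theta_j}$ are first and second partial derivatives in the parameters; $f_{\theta_i}'=\partial^2 f/\partial x\,\partial\theta_i$. All are evaluated at $(x;\theta)$. Constants in the $O(\cdot)$ terms may depend on $\theta$. *)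

theory Defs
  imports "HOL-Analysis.Analysis" "HOL-Library.Landau_Symbols"
begin

text \<open>A parameter is \<open>\<theta> = (\<mu>, \<sigma>, \<alpha>, \<beta>) :: real ^ 4\<close>, so that \<open>\<theta> $ i\<close> is
  the i-th parameter.\<close>

abbreviation (input) ix_mu :: 4 where "ix_mu \<equiv> 1"
abbreviation (input) ix_sigma :: 4 where "ix_sigma \<equiv> 2"
abbreviation (input) ix_alpha :: 4 where "ix_alpha \<equiv> 3"
abbreviation (input) ix_beta :: 4 where "ix_beta \<equiv> 4"

definition Theta_M :: "(real ^ 4) set" where
  "Theta_M = {\<theta>. \<theta> $ ix_sigma > 0 \<and> \<theta> $ ix_alpha \<in> {0<..2} \<and> \<theta> $ ix_beta \<in> {-1..1}}"

lemma interior_Theta_M: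
  "interior Theta_M =
    {\<theta>. \<theta> $ ix_sigma > 0 \<and> \<theta> $ ix_alpha \<in> {0<..<2} \<and> \<theta> $ ix_beta \<in> {-1<..<1}}"
  (is "_ = ?U")
proof (rule interior_unique)
  show "?U \<subseteq> Theta_M" by (auto simp: Theta_M_def)
  have "?U = {\<theta>. 0 < \<theta> $ 2} \<inter> {\<theta>. 0 < \<theta> $ 3} \<inter> {\<theta>. \<theta> $ 3 < 2} \<inter> {\<theta>. - 1 < \<theta> $ 4} \<inter> {\<theta>. \<theta> $ 4 < 1}"
    by auto
  then show "open ?U"
    by (auto intro!: open_Int open_Collect_less continuous_intros)
next
  fix T :: "(real ^ 4) set"
  assume T: "T \<subseteq> Theta_M" "open T"
  show "T \<subseteq> ?U"
  proof
    fix \<theta> assume "\<theta> \<in> T"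
    then obtain e where e: "e > 0" "cball \<theta> e \<subseteq> T"
      using T(2) open_contains_cball by blast
    have in_Theta: "\<theta> + s *\<^sub>R axis i 1 \<in> Theta_M" if "\<bar>s\<bar> \<le> e" for s i
      using that e(2) T(1) by (force simp: dist_norm)
    have "\<theta> \<in> Theta_M" using \<open>\<theta> \<in> T\<close> T(1) by auto
    moreover have "\<theta> $ 3 + e \<le> 2" "\<theta> $ 4 + e \<le> 1" "-1 \<le> \<theta> $ 4 - e"
      using in_Theta[of e 3] in_Theta[of e 4] in_Theta[of "-e" 4] e(1)
      by (auto simp: Theta_M_def axis_def)
    ultimately show "\<theta> \<in> ?U" using e(1) by (auto simp: Theta_M_def)
  qed
qed

text \<open>Characteristic function in the continuous \<open>(M\<^sub>0)\<close> parameterization. With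
  \<open>0 powr a = 0\<close> and \<open>ln 0 = 0\<close> both branches give the value 1 at \<open>t = 0\<close>.\<close>

definition stable_cf :: "real \<Rightarrow> real \<Rightarrow> real \<Rightarrow> real \<Rightarrow> real \<Rightarrow> complex" where
  "stable_cf \<mu> \<sigma> \<alpha> \<beta> t =
    (if \<alpha> \<noteq> 1 then
       exp (- of_real (\<bar>\<sigma> * t\<bar> powr \<alpha>) *
              (1 + \<i> * of_real (\<beta> * sgn t * tan (pi * \<alpha> / 2) * (\<bar>\<sigma> * t\<bar> powr (1 - \<alpha>) - 1)))
            + \<i> * of_real (\<mu> * t))
     else
       exp (- of_real \<bar>\<sigma> * t\<bar> - \<i> * of_real (\<sigma> * t * (2 * \<beta> / pi) * ln \<bar>\<sigma> * t\<bar>)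
            + \<i> * of_real (\<mu> * t)))"

text \<open>The Fourier inversion integral is real, see \<open>complex_of_real_stable_pdf\<close>; the
  real part only serves to obtain a function with values in \<open>real\<close>.\<close>

definition stable_pdf :: "real \<Rightarrow> real ^ 4 \<Rightarrow> real" where
  "stable_pdf x \<theta> =
    Re (1 / (2 * pi) *
      (LINT t|lborel. exp (- \<i> * of_real (t * x)) *
         stable_cf (\<theta> $ ix_mu) (\<theta> $ ix_sigma) (\<theta> $ ix_alpha) (\<theta> $ ix_beta) t))"

lemma cnj_stable_cf: "cnj (stable_cf \<mu> \<sigma> \<alpha> \<beta> t) = stable_cf \<mu> \<sigma> \<alpha> \<beta> (- t)"
  by (simp add: stable_cf_def exp_cnj sgn_minus algebra_simps)

lemma complex_of_real_stable_pdf: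
  "complex_of_real (stable_pdf x \<theta>) =
    1 / (2 * pi) *
      (LINT t|lborel. exp (- \<i> * of_real (t * x)) *
         stable_cf (\<theta> $ ix_mu) (\<theta> $ ix_sigma) (\<theta> $ ix_alpha) (\<theta> $ ix_beta) t)"
proof -
  define h where "h = (\<lambda>t. exp (- \<i> * of_real (t * x)) *
    stable_cf (\<theta> $ 1) (\<theta> $ 2) (\<theta> $ 3) (\<theta> $ 4) t)"
  have "cnj (h t) = h (- t)" for t
    by (simp add: h_def cnj_stable_cf exp_cnj)
  then have "cnj (LINT t|lborel. h t) = (LINT t|lborel. h (- t))"
    by (simp flip: Bochner_Integration.integral_cnj)
  also have "\<dots> = (LINT t|lborel. h t)"
    using lborel_integral_real_affine[of "-1" h 0] by simp
  finally have "Im (1 / (2 * pi) * (LINT t|lborel. h t)) = 0"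
    by (simp add: complex_eq_iff Im_divide_of_real flip: of_real_mult)
  then show ?thesis
    unfolding stable_pdf_def h_def[symmetric] by (simp add: complex_eq_iff)
qed

definition C1_on :: "('a::real_normed_vector \<Rightarrow> 'b::real_normed_vector) \<Rightarrow> 'a set \<Rightarrow> bool"
  where "C1_on g U \<longleftrightarrow>
    (\<exists>g' :: 'a \<Rightarrow> 'a \<Rightarrow>\<^sub>L 'b.
       (\<forall>\<theta>\<in>U. (g has_derivative blinfun_apply (g' \<theta>)) (at \<theta>)) \<and> continuous_on U g')"

definition C2_on :: "('a::real_normed_vector \<Rightarrow> 'b::real_normed_vector) \<Rightarrow> 'a set \<Rightarrow> bool"
  where "C2_on g U \<longleftrightarrow>
    (\<exists>g' :: 'a \<Rightarrow> 'a \<Rightarrow>\<^sub>L 'b.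
       (\<forall>\<theta>\<in>U. (g has_derivative blinfun_apply (g' \<theta>)) (at \<theta>)) \<and> C1_on g' U)"

definition partial_deriv :: "'n::finite \<Rightarrow> (real ^ 'n \<Rightarrow> real) \<Rightarrow> real ^ 'n \<Rightarrow> real" where
  "partial_deriv i g \<theta> = deriv (\<lambda>s. g (\<theta> + s *\<^sub>R axis i 1)) 0"

text \<open>The suffix \<open>_x\<close> stands for a derivative in \<open>x\<close> (a prime in the usual notation),
  \<open>_d i\<close> for \<open>\<partial>/\<partial>\<theta>\<^sub>i\<close>, and \<open>_dd i j\<close> for \<open>\<partial>/\<partial>\<theta>\<^sub>j (\<partial>/\<partial>\<theta>\<^sub>i)\<close>.\<close>

definition stable_pdf_x :: "real \<Rightarrow> real ^ 4 \<Rightarrow> real" where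
  "stable_pdf_x x \<theta> = deriv (\<lambda>y. stable_pdf y \<theta>) x"

definition stable_pdf_d :: "4 \<Rightarrow> real \<Rightarrow> real ^ 4 \<Rightarrow> real" where
  "stable_pdf_d i x = partial_deriv i (stable_pdf x)"

definition stable_pdf_d_x :: "4 \<Rightarrow> real \<Rightarrow> real ^ 4 \<Rightarrow> real" where
  "stable_pdf_d_x i x \<theta> = deriv (\<lambda>y. stable_pdf_d i y \<theta>) x"

definition stable_pdf_dd :: "4 \<Rightarrow> 4 \<Rightarrow> real \<Rightarrow> real ^ 4 \<Rightarrow> real" where
  "stable_pdf_dd i j x = partial_deriv j (stable_pdf_d i x)"

end

theory Submission
  imports Defs "HOL-Complex_Analysis.Cauchy_Integral_Formula" "HOL-Real_Asymp.Real_Asymp"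
begin

text \<open>
  After the substitution \<open>r = \<sigma> t\<close> the density is \<open>\<sigma>\<^sup>-\<^sup>1 G((\<mu> - x) / \<sigma>, \<alpha>, \<beta>)\<close> with
  \<open>G(m, \<alpha>, \<beta>) = \<pi>\<^sup>-\<^sup>1 Re \<integral> exp (i m r - r\<^sup>\<alpha> - i \<beta> K(\<alpha>, r)) dr\<close> over \<open>r > 0\<close>, where \<open>K\<close> is holomorphic
  in \<open>\<alpha>\<close> on the disc \<open>\<bar>\<alpha> - 1\<bar> < 1\<close>: the singularity of \<open>tan (\<pi> \<alpha> / 2)\<close> at \<open>\<alpha> = 1\<close> is removable. A derivative
  of \<open>G\<close> multiplies the integrand by a factor of polynomial growth, so dominated convergence gives the
  smoothness.

  For the tails let \<open>m \<rightarrow> -\<infinity>\<close> (the case \<open>m \<rightarrow> \<infinity>\<close> follows from \<open>\<beta> \<mapsto> -\<beta>\<close>) and shift the contour to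
  \<open>0 \<rightarrow> -i \<rightarrow> -i + \<infinity>\<close>. The horizontal part is \<open>O(e\<^sup>m)\<close>, and on the vertical part \<open>exp (i m r)\<close> becomes the
  real factor \<open>exp (m u)\<close>, which leaves a Laplace integral of the imaginary part of the remaining
  integrand. At \<open>r = -i u\<close> the linear terms of the exponent are real and
  \<open>Im (-i K) = u\<^sup>\<alpha> sin (\<pi> \<alpha> / 2)\<close>. Hence this imaginary part is of order \<open>u\<^sup>\<alpha> \<bar>ln u\<bar>\<^sup>k\<close> for each of the
  derivatives, with \<open>k\<close> the number of \<open>\<alpha>\<close>-derivatives and a further factor \<open>u\<close> per \<open>m\<close>-derivative.
\<close>

section \<open>Dominated integrals and \<open>C\<^sup>2\<close> functions\<close>

text \<open>The contour is turned only to depth 1, not onto the whole imaginary axis, because the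
  rest of the kernel may grow there: for \<open>\<alpha> > 1\<close> the term -r^\<alpha> has
  positive real part at r = -i u. Depth 1 is enough, since the horizontal part is already
  exponentially small in m, provided that the kernel still decays along the shifted line; this is
  what the estimate in the strip supplies.

  All derivatives stay in one class, integrals of the kernel against multipliers that are closed
  under sums and products, so that smoothness and tails are proved for the class and then
  specialised.

  The sharper rates at \<open>\<alpha> = 1\<close> come from a cancellation. The rotated integrand
  has linear term (1 + \<beta>) u, which contributes a multiple of (1 + \<beta>) / m^2 to the tail.
  This is affine in \<beta>, so the second \<beta>-derivative removes it. The second
  \<sigma>-derivative is \<sigma>^-3 times 2 G + 4 m G' + m^2 G'', with primes for derivatives in m,
  and this operator sends m^-2 to (2 - 8 + 6) m^-2 = 0. What remains gains one power of m at the
  price of one logarithm.\<close>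

lemma tendsto_integral_dominated:
  fixes f :: "'p::first_countable_topology \<Rightarrow> 'r \<Rightarrow> 'b::{banach,second_countable_topology}"
  assumes lim: "\<And>r. r \<in> space M \<Longrightarrow> ((\<lambda>p. f p r) \<longlongrightarrow> l r) (at p0 within S)"
    and bd: "\<And>p r. p \<in> S \<Longrightarrow> p \<noteq> p0 \<Longrightarrow> r \<in> space M \<Longrightarrow> norm (f p r) \<le> w r"
    and w: "integrable M w"
    and [measurable]: "\<And>p. p \<in> S \<Longrightarrow> p \<noteq> p0 \<Longrightarrow> f p \<in> borel_measurable M" "l \<in> borel_measurable M"
  shows "((\<lambda>p. integral\<^sup>L M (f p)) \<longlongrightarrow> integral\<^sup>L M l) (at p0 within S)"
  unfolding tendsto_at_iff_sequentially comp_def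
proof (intro allI impI)
  fix X :: "nat \<Rightarrow> 'p"
  assume X: "\<forall>i. X i \<in> S - {p0}" "X \<longlonglongrightarrow> p0"
  show "(\<lambda>n. integral\<^sup>L M (f (X n))) \<longlonglongrightarrow> integral\<^sup>L M l"
  proof (rule integral_dominated_convergence[OF _ _ w])
    show "AE r in M. (\<lambda>n. f (X n) r) \<longlonglongrightarrow> l r"
      using lim X unfolding tendsto_at_iff_sequentially comp_def by (intro AE_I2) blast
  qed (use X bd in auto)
qed

lemma continuous_on_integral_dominated:
  fixes f :: "'p::first_countable_topology \<Rightarrow> 'r \<Rightarrow> 'b::{banach,second_countable_topology}"
  assumes "\<And>r. r \<in> space M \<Longrightarrow> continuous_on S (\<lambda>p. f p r)"
    and "\<And>p r. p \<in> S \<Longrightarrow> r \<in> space M \<Longrightarrow> norm (f p r) \<le> w r"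
    and "integrable M w"
    and "\<And>p. p \<in> S \<Longrightarrow> f p \<in> borel_measurable M"
  shows "continuous_on S (\<lambda>p. integral\<^sup>L M (f p))"
  unfolding continuous_on_def
  by (intro ballI tendsto_integral_dominated[where w = w])
    (use assms in \<open>auto simp: continuous_on_def\<close>)

text \<open>By the mean value inequality the bound on \<open>D\<close> over the ball makes
  \<open>f\<close> Lipschitz in the parameter with constant \<open>w r\<close>. Hence the remainder
  quotient \<open>Q\<close> is dominated by \<open>2 * w r\<close>, and it tends to 0 for each
  \<open>r\<close>.\<close>

lemma has_derivative_integral_dominated:
  fixes f :: "'p::{real_normed_vector,perfect_space} \<Rightarrow> 'r \<Rightarrow> 'b::{banach,second_countable_topology}"
  assumes e: "e > 0"
    and D: "\<And>p r. p \<in> ball p0 e \<Longrightarrow> r \<in> space M \<Longrightarrow> ((\<lambda>p. f p r) has_derivative D p r) (at p)"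
    and bd: "\<And>p r h. p \<in> ball p0 e \<Longrightarrow> r \<in> space M \<Longrightarrow> norm (D p r h) \<le> w r * norm h"
    and w: "integrable M w"
    and int: "\<And>p. p \<in> ball p0 e \<Longrightarrow> integrable M (f p)"
    and meas: "\<And>h. (\<lambda>r. D p0 r h) \<in> borel_measurable M"
  shows "((\<lambda>p. integral\<^sup>L M (f p)) has_derivative (\<lambda>h. integral\<^sup>L M (\<lambda>r. D p0 r h))) (at p0)"
proof -
  have p0: "p0 \<in> ball p0 e" using e by simp
  have intD: "integrable M (\<lambda>r. D p0 r h)" for h
  proof (rule Bochner_Integration.integrable_bound)
    show "integrable M (\<lambda>r. w r * norm h)" using w by simp
    show "AE r in M. norm (D p0 r h) \<le> norm (w r * norm h)"
      by (rule AE_I2) (rule order_trans[OF bd[OF p0]], simp_all only: real_norm_def abs_ge_self)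
  qed (rule meas)
  have linD: "linear (D p0 r)" if "r \<in> space M" for r
    using D[OF p0 that] has_derivative_linear by blast
  have lip: "norm (f p r - f p0 r) \<le> w r * norm (p - p0)" if "p \<in> ball p0 e" "r \<in> space M" for p r
  proof (rule differentiable_bound[where S = "ball p0 e" and f' = "\<lambda>p. D p r"])
    show "((\<lambda>p. f p r) has_derivative D x r) (at x within ball p0 e)" if "x \<in> ball p0 e" for x
      using D[OF that \<open>r \<in> space M\<close>] by (rule has_derivative_at_withinI)
    show "onorm (D x r) \<le> w r" if "x \<in> ball p0 e" for x
      using bd[OF that \<open>r \<in> space M\<close>] by (rule onorm_le)
  qed (use that p0 in auto)
  show ?thesis
  proof (rule has_derivativeI)
    show "bounded_linear (\<lambda>h. integral\<^sup>L M (\<lambda>r. D p0 r h))"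
    proof (rule bounded_linear_intro[where K = "integral\<^sup>L M w"])
      fix h k :: 'p and c :: real
      have "integral\<^sup>L M (\<lambda>r. D p0 r (h + k)) = integral\<^sup>L M (\<lambda>r. D p0 r h + D p0 r k)"
        by (intro Bochner_Integration.integral_cong) (auto simp: linear_add[OF linD])
      then show "integral\<^sup>L M (\<lambda>r. D p0 r (h + k)) =
          integral\<^sup>L M (\<lambda>r. D p0 r h) + integral\<^sup>L M (\<lambda>r. D p0 r k)"
        using intD by simp
      have "integral\<^sup>L M (\<lambda>r. D p0 r (c *\<^sub>R h)) = integral\<^sup>L M (\<lambda>r. c *\<^sub>R D p0 r h)"
        by (intro Bochner_Integration.integral_cong) (auto simp: linear_scale[OF linD])
      then show "integral\<^sup>L M (\<lambda>r. D p0 r (c *\<^sub>R h)) = c *\<^sub>R integral\<^sup>L M (\<lambda>r. D p0 r h)"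
        by simp
      have "norm (integral\<^sup>L M (\<lambda>r. D p0 r h)) \<le> integral\<^sup>L M (\<lambda>r. norm (D p0 r h))"
        by (rule integral_norm_bound)
      also have "\<dots> \<le> integral\<^sup>L M (\<lambda>r. w r * norm h)"
        by (rule integral_mono[OF integrable_norm[OF intD] integrable_mult_left[OF w] bd[OF p0]])
      finally have "norm (integral\<^sup>L M (\<lambda>r. D p0 r h)) \<le> integral\<^sup>L M (\<lambda>r. w r * norm h)" .
      then show "norm (integral\<^sup>L M (\<lambda>r. D p0 r h)) \<le> norm h * integral\<^sup>L M w"
        by (simp add: mult.commute)
    qed
    define Q where "Q p r = (f p r - f p0 r - D p0 r (p - p0)) /\<^sub>R norm (p - p0)" for p r
    have "((\<lambda>p. integral\<^sup>L M (Q p)) \<longlongrightarrow> integral\<^sup>L M (\<lambda>r. 0)) (at p0 within ball p0 e)"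
    proof (rule tendsto_integral_dominated[where w = "\<lambda>r. 2 * w r"])
      fix r assume r: "r \<in> space M"
      show "((\<lambda>p. Q p r) \<longlongrightarrow> 0) (at p0 within ball p0 e)"
        unfolding Q_def using D[OF p0 r] unfolding has_derivative_def
        by (auto intro: tendsto_mono[OF at_le])
    next
      fix p r assume pr: "p \<in> ball p0 e" "p \<noteq> p0" "r \<in> space M"
      have "norm (f p r - f p0 r - D p0 r (p - p0)) \<le> 2 * w r * norm (p - p0)"
        using lip[OF pr(1,3)] bd[OF p0 pr(3), of "p - p0"]
          norm_triangle_ineq4[of "f p r - f p0 r" "D p0 r (p - p0)"] by simp
      then show "norm (Q p r) \<le> 2 * w r"
        using pr(2) unfolding Q_def norm_scaleR
        by (simp add: inverse_eq_divide pos_divide_le_eq)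
    next
      fix p assume p: "p \<in> ball p0 e"
      show "Q p \<in> borel_measurable M"
        unfolding Q_def[abs_def]
        by (intro borel_measurable_scaleR borel_measurable_diff borel_measurable_const
            borel_measurable_integrable[OF int[OF p]] borel_measurable_integrable[OF int[OF p0]] meas)
    qed (use w in auto)
    moreover have "integral\<^sup>L M (Q p) = (integral\<^sup>L M (f p) - integral\<^sup>L M (f p0) -
        integral\<^sup>L M (\<lambda>r. D p0 r (p - p0))) /\<^sub>R norm (p - p0)" if "p \<in> ball p0 e" for p
      using int[OF that] int[OF p0] intD[of "p - p0"] by (simp add: Q_def[abs_def])
    moreover have "\<forall>\<^sub>F p in at p0 within ball p0 e. p \<in> ball p0 e"
      by (simp add: eventually_at_filter)
    ultimately have "((\<lambda>p. (integral\<^sup>L M (f p) - integral\<^sup>L M (f p0) -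
        integral\<^sup>L M (\<lambda>r. D p0 r (p - p0))) /\<^sub>R norm (p - p0)) \<longlongrightarrow> 0) (at p0 within ball p0 e)"
      by (auto elim!: Lim_transform_eventually eventually_mono)
    then have "((\<lambda>p. (integral\<^sup>L M (f p) - integral\<^sup>L M (f p0) -
        integral\<^sup>L M (\<lambda>r. D p0 r (p - p0))) /\<^sub>R norm (p - p0)) \<longlongrightarrow> 0) (at p0)"
      using e at_within_open[of p0 "ball p0 e"] by simp
    then show "(\<lambda>y. (integral\<^sup>L M (f y) - integral\<^sup>L M (f p0) -
         integral\<^sup>L M (\<lambda>r. D p0 r (y - p0))) /\<^sub>R norm (y - p0)) \<midarrow>p0\<rightarrow> 0" .
  qed
qed

section \<open>Twice continuous differentiability from partial derivatives\<close>

lemma has_derivative_blinfun_sum: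
  fixes p :: "'n::finite \<Rightarrow> real ^ 'n \<Rightarrow> real" and B :: "'n \<Rightarrow> 'b::real_normed_vector"
  assumes "\<And>i. (p i has_derivative (\<lambda>h. \<Sum>j\<in>UNIV. h $ j * q i j)) (at \<theta>)"
  shows "((\<lambda>\<theta>. \<Sum>i\<in>UNIV. p i \<theta> *\<^sub>R B i) has_derivative
    blinfun_apply (\<Sum>i\<in>UNIV. \<Sum>j\<in>UNIV. q i j *\<^sub>R
      (blinfun_scaleR_left (B i) o\<^sub>L blinfun_inner_right (axis j 1)))) (at \<theta>)"
proof -
  have "((\<lambda>\<theta>. \<Sum>i\<in>UNIV. p i \<theta> *\<^sub>R B i) has_derivative
      (\<lambda>h. \<Sum>i\<in>UNIV. (\<Sum>j\<in>UNIV. h $ j * q i j) *\<^sub>R B i)) (at \<theta>)"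
    by (intro has_derivative_sum has_derivative_scaleR_left assms)
  moreover have "blinfun_apply (\<Sum>i\<in>UNIV. \<Sum>j\<in>UNIV. q i j *\<^sub>R
      (blinfun_scaleR_left (B i) o\<^sub>L blinfun_inner_right (axis j 1))) =
      (\<lambda>h. \<Sum>i\<in>UNIV. (\<Sum>j\<in>UNIV. h $ j * q i j) *\<^sub>R B i)"
    by (rule ext) (simp add: blinfun.sum_left blinfun.scaleR_left inner_axis' scaleR_sum_left mult.commute)
  ultimately show ?thesis by simp
qed

text \<open>The derivative of \<open>f\<close> is assembled from the partials \<open>p i\<close> as
  a combination of coordinate functionals, and is then differentiated once more as a map into the
  space of bounded linear functionals. Its derivative is a finite combination of fixed maps with
  coefficients \<open>q i j\<close>, so their continuity carries over.\<close>

lemma C2_onI: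
  fixes f :: "real ^ 'n \<Rightarrow> real"
  assumes f: "\<And>\<theta>. \<theta> \<in> U \<Longrightarrow> (f has_derivative (\<lambda>h. \<Sum>i\<in>UNIV. h $ i * p i \<theta>)) (at \<theta>)"
    and p: "\<And>\<theta> i. \<theta> \<in> U \<Longrightarrow> (p i has_derivative (\<lambda>h. \<Sum>j\<in>UNIV. h $ j * q i j \<theta>)) (at \<theta>)"
    and q: "\<And>i j. continuous_on U (q i j)"
  shows "C2_on f U"
  unfolding C2_on_def
proof (intro exI conjI ballI)
  let ?B = "\<lambda>i::'n. blinfun_inner_right (axis i (1::real))"
  let ?g = "\<lambda>\<theta>. \<Sum>i\<in>UNIV. p i \<theta> *\<^sub>R ?B i"
  show "(f has_derivative blinfun_apply (?g \<theta>)) (at \<theta>)" if "\<theta> \<in> U" for \<theta>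
  proof -
    have "blinfun_apply (?g \<theta>) = (\<lambda>h. \<Sum>i\<in>UNIV. h $ i * p i \<theta>)"
      by (rule ext) (simp add: blinfun.sum_left blinfun.scaleR_left inner_axis' mult.commute)
    then show ?thesis using f[OF that] by simp
  qed
  show "C1_on ?g U"
    unfolding C1_on_def
  proof (intro exI conjI ballI)
    fix \<theta> assume "\<theta> \<in> U"
    show "(?g has_derivative blinfun_apply (\<Sum>i\<in>UNIV. \<Sum>j\<in>UNIV. q i j \<theta> *\<^sub>R
        (blinfun_scaleR_left (?B i) o\<^sub>L blinfun_inner_right (axis j 1)))) (at \<theta>)"
      by (rule has_derivative_blinfun_sum[OF p[OF \<open>\<theta> \<in> U\<close>]])
  qed (intro continuous_intros q)
qed

lemma partial_deriv_eq:
  fixes g :: "real ^ 'n::finite \<Rightarrow> real"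
  assumes "(g has_derivative (\<lambda>h. \<Sum>j\<in>UNIV. h $ j * q j)) (at \<theta>)"
  shows "partial_deriv i g \<theta> = q i"
proof -
  have "((\<lambda>s. g (\<theta> + s *\<^sub>R axis i 1)) has_derivative (\<lambda>s. \<Sum>j\<in>UNIV. (s *\<^sub>R axis i 1 :: real ^ 'n) $ j * q j)) (at 0)"
    by (rule has_derivative_compose[where g = g]) (use assms in \<open>auto intro!: derivative_eq_intros\<close>)
  also have "(\<lambda>s. \<Sum>j\<in>UNIV. (s *\<^sub>R axis i 1 :: real ^ 'n) $ j * q j) = (\<lambda>s. s * q i)"
  proof
    fix s :: real
    have "(\<Sum>j\<in>UNIV. (s *\<^sub>R axis i 1 :: real ^ 'n) $ j * q j) = (\<Sum>j\<in>UNIV. if j = i then s * q j else 0)"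
      by (intro sum.cong) (auto simp: axis_def)
    then show "(\<Sum>j\<in>UNIV. (s *\<^sub>R axis i 1 :: real ^ 'n) $ j * q j) = s * q i"
      by simp
  qed
  finally have "((\<lambda>s. g (\<theta> + s *\<^sub>R axis i 1)) has_field_derivative q i) (at 0)"
    by (simp add: has_field_derivative_def mult.commute[of "q i"] mult_commute_abs)
  then show ?thesis
    unfolding partial_deriv_def by (rule DERIV_imp_deriv)
qed

text \<open>Uniform in the exponent. For \<open>s \<le> 1\<close> the power \<open>s powr a\<close>
  pays for the logarithms, by \<open>- ln s \<le> k / a * s powr (- (a / k))\<close>; for
  \<open>s > 1\<close> every factor is polynomial. The offset 4 exceeds pi, so that
  \<open>4 + \<bar>ln s\<bar>\<close> also bounds the modulus of a principal complex
  logarithm.\<close>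

lemma log_powr_bound:
  fixes a :: real and k :: nat
  assumes a: "0 < a"
  obtains C where "C \<ge> 0"
    "\<And>s \<alpha>. 0 < s \<Longrightarrow> a \<le> \<alpha> \<Longrightarrow> \<alpha> \<le> 2 \<Longrightarrow> s powr \<alpha> * (4 + \<bar>ln s\<bar>) ^ k \<le> C * (1 + s) ^ (k + 2)"
proof
  define C where "C = (4 + real k / a) ^ k + 4 ^ k"
  show "C \<ge> 0" using a by (simp add: C_def)
  fix s \<alpha> :: real assume s: "0 < s" and \<alpha>: "a \<le> \<alpha>" "\<alpha> \<le> 2"
  show "s powr \<alpha> * (4 + \<bar>ln s\<bar>) ^ k \<le> C * (1 + s) ^ (k + 2)"
  proof (cases "s \<le> 1")
    case True
    have "s powr a * (4 + \<bar>ln s\<bar>) ^ k \<le> (4 + real k / a) ^ k"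
    proof (cases "k = 0")
      case True
      then show ?thesis using s \<open>s \<le> 1\<close> a by (simp add: powr_le1)
    next
      case False
      define t where "t = s powr (- (a / k))"
      have t1: "t \<ge> 1"
        using s \<open>s \<le> 1\<close> a False ge_one_powr_ge_zero[of "1/s" "a/k"]
        by (simp add: t_def powr_minus powr_divide inverse_eq_divide)
      have "- ln s = k / a * ln t"
        using s a False by (simp add: t_def ln_powr)
      also have "\<dots> \<le> k / a * t"
        using a t1 ln_bound[of t] by (intro mult_left_mono) auto
      finally have "4 + \<bar>ln s\<bar> \<le> 4 * t + k / a * t"
        using s \<open>s \<le> 1\<close> t1 by (auto simp: abs_if)
      then have "(4 + \<bar>ln s\<bar>) ^ k \<le> ((4 + k / a) * t) ^ k"
        by (intro power_mono) (auto simp: algebra_simps)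
      also have "\<dots> = (4 + k / a) ^ k * s powr (- a)"
        using False s by (simp add: power_mult_distrib t_def powr_power)
      finally have "s powr a * (4 + \<bar>ln s\<bar>) ^ k \<le> s powr a * ((4 + k / a) ^ k * s powr (- a))"
        by (intro mult_left_mono) auto
      also have "\<dots> = (4 + k / a) ^ k"
        using s by (simp add: powr_minus)
      finally show ?thesis .
    qed
    moreover have "s powr \<alpha> \<le> s powr a"
      using s True \<alpha> by (intro powr_mono') auto
    ultimately have "s powr \<alpha> * (4 + \<bar>ln s\<bar>) ^ k \<le> (4 + real k / a) ^ k"
      by (meson mult_right_mono order_trans zero_le_power add_nonneg_nonneg abs_ge_zero zero_le_numeral)
    also have "\<dots> \<le> C" by (simp add: C_def)
    also have "\<dots> \<le> C * (1 + s) ^ (k + 2)"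
      using \<open>C \<ge> 0\<close> s one_le_power[of "1 + s" "k + 2"] mult_left_mono[of 1 "(1 + s) ^ (k + 2)" C] by simp
    finally show ?thesis .
  next
    case False
    have "4 + \<bar>ln s\<bar> \<le> 4 * (1 + s)"
      using False ln_bound[of s] by auto
    then have "(4 + \<bar>ln s\<bar>) ^ k \<le> (4 * (1 + s)) ^ k"
      by (intro power_mono) auto
    moreover have "s powr \<alpha> \<le> (1 + s) ^ 2"
    proof -
      have "s powr \<alpha> \<le> s powr 2" using False \<alpha> by (intro powr_mono) auto
      also have "\<dots> \<le> (1 + s) ^ 2" using s by (simp add: powr_numeral power_mono)
      finally show ?thesis .
    qed
    ultimately have "s powr \<alpha> * (4 + \<bar>ln s\<bar>) ^ k \<le> (1 + s) ^ 2 * (4 * (1 + s)) ^ k"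
      using s by (intro mult_mono) auto
    also have "\<dots> = 4 ^ k * (1 + s) ^ (k + 2)"
      by (subst power_mult_distrib) (simp add: power_add power2_eq_square)
    also have "\<dots> \<le> C * (1 + s) ^ (k + 2)"
      using s a by (intro mult_right_mono) (auto simp: C_def)
    finally show ?thesis .
  qed
qed

section \<open>The skewness term as a holomorphic function of \<open>\<alpha>\<close>\<close>

text \<open>With w = (\<alpha> - 1) Ln r one has r^\<alpha> - r = r (exp w - 1). Dividing by w takes
  out the zero at \<open>\<alpha> = 1\<close> that compensates the pole of the tangent, and the
  quotient is entire in w.\<close>

definition expq :: "complex \<Rightarrow> complex" where
  "expq w = (if w = 0 then 1 else (exp w - 1) / w)"

lemma mult_expq: "w * expq w = exp w - 1"
  by (simp add: expq_def)

lemma expq_holomorphic: "expq holomorphic_on S"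
proof -
  have "(\<lambda>z. if z = 0 then deriv exp 0 else (exp z - exp 0) / (z - 0)) holomorphic_on (UNIV :: complex set)"
    by (intro pole_lemma_open holomorphic_intros) auto
  also have "(\<lambda>z. if z = 0 then deriv exp 0 else (exp z - exp 0) / (z - 0)) = expq"
    by (auto simp: fun_eq_iff expq_def DERIV_imp_deriv[OF DERIV_exp])
  finally show ?thesis
    using holomorphic_on_subset by blast
qed

text \<open>The quotient is the mean of \<open>exp\<close> over the segment from 0 to
  \<open>w\<close>, on which the real part is at most the larger of 0 and
  \<open>Re w\<close>.\<close>

lemma norm_expq_le: "norm (expq w) \<le> max 1 (exp (Re w))"
proof (cases "w = 0")
  case False
  have "norm (exp w - exp 0) \<le> max 1 (exp (Re w)) * norm (w - 0)"
  proof (rule field_differentiable_bound[where S = "closed_segment 0 w" and f' = exp])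
    show "norm (exp z) \<le> max 1 (exp (Re w))" if z: "z \<in> closed_segment 0 w" for z
    proof -
      obtain t where t: "0 \<le> t" "t \<le> 1" "z = t *\<^sub>R w"
        using z by (auto simp: in_segment)
      have "t * Re w \<le> max 0 (Re w)"
        using t mult_left_le_one_le[of "Re w" t] mult_nonneg_nonpos[of t "Re w"] by (cases "Re w \<ge> 0") auto
      then show ?thesis
        using t by (auto simp: max_def split: if_splits)
    qed
  qed (auto intro!: derivative_eq_intros)
  then show ?thesis
    using False by (simp add: expq_def norm_divide divide_simps)
qed (simp add: expq_def)

text \<open>Cauchy's inequality on the circle of radius 1 about \<open>w\<close>: the real part
  grows by at most 1 there, which costs the factor \<open>exp 1\<close>.\<close>

lemma norm_higher_deriv_expq: "norm ((deriv ^^ j) expq w) \<le> fact j * exp 1 * max 1 (exp (Re w))"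
proof -
  have "norm ((deriv ^^ j) expq w) \<le> fact j * (exp 1 * max 1 (exp (Re w))) / 1 ^ j"
  proof (rule Cauchy_inequality)
    show "continuous_on (cball w 1) expq"
      by (rule holomorphic_on_imp_continuous_on[OF expq_holomorphic])
    fix x assume "norm (w - x) = 1"
    then have "Re x \<le> Re w + 1"
      using abs_Re_le_cmod[of "w - x"] by simp
    then have "exp (Re x) \<le> exp 1 * exp (Re w)"
      by (simp flip: exp_add)
    moreover have "1 \<le> exp 1 * max 1 (exp (Re w))"
      using mult_mono[of 1 "exp 1" 1 "max 1 (exp (Re w))"] by simp
    ultimately have "max 1 (exp (Re x)) \<le> exp 1 * max 1 (exp (Re w))"
      by (smt (verit) max_def mult_left_mono exp_ge_zero)
    then show "norm (expq x) \<le> exp 1 * max 1 (exp (Re w))"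
      using norm_expq_le[of x] by linarith
  qed (auto intro: expq_holomorphic)
  then show ?thesis by (simp add: mult.assoc)
qed

text \<open>Near 1 the tangent behaves like -2 / (pi (z - 1)); this explains the sign and the value
  at 1.\<close>

definition tanC :: "complex \<Rightarrow> complex" where
  "tanC z = (if z = 1 then of_real (2 / pi) else - (z - 1) * tan (of_real pi * z / 2))"

text \<open>Shifting the argument by pi / 2 turns the tangent into minus a cotangent, so
  \<open>tanC\<close> is a cosine over the difference quotient \<open>D\<close> of sin (pi / 2 (z -
  1)) at 1. \<open>D\<close> has no zero in the disc: its value at 1 is pi / 2, and elsewhere the
  sine vanishes only where z - 1 is an even integer.\<close>

lemma tanC_holomorphic: "tanC holomorphic_on ball 1 1"
proof -
  let ?s = "\<lambda>z. sin (of_real pi / 2 * (z - 1)) :: complex"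
  define D where "D = (\<lambda>z. if z = 1 then deriv ?s 1 else (?s z - ?s 1) / (z - 1))"
  have "D holomorphic_on UNIV"
    unfolding D_def by (rule pole_lemma_open) (auto intro!: holomorphic_intros)
  then have D: "D holomorphic_on ball 1 1"
    by (rule holomorphic_on_subset) auto
  have D1: "D 1 = of_real pi / 2"
  proof -
    have "(?s has_field_derivative of_real pi / 2) (at 1)"
      by (auto intro!: derivative_eq_intros)
    then show ?thesis by (simp add: D_def DERIV_imp_deriv)
  qed
  have s0: "?s z \<noteq> 0" if "z \<in> ball 1 1" "z \<noteq> 1" for z
  proof
    assume "?s z = 0"
    then obtain n :: int where n: "of_real pi / 2 * (z - 1) = of_real (n * pi)"
      by (auto simp: sin_eq_0)
    have "of_real pi * (z - 1) = of_real pi * (2 * of_int n)"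
      using n by (simp add: field_simps)
    then have z: "z - 1 = 2 * of_int n"
      by (metis mult_left_cancel of_real_eq_0_iff pi_neq_zero)
    have "norm (z - 1) < 1"
      using that(1) by (simp add: dist_norm norm_minus_commute)
    then have "\<bar>2 * real_of_int n\<bar> < 1"
      unfolding z by (simp add: norm_mult)
    then have "n = 0" by linarith
    then show False using z that(2) by simp
  qed
  have "(\<lambda>z. cos (of_real pi / 2 * (z - 1)) / D z) holomorphic_on ball 1 1"
  proof (intro holomorphic_intros D)
    fix z :: complex assume "z \<in> ball 1 1"
    then show "D z \<noteq> 0"
      using s0[of z] by (cases "z = 1") (simp_all only: D1, auto simp: D_def)
  qed
  then show ?thesis
  proof (rule holomorphic_transform)
    fix z :: complex assume z: "z \<in> ball 1 1"
    show "cos (of_real pi / 2 * (z - 1)) / D z = tanC z"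
    proof (cases "z = 1")
      case True
      then show ?thesis by (simp add: D1 tanC_def)
    next
      case False
      have *: "of_real pi * z / 2 = of_real pi / 2 * (z - 1) + of_real pi / 2"
        by (simp add: field_simps)
      have "tan (of_real pi * z / 2) = - cos (of_real pi / 2 * (z - 1)) / ?s z"
        unfolding * tan_def by (simp add: sin_add cos_add flip: sin_of_real cos_of_real of_real_divide)
      then show ?thesis
        using False by (simp add: tanC_def D_def) (simp add: left_diff_distrib right_diff_distrib diff_divide_distrib)
    qed
  qed
qed

lemma tanC_of_real:
  "tanC (of_real \<alpha>) = of_real (if \<alpha> = 1 then 2 / pi else - (\<alpha> - 1) * tan (pi * \<alpha> / 2))"
  using tan_of_real[where 'a = complex, of "pi * \<alpha> / 2"] by (simp add: tanC_def)

section \<open>The skewness term and its parameter derivatives on the slit plane\<close>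

definition slit :: "complex set" where "slit = - \<real>\<^sub>\<le>\<^sub>0"

lemma open_slit: "open slit"
  by (simp add: slit_def open_Compl)

lemma slit_nonzero: "r \<in> slit \<Longrightarrow> r \<noteq> 0"
  by (auto simp: slit_def)

lemma of_real_in_slit: "0 < x \<Longrightarrow> of_real x \<in> slit"
  by (simp add: slit_def)

lemma Re_pos_in_slit: "0 < Re r \<Longrightarrow> r \<in> slit"
  by (auto simp: slit_def complex_nonpos_Reals_iff)

lemma neg_imag_in_slit: "0 < u \<Longrightarrow> - \<i> * of_real u \<in> slit"
  by (auto simp: slit_def complex_nonpos_Reals_iff)

lemma norm_Ln_le: "r \<noteq> 0 \<Longrightarrow> norm (Ln r) \<le> 4 + \<bar>ln (norm r)\<bar>"
  using cmod_le[of "Ln r"] mpi_less_Im_Ln[of r] Im_Ln_le_pi[of r] pi_less_4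
  by simp

text \<open>For real \<open>\<alpha> \<noteq> 1\<close> this is \<open>tan (\<pi> \<alpha> / 2) * (r - r\<^sup>\<alpha>)\<close>; the product form shows that the
  singularity at \<open>\<alpha> = 1\<close> is removable.\<close>

definition stabK :: "complex \<Rightarrow> complex \<Rightarrow> complex" where
  "stabK z r = r * Ln r * (tanC z * expq (Ln r * z + - Ln r))"

text \<open>Complex differentiation in the parameter yields the derivatives of every order in
  \<alpha> together with Leibniz and Cauchy bounds for them.\<close>

definition stabKd :: "nat \<Rightarrow> real \<Rightarrow> complex \<Rightarrow> complex" where
  "stabKd j \<alpha> r = (deriv ^^ j) (\<lambda>z. stabK z r) (of_real \<alpha>)"

lemma stabK_holomorphic_param: "(\<lambda>z. stabK z r) holomorphic_on ball 1 1"
proof -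
  have "(\<lambda>z. expq (Ln r * z + - Ln r)) holomorphic_on ball 1 1"
    by (rule holomorphic_on_compose[of _ _ expq, unfolded comp_def])
      (intro holomorphic_intros expq_holomorphic)+
  then show ?thesis
    unfolding stabK_def by (intro holomorphic_intros tanC_holomorphic)
qed

lemma in_ball_1_1: "0 < \<alpha> \<Longrightarrow> \<alpha> < 2 \<Longrightarrow> complex_of_real \<alpha> \<in> ball 1 1"
  using dist_of_real[where 'a = complex, of 1 \<alpha>] by (auto simp: dist_real_def)

text \<open>Leibniz rule in the parameter. The argument of \<open>expq\<close> is affine in
  \<open>z\<close> with slope \<open>Ln r\<close>, so each derivative that falls on
  \<open>expq\<close> brings one factor \<open>Ln r\<close>. Holomorphy in \<open>r\<close> and the
  growth in \<open>r\<close> are both read off from this formula.\<close>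

lemma stabKd_expand:
  assumes "0 < \<alpha>" "\<alpha> < 2"
  shows "stabKd j \<alpha> r = r * Ln r * (\<Sum>i=0..j. of_nat (j choose i) * (deriv ^^ i) tanC (of_real \<alpha>) *
    (Ln r ^ (j - i) * (deriv ^^ (j - i)) expq (Ln r * of_real \<alpha> + - Ln r)))"
proof -
  note \<alpha> = in_ball_1_1[OF assms]
  have h: "(\<lambda>z. expq (Ln r * z + - Ln r)) holomorphic_on ball 1 1"
    by (rule holomorphic_on_compose[of _ _ expq, unfolded comp_def])
      (intro holomorphic_intros expq_holomorphic)+
  have "stabKd j \<alpha> r = r * Ln r * (deriv ^^ j) (\<lambda>z. tanC z * expq (Ln r * z + - Ln r)) (of_real \<alpha>)"
    unfolding stabKd_def stabK_def
    by (rule higher_deriv_cmult[OF holomorphic_on_mult[OF tanC_holomorphic h] \<alpha> open_ball])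
  also have "(deriv ^^ j) (\<lambda>z. tanC z * expq (Ln r * z + - Ln r)) (of_real \<alpha>) =
    (\<Sum>i=0..j. of_nat (j choose i) * (deriv ^^ i) tanC (of_real \<alpha>) *
      (deriv ^^ (j - i)) (\<lambda>z. expq (Ln r * z + - Ln r)) (of_real \<alpha>))"
    by (rule higher_deriv_mult[OF tanC_holomorphic h]) (use \<alpha> in auto)
  also have "\<dots> = (\<Sum>i=0..j. of_nat (j choose i) * (deriv ^^ i) tanC (of_real \<alpha>) *
    (Ln r ^ (j - i) * (deriv ^^ (j - i)) expq (Ln r * of_real \<alpha> + - Ln r)))"
    by (intro sum.cong refl arg_cong2[of _ _ _ _ "(*)"]
        higher_deriv_compose_linear'[where S = UNIV and T = UNIV] expq_holomorphic) auto
  finally show ?thesis .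
qed

lemma stabKd_holomorphic:
  assumes "0 < \<alpha>" "\<alpha> < 2"
  shows "stabKd j \<alpha> holomorphic_on slit"
proof -
  have "(\<lambda>r. (deriv ^^ i) expq (Ln r * of_real \<alpha> + - Ln r)) holomorphic_on slit" for i
    by (rule holomorphic_on_compose[of _ _ "(deriv ^^ i) expq", unfolded comp_def])
      (auto intro!: holomorphic_intros holomorphic_on_subset[OF holomorphic_higher_deriv[OF expq_holomorphic open_UNIV]]
        simp: slit_def)
  then show ?thesis
    unfolding stabKd_expand[OF assms] by (auto intro!: holomorphic_intros simp: slit_def)
qed

text \<open>The derivatives of \<open>tanC\<close> are bounded on the compact interval
  \<open>{a..b}\<close>. With \<open>s = norm r\<close>, those of \<open>expq\<close> are bounded by
  a constant times \<open>max 1 (s powr (\<alpha> - 1))\<close>; multiplied by the leading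
  \<open>r\<close> this is at most \<open>s + s powr \<alpha>\<close>. The at most
  \<open>j + 1\<close> logarithms are absorbed by \<open>log_powr_bound\<close>, which gives the
  exponent \<open>j + 3\<close>.\<close>

lemma stabKd_bound:
  assumes ab: "0 < a" "b < 2"
  obtains C where "C \<ge> 0"
    "\<And>\<alpha> r. a \<le> \<alpha> \<Longrightarrow> \<alpha> \<le> b \<Longrightarrow> r \<in> slit \<Longrightarrow> norm (stabKd j \<alpha> r) \<le> C * (1 + norm r) ^ (j + 3)"
proof -
  have "\<exists>M. \<forall>\<alpha>\<in>{a..b}. norm ((deriv ^^ i) tanC (of_real \<alpha>)) \<le> M" for i
  proof -
    have "compact ((\<lambda>\<alpha>. (deriv ^^ i) tanC (of_real \<alpha>)) ` {a..b})"
    proof (intro compact_continuous_image)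
      have "continuous_on (ball 1 1) ((deriv ^^ i) tanC)"
        by (intro holomorphic_on_imp_continuous_on holomorphic_higher_deriv tanC_holomorphic) auto
      then show "continuous_on {a..b} (\<lambda>\<alpha>. (deriv ^^ i) tanC (of_real \<alpha>))"
        by (rule continuous_on_compose2) (use ab in_ball_1_1 in \<open>force intro!: continuous_intros\<close>)+
    qed auto
    then show ?thesis
      using compact_imp_bounded bounded_iff by (metis (mono_tags, lifting) imageI)
  qed
  then obtain M where M: "\<And>i \<alpha>. a \<le> \<alpha> \<Longrightarrow> \<alpha> \<le> b \<Longrightarrow> norm ((deriv ^^ i) tanC (of_real \<alpha>)) \<le> M i"
    by (metis atLeastAtMost_iff)
  \<comment> \<open>The logarithmic bound is applied with the exponents 1 and
    \<open>\<alpha>\<close>, so its lower end must lie below both.\<close>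
  define a' where "a' = min a 1"
  have a': "0 < a'" using ab by (simp add: a'_def)
  have "\<exists>C\<ge>0. \<forall>s \<alpha>. 0 < s \<longrightarrow> a' \<le> \<alpha> \<longrightarrow> \<alpha> \<le> 2 \<longrightarrow> s powr \<alpha> * (4 + \<bar>ln s\<bar>) ^ k \<le> C * (1 + s) ^ (k + 2)" for k
    using log_powr_bound[OF a', of k] by metis
  then obtain N where N0: "\<And>k. N k \<ge> 0" and
    N: "\<And>k s \<alpha>. 0 < s \<Longrightarrow> a' \<le> \<alpha> \<Longrightarrow> \<alpha> \<le> 2 \<Longrightarrow> s powr \<alpha> * (4 + \<bar>ln s\<bar>) ^ k \<le> N k * (1 + s) ^ (k + 2)"
    by metis
  define C where "C = (\<Sum>i=0..j. of_nat (j choose i) * \<bar>M i\<bar> * (fact (j - i) * exp 1) * (2 * N (Suc (j - i))))"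
  show ?thesis
  proof
    show "C \<ge> 0" unfolding C_def using N0 by (intro sum_nonneg) auto
    fix \<alpha> r assume \<alpha>: "a \<le> \<alpha>" "\<alpha> \<le> b" and r: "r \<in> slit"
    define s where "s = norm r"
    have s: "s > 0" using slit_nonzero[OF r] by (simp add: s_def)
    have \<alpha>02: "0 < \<alpha>" "\<alpha> < 2" using \<alpha> ab by auto
    have q: "norm r * (norm (Ln r) ^ Suc n * norm ((deriv ^^ n) expq (Ln r * of_real \<alpha> + - Ln r)))
      \<le> fact n * exp 1 * (2 * N (Suc n)) * (1 + s) ^ (j + 3)" if "n \<le> j" for n
    proof -
      have "exp (Re (Ln r * of_real \<alpha> + - Ln r)) = s powr (\<alpha> - 1)"
        using s slit_nonzero[OF r] by (simp add: powr_def s_def algebra_simps)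
      then have "norm ((deriv ^^ n) expq (Ln r * of_real \<alpha> + - Ln r)) \<le> fact n * exp 1 * max 1 (s powr (\<alpha> - 1))"
        using norm_higher_deriv_expq[of n "Ln r * of_real \<alpha> + - Ln r"] by simp
      moreover have "norm (Ln r) ^ Suc n \<le> (4 + \<bar>ln s\<bar>) ^ Suc n"
        using norm_Ln_le[OF slit_nonzero[OF r]] by (intro power_mono) (auto simp: s_def)
      ultimately have "norm r * (norm (Ln r) ^ Suc n * norm ((deriv ^^ n) expq (Ln r * of_real \<alpha> + - Ln r)))
        \<le> s * ((4 + \<bar>ln s\<bar>) ^ Suc n * (fact n * exp 1 * max 1 (s powr (\<alpha> - 1))))"
        using s unfolding s_def[symmetric] by (intro mult_left_mono mult_mono) auto
      also have "\<dots> = fact n * exp 1 * (s * max 1 (s powr (\<alpha> - 1)) * (4 + \<bar>ln s\<bar>) ^ Suc n)"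
        by (simp add: algebra_simps)
      also have "s * max 1 (s powr (\<alpha> - 1)) \<le> s powr 1 + s powr \<alpha>"
        using s powr_add[of s 1 "\<alpha> - 1"] by (auto simp: max_def)
      then have "fact n * exp 1 * (s * max 1 (s powr (\<alpha> - 1)) * (4 + \<bar>ln s\<bar>) ^ Suc n)
        \<le> fact n * exp 1 * ((s powr 1 + s powr \<alpha>) * (4 + \<bar>ln s\<bar>) ^ Suc n)"
        by (intro mult_left_mono mult_right_mono) auto
      also have "(s powr 1 + s powr \<alpha>) * (4 + \<bar>ln s\<bar>) ^ Suc n \<le> 2 * N (Suc n) * (1 + s) ^ (n + 3)"
      proof -
        have *: "Suc n + 2 = n + 3" by simp
        show ?thesis
          using N[OF s, of 1 "Suc n"] N[OF s, of \<alpha> "Suc n"] \<alpha> ab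
          unfolding a'_def distrib_right * by linarith
      qed
      also have "\<dots> \<le> 2 * N (Suc n) * (1 + s) ^ (j + 3)"
        using that s N0 by (intro mult_left_mono power_increasing) auto
      finally show ?thesis by (simp add: mult.assoc)
    qed
    have "norm (stabKd j \<alpha> r) \<le> (\<Sum>i=0..j. norm (of_nat (j choose i) * (deriv ^^ i) tanC (of_real \<alpha>)) *
        (norm r * (norm (Ln r) ^ Suc (j - i) * norm ((deriv ^^ (j - i)) expq (Ln r * of_real \<alpha> + - Ln r)))))"
      unfolding stabKd_expand[OF \<alpha>02] sum_distrib_left
      by (rule order_trans[OF norm_sum]) (simp add: norm_mult norm_power algebra_simps)
    also have "\<dots> \<le> (\<Sum>i=0..j. (of_nat (j choose i) * \<bar>M i\<bar>) *
        (fact (j - i) * exp 1 * (2 * N (Suc (j - i))) * (1 + s) ^ (j + 3)))"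
      using M[OF \<alpha>] by (intro sum_mono mult_mono q)
        (auto simp: norm_mult intro!: mult_mono order_trans[OF _ abs_ge_self])
    also have "\<dots> = C * (1 + norm r) ^ (j + 3)"
      by (simp add: C_def s_def sum_distrib_right mult.assoc)
    finally show "norm (stabKd j \<alpha> r) \<le> C * (1 + norm r) ^ (j + 3)" .
  qed
qed

section \<open>The skewness term on the positive real and the negative imaginary axis\<close>

lemma stabKd_has_vector_derivative:
  assumes "0 < \<alpha>" "\<alpha> < 2"
  shows "((\<lambda>\<alpha>. stabKd j \<alpha> r) has_vector_derivative stabKd (Suc j) \<alpha> r) (at \<alpha> within S)"
  unfolding stabKd_def
  by (rule has_vector_derivative_real_field)
    (rule has_field_derivative_higher_deriv[OF stabK_holomorphic_param open_ball in_ball_1_1[OF assms]])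

text \<open>Differentiation in a real parameter commutes with \<open>Im\<close>, so an identity of
  imaginary parts on an open set passes from each order to the next. Explicit formulas for the
  skewness term are thus needed only at order 0.\<close>

lemma Im_higher_derivs_eq:
  fixes F G :: "nat \<Rightarrow> real \<Rightarrow> complex"
  assumes "open S"
    and F: "\<And>j \<alpha>. \<alpha> \<in> S \<Longrightarrow> (F j has_vector_derivative F (Suc j) \<alpha>) (at \<alpha>)"
    and G: "\<And>j \<alpha>. \<alpha> \<in> S \<Longrightarrow> (G j has_vector_derivative G (Suc j) \<alpha>) (at \<alpha>)"
    and base: "\<And>\<alpha>. \<alpha> \<in> S \<Longrightarrow> Im (F 0 \<alpha>) = Im (G 0 \<alpha>)" and "\<alpha> \<in> S"
  shows "Im (F j \<alpha>) = Im (G j \<alpha>)"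
  using \<open>\<alpha> \<in> S\<close>
proof (induction j arbitrary: \<alpha>)
  case (Suc j)
  have "((\<lambda>\<alpha>. Im (F j \<alpha>)) has_vector_derivative Im (F (Suc j) \<alpha>)) (at \<alpha>)"
    by (rule bounded_linear.has_vector_derivative[OF bounded_linear_Im F[OF Suc.prems]])
  moreover have "((\<lambda>\<alpha>. Im (F j \<alpha>)) has_vector_derivative Im (G (Suc j) \<alpha>)) (at \<alpha>)"
    by (rule has_vector_derivative_transform_within_open[OF
          bounded_linear.has_vector_derivative[OF bounded_linear_Im G[OF Suc.prems]] \<open>open S\<close> Suc.prems])
      (use Suc.IH in auto)
  ultimately show ?case
    by (rule vector_derivative_unique_at)
qed (use base in auto)

lemma stabKd_0_eq: "stabKd 0 \<alpha> r = r * Ln r * (tanC (of_real \<alpha>) * expq (Ln r * of_real \<alpha> + - Ln r))"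
  by (simp add: stabKd_def stabK_def)

lemma stabKd_0_neq_1:
  assumes "\<alpha> \<noteq> 1" "r \<noteq> 0"
  shows "stabKd 0 \<alpha> r = of_real (tan (pi * \<alpha> / 2)) * (r - exp (of_real \<alpha> * Ln r))"
proof -
  let ?w = "Ln r * of_real \<alpha> + - Ln r"
  have "exp ?w = exp (of_real \<alpha> * Ln r) / r"
    using assms(2) by (simp add: exp_diff mult.commute)
  moreover have "stabKd 0 \<alpha> r = - of_real (tan (pi * \<alpha> / 2)) * (r * (?w * expq ?w))"
    using assms(1) by (simp add: stabKd_0_eq tanC_of_real algebra_simps)
  ultimately show ?thesis
    using assms(2) by (simp add: mult_expq field_simps)
qed

lemma stabKd_0_1: "stabKd 0 1 r = of_real (2 / pi) * (r * Ln r)"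
  by (simp add: stabKd_0_eq tanC_def expq_def)

text \<open>Comparison with the zero sequence. It makes the skewness term a pure phase on the path
  of integration, which determines the modulus of the kernel and its behaviour under
  conjugation.\<close>

lemma stabKd_real:
  assumes "0 < \<alpha>" "\<alpha> < 2" "0 < x"
  shows "Im (stabKd j \<alpha> (of_real x)) = 0"
proof -
  have "Im (stabKd j \<alpha> (of_real x)) = Im (0 :: complex)"
  proof (rule Im_higher_derivs_eq[where S = "{0<..<2}" and F = "\<lambda>j \<alpha>. stabKd j \<alpha> (of_real x)" and G = "\<lambda>j \<alpha>. 0"])
    fix \<alpha> :: real
    show "Im (stabKd 0 \<alpha> (of_real x)) = Im 0"
    proof (cases "\<alpha> = 1")
      case False
      then show ?thesis
        using assms(3) by (simp add: stabKd_0_neq_1 Ln_of_real Im_exp)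
    qed (use assms(3) in \<open>simp add: stabKd_0_1 Ln_of_real flip: of_real_mult\<close>)
  qed (use assms stabKd_has_vector_derivative in auto)
  then show ?thesis by simp
qed

lemma Ln_neg_imag: "0 < u \<Longrightarrow> Ln (- \<i> * of_real u) = of_real (ln u) - \<i> * of_real (pi / 2)"
  using Ln_times_of_real[of u "-\<i>"] by (simp add: mult.commute Ln_minus_ii Ln_of_real)

text \<open>The pole of the tangent disappears because \<open>tan (pi * \<alpha> / 2)\<close> meets
  \<open>cos (pi * \<alpha> / 2)\<close>. The resulting
  \<open>u powr \<alpha> * sin (pi * \<alpha> / 2)\<close> is written as the imaginary part of exp
  (\<alpha> c), since then each derivative in \<alpha> is multiplication by \<open>c\<close>, that
  is, one logarithm.\<close>

lemma Im_stabKd_neg_imag: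
  assumes "0 < \<alpha>" "\<alpha> < 2" "0 < u"
  defines "c \<equiv> of_real (ln u) + \<i> * of_real (pi / 2)"
  shows "Im (- \<i> * stabKd j \<alpha> (- \<i> * of_real u)) = Im (c ^ j * exp (of_real \<alpha> * c))"
proof (rule Im_higher_derivs_eq[where S = "{0<..<2}" and F = "\<lambda>j \<alpha>. - \<i> * stabKd j \<alpha> (- \<i> * of_real u)"
      and G = "\<lambda>j \<alpha>. c ^ j * exp (of_real \<alpha> * c)"])
  fix \<alpha> :: real assume "\<alpha> \<in> {0<..<2}"
  let ?r = "- \<i> * complex_of_real u"
  have "of_real \<alpha> * Ln ?r = of_real (\<alpha> * ln u) + \<i> * of_real (- (pi * \<alpha> / 2))"
    by (simp only: Ln_neg_imag[OF \<open>0 < u\<close>]) (simp add: algebra_simps)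
  then have e: "exp (of_real \<alpha> * Ln ?r) = of_real (u powr \<alpha>) * cis (- (pi * \<alpha> / 2))"
    using \<open>0 < u\<close> by (simp only: exp_add cis_conv_exp exp_of_real powr_def) simp
  have "of_real \<alpha> * c = of_real (\<alpha> * ln u) + \<i> * of_real (pi * \<alpha> / 2)"
    by (simp add: c_def algebra_simps)
  then have e': "exp (of_real \<alpha> * c) = of_real (u powr \<alpha>) * cis (pi * \<alpha> / 2)"
    using \<open>0 < u\<close> by (simp only: exp_add cis_conv_exp exp_of_real powr_def) simp
  show "Im (- \<i> * stabKd 0 \<alpha> ?r) = Im (c ^ 0 * exp (of_real \<alpha> * c))"
  proof (cases "\<alpha> = 1")
    case True
    then show ?thesis
      using \<open>0 < u\<close> unfolding e' by (simp add: stabKd_0_1 Ln_neg_imag[simplified])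
  next
    case False
    have "cos (pi * \<alpha> / 2) \<noteq> 0"
      using cos_inj_pi[of "pi * \<alpha> / 2" "pi / 2"] False \<open>\<alpha> \<in> {0<..<2}\<close> by auto
    then show ?thesis
      using False \<open>0 < u\<close> unfolding e' by (simp add: stabKd_0_neq_1 e[simplified] tan_def)
  qed
next
  fix j and \<alpha> :: real
  show "((\<lambda>\<alpha>. c ^ j * exp (of_real \<alpha> * c)) has_vector_derivative c ^ Suc j * exp (of_real \<alpha> * c)) (at \<alpha>)"
    by (rule has_vector_derivative_real_field) (auto intro!: derivative_eq_intros)
next
  fix j and \<alpha>' :: real assume "\<alpha>' \<in> {0<..<2}"
  then show "((\<lambda>\<alpha>. - \<i> * stabKd j \<alpha> (- \<i> * of_real u)) has_vector_derivative
      - \<i> * stabKd (Suc j) \<alpha>' (- \<i> * of_real u)) (at \<alpha>')"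
    by (intro has_vector_derivative_mult_right stabKd_has_vector_derivative) auto
qed (use assms in auto)

section \<open>Differentiation of the inversion integral\<close>

abbreviation halfline :: "real measure" where
  "halfline \<equiv> restrict_space lborel {0<..}"

lemma space_halfline: "space halfline = {0<..}"
  by (simp add: space_restrict_space)

lemma measurable_halfline:
  fixes f :: "real \<Rightarrow> 'b::topological_space"
  shows "continuous_on {0<..} f \<Longrightarrow> f \<in> borel_measurable halfline"
  using borel_measurable_continuous_on_restrict[of "{0<..}" f]
  by (simp cong: measurable_cong_sets add: sets_restrict_space_cong[OF sets_lborel])

text \<open>With \<open>N \<ge> k / a\<close> one has r^k \<le> (r^a)^N for r \<ge> 1, and (c r^a /
  N)^N \<le> (1 + c r^a / N)^N \<le> exp (c r^a).\<close>

lemma power_le_exp_powr: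
  fixes a c :: real
  assumes "0 < a" "0 < c"
  obtains K where "K > 0" "\<And>r. 0 < r \<Longrightarrow> (1 + r) ^ k \<le> K * exp (c * r powr a)"
proof
  define N where "N = Suc (nat \<lceil>real k / a\<rceil>)"
  define K where "K = 2 ^ k * (1 + real N ^ N / c ^ N)"
  have "K \<ge> 0" using assms by (simp add: K_def)
  show "K > 0" unfolding K_def using assms
    by (intro mult_pos_pos add_pos_nonneg) auto
  fix r :: real assume r: "0 < r"
  show "(1 + r) ^ k \<le> K * exp (c * r powr a)"
  proof (cases "r \<le> 1")
    case True
    have "(1 + r) ^ k \<le> 2 ^ k" using True r by (intro power_mono) auto
    also have "\<dots> \<le> K * 1" using assms by (simp add: K_def)
    also have "\<dots> \<le> K * exp (c * r powr a)"
      using \<open>K \<ge> 0\<close> assms by (intro mult_left_mono) auto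
    finally show ?thesis .
  next
    case False
    have "(1 + r) ^ k \<le> (2 * r) ^ k" using False by (intro power_mono) auto
    also have "\<dots> = 2 ^ k * r powr k" using r by (simp add: power_mult_distrib powr_realpow)
    also have "\<dots> \<le> 2 ^ k * r powr (a * N)"
    proof -
      have "real k / a \<le> N" unfolding N_def by linarith
      then have "real k \<le> a * N" using assms by (simp add: field_simps)
      then show ?thesis using False by (intro mult_left_mono powr_mono) auto
    qed
    also have "r powr (a * N) = (r powr a) ^ N" using r by (simp add: powr_powr flip: powr_realpow)
    also have "\<dots> \<le> real N ^ N / c ^ N * exp (c * r powr a)"
    proof -
      have "(c * r powr a / N) ^ N \<le> (1 + c * r powr a / N) ^ N"
        using assms by (intro power_mono) auto
      also have "\<dots> \<le> exp (c * r powr a)"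
      proof (rule exp_ge_one_plus_x_over_n_power_n)
        have "0 \<le> c * r powr a" using assms by simp
        then show "- real N \<le> c * r powr a" by linarith
      qed (simp add: N_def)
      finally have "(c * r powr a / N) ^ N \<le> exp (c * r powr a)" .
      then have "c ^ N * (r powr a) ^ N / real N ^ N \<le> exp (c * r powr a)"
        by (simp only: power_mult_distrib power_divide)
      moreover have "real N > 0" by (simp add: N_def)
      then have "real N ^ N > 0" "c ^ N > 0" using assms zero_less_power by blast+
      ultimately show ?thesis by (simp add: field_simps)
    qed
    also have "2 ^ k * (real N ^ N / c ^ N * exp (c * r powr a)) \<le> K * exp (c * r powr a)"
      using assms by (simp add: K_def algebra_simps)
    finally show ?thesis by simp
  qed
qed

lemma integrable_halfline_inverse_square: "integrable halfline (\<lambda>r. 1 / (1 + r)\<^sup>2)"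
proof -
  have "(\<integral>\<^sup>+r. ennreal (1 / (1 + r)\<^sup>2) * indicator {0..} r \<partial>lborel) = ennreal (0 - (- 1 / (1 + 0)))"
  proof (rule nn_integral_FTC_atLeast)
    show "((\<lambda>r. - 1 / (1 + r)) has_real_derivative 1 / (1 + r)\<^sup>2) (at r)" if "0 \<le> r" for r :: real
      using that by (auto intro!: derivative_eq_intros simp: power2_eq_square)
    show "((\<lambda>r::real. - 1 / (1 + r)) \<longlongrightarrow> 0) at_top" by real_asymp
  qed auto
  then have fin: "(\<integral>\<^sup>+r. ennreal (1 / (1 + r)\<^sup>2) * indicator {0..} r \<partial>lborel) < \<infinity>"
    by simp
  have "(\<integral>\<^sup>+r. ennreal (indicator {0<..} r *\<^sub>R (1 / (1 + r)\<^sup>2)) \<partial>lborel) \<le>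
      (\<integral>\<^sup>+r. ennreal (1 / (1 + r)\<^sup>2) * indicator {0..} r \<partial>lborel)"
    by (intro nn_integral_mono) (auto simp: indicator_def)
  then have "(\<integral>\<^sup>+r. ennreal (indicator {0<..} r *\<^sub>R (1 / (1 + r)\<^sup>2)) \<partial>lborel) < \<infinity>"
    using fin by (rule le_less_trans)
  then have "integrable lborel (\<lambda>r. indicator {0<..} r *\<^sub>R (1 / (1 + r :: real)\<^sup>2))"
    by (intro integrableI_nonneg) auto
  then show ?thesis by (subst integrable_restrict_space) auto
qed

lemma integrable_power_exp_powr:
  assumes "0 < a" "0 < c"
  shows "integrable halfline (\<lambda>r. (1 + r) ^ k * exp (- c * r powr a))"
proof -
  \<comment> \<open>The two spare powers leave the integrable majorant
    \<open>K / (1 + r)\<^sup>2\<close>.\<close>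
  obtain K where K: "K > 0" "\<And>r. 0 < r \<Longrightarrow> (1 + r) ^ (k + 2) \<le> K * exp (c * r powr a)"
    using power_le_exp_powr[OF assms] by metis
  have "integrable halfline (\<lambda>r. K * (1 / (1 + r)\<^sup>2))"
    by (rule integrable_mult_right[OF integrable_halfline_inverse_square])
  then show ?thesis
  proof (rule Bochner_Integration.integrable_bound)
    show "(\<lambda>r. (1 + r) ^ k * exp (- c * r powr a)) \<in> borel_measurable halfline"
      by (intro measurable_halfline continuous_intros) auto
    show "AE r in halfline. norm ((1 + r) ^ k * exp (- c * r powr a)) \<le> norm (K * (1 / (1 + r)\<^sup>2))"
    proof (rule AE_I2)
      fix r assume "r \<in> space halfline"
      then have "0 < r" by (simp add: space_halfline)
      then show "norm ((1 + r) ^ k * exp (- c * r powr a)) \<le> norm (K * (1 / (1 + r)\<^sup>2))"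
      proof -
        have "(1 + r) ^ k * exp (- c * r powr a) * (1 + r)\<^sup>2 = exp (- c * r powr a) * (1 + r) ^ (k + 2)"
          by (simp only: power_add ac_simps)
        also have "\<dots> \<le> exp (- c * r powr a) * (K * exp (c * r powr a))"
          using K(2)[OF \<open>0 < r\<close>] by (intro mult_left_mono) auto
        also have "\<dots> = K" by (simp add: exp_minus)
        finally show ?thesis
          using \<open>0 < r\<close> K(1) by (simp add: pos_le_divide_eq abs_mult)
      qed
    qed
  qed
qed

section \<open>Multipliers: factors in \<open>\<alpha>\<close>, \<open>\<beta>\<close> and
  \<open>r\<close>, free of m, that derivatives place before the kernel\<close>

type_synonym mult = "real \<Rightarrow> real \<Rightarrow> complex \<Rightarrow> complex"

text \<open>The exponent of the integrand is \<open>i m r + mD 0\<close>; its derivatives with respect to \<open>m\<close>, \<open>\<beta>\<close> and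
  \<open>\<alpha>\<close> are \<open>mA\<close>, \<open>mB 0\<close> and \<open>mD 1\<close>, and \<open>\<partial>/\<partial>\<alpha>\<close> raises the index of \<open>mB\<close> and \<open>mD\<close>.\<close>

definition mA :: mult where "mA \<alpha> \<beta> r = \<i> * r"
definition mB :: "nat \<Rightarrow> mult" where "mB j \<alpha> \<beta> r = - \<i> * stabKd j \<alpha> r"
definition mD :: "nat \<Rightarrow> mult" where
  "mD j \<alpha> \<beta> r = - (Ln r ^ j * exp (of_real \<alpha> * Ln r)) + of_real \<beta> * mB j \<alpha> \<beta> r"

abbreviation mone :: mult where "mone \<equiv> \<lambda>\<alpha> \<beta> r. 1"
abbreviation mtimes :: "mult \<Rightarrow> mult \<Rightarrow> mult" where "mtimes P Q \<equiv> \<lambda>\<alpha> \<beta> r. P \<alpha> \<beta> r * Q \<alpha> \<beta> r"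
abbreviation mplus :: "mult \<Rightarrow> mult \<Rightarrow> mult" where "mplus P Q \<equiv> \<lambda>\<alpha> \<beta> r. P \<alpha> \<beta> r + Q \<alpha> \<beta> r"

text \<open>Holomorphy in \<open>r\<close> serves the contour shift, continuity in the parameters
  the joint continuity, and the polynomial bound the domination. The bound is locally uniform in the
  parameters and holds on all of \<open>slit\<close>, hence also excludes a blow-up at
  \<open>r = 0\<close>.\<close>

definition admissible :: "mult \<Rightarrow> bool" where
  "admissible P \<longleftrightarrow>
    (\<forall>\<alpha> \<beta>. 0 < \<alpha> \<longrightarrow> \<alpha> < 2 \<longrightarrow> P \<alpha> \<beta> holomorphic_on slit) \<and>
    (\<forall>r\<in>slit. continuous_on ({0<..<2} \<times> UNIV) (\<lambda>q. P (fst q) (snd q) r)) \<and>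
    (\<forall>a b c. 0 < a \<longrightarrow> b < 2 \<longrightarrow> (\<exists>C n. C \<ge> 0 \<and> (\<forall>\<alpha> \<beta> r. a \<le> \<alpha> \<longrightarrow> \<alpha> \<le> b \<longrightarrow> \<bar>\<beta>\<bar> \<le> c \<longrightarrow> r \<in> slit \<longrightarrow>
      norm (P \<alpha> \<beta> r) \<le> C * (1 + norm r) ^ n)))"

lemma admissible_holomorphic:
  "admissible P \<Longrightarrow> 0 < \<alpha> \<Longrightarrow> \<alpha> < 2 \<Longrightarrow> P \<alpha> \<beta> holomorphic_on slit"
  by (simp add: admissible_def)

lemma admissible_bound:
  assumes "admissible P" "0 < a" "b < 2"
  obtains C n where "C \<ge> 0" "\<And>\<alpha> \<beta> r. a \<le> \<alpha> \<Longrightarrow> \<alpha> \<le> b \<Longrightarrow> \<bar>\<beta>\<bar> \<le> c \<Longrightarrow> r \<in> slit \<Longrightarrow>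
      norm (P \<alpha> \<beta> r) \<le> C * (1 + norm r) ^ n"
proof -
  obtain C n where "C \<ge> 0" "\<forall>\<alpha> \<beta> r. a \<le> \<alpha> \<longrightarrow> \<alpha> \<le> b \<longrightarrow> \<bar>\<beta>\<bar> \<le> c \<longrightarrow> r \<in> slit \<longrightarrow>
      norm (P \<alpha> \<beta> r) \<le> C * (1 + norm r) ^ n"
    using assms unfolding admissible_def by blast
  then show ?thesis by (intro that[of C n]) blast+
qed

lemma admissible_const: "admissible (\<lambda>\<alpha> \<beta> r. c)"
  unfolding admissible_def
proof (intro conjI allI impI)
  show "\<exists>C n. C \<ge> 0 \<and> (\<forall>\<alpha> \<beta> r. a \<le> \<alpha> \<longrightarrow> \<alpha> \<le> b \<longrightarrow> \<bar>\<beta>\<bar> \<le> d \<longrightarrow> r \<in> slit \<longrightarrow> norm c \<le> C * (1 + norm r) ^ n)" for a b d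
    by (intro exI[of _ "norm c"] exI[of _ 0]) auto
qed auto

lemma admissible_mult:
  assumes "admissible P" "admissible Q"
  shows "admissible (mtimes P Q)"
  unfolding admissible_def
proof (intro conjI allI impI)
  fix a b c :: real assume ab: "0 < a" "b < 2"
  obtain C n where C: "C \<ge> 0" "\<And>\<alpha> \<beta> r. a \<le> \<alpha> \<Longrightarrow> \<alpha> \<le> b \<Longrightarrow> \<bar>\<beta>\<bar> \<le> c \<Longrightarrow> r \<in> slit \<Longrightarrow>
      norm (P \<alpha> \<beta> r) \<le> C * (1 + norm r) ^ n" using admissible_bound[OF assms(1) ab, of c] by metis
  obtain D k where D: "D \<ge> 0" "\<And>\<alpha> \<beta> r. a \<le> \<alpha> \<Longrightarrow> \<alpha> \<le> b \<Longrightarrow> \<bar>\<beta>\<bar> \<le> c \<Longrightarrow> r \<in> slit \<Longrightarrow>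
      norm (Q \<alpha> \<beta> r) \<le> D * (1 + norm r) ^ k" using admissible_bound[OF assms(2) ab, of c] by metis
  show "\<exists>C n. C \<ge> 0 \<and> (\<forall>\<alpha> \<beta> r. a \<le> \<alpha> \<longrightarrow> \<alpha> \<le> b \<longrightarrow> \<bar>\<beta>\<bar> \<le> c \<longrightarrow> r \<in> slit \<longrightarrow>
      norm (P \<alpha> \<beta> r * Q \<alpha> \<beta> r) \<le> C * (1 + norm r) ^ n)"
  proof (intro exI[of _ "C * D"] exI[of _ "n + k"] conjI allI impI)
    fix \<alpha> \<beta> r assume "a \<le> \<alpha>" "\<alpha> \<le> b" "\<bar>\<beta>\<bar> \<le> c" "r \<in> slit"
    then have "norm (P \<alpha> \<beta> r) * norm (Q \<alpha> \<beta> r) \<le> (C * (1 + norm r) ^ n) * (D * (1 + norm r) ^ k)"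
      using C D by (intro mult_mono) auto
    then show "norm (P \<alpha> \<beta> r * Q \<alpha> \<beta> r) \<le> C * D * (1 + norm r) ^ (n + k)"
      by (simp add: norm_mult power_add algebra_simps)
  qed (use C D in auto)
qed (use assms in \<open>auto simp: admissible_def intro!: holomorphic_intros continuous_intros\<close>)

lemma admissible_add:
  assumes "admissible P" "admissible Q"
  shows "admissible (mplus P Q)"
  unfolding admissible_def
proof (intro conjI allI impI)
  fix a b c :: real assume ab: "0 < a" "b < 2"
  obtain C n where C: "C \<ge> 0" "\<And>\<alpha> \<beta> r. a \<le> \<alpha> \<Longrightarrow> \<alpha> \<le> b \<Longrightarrow> \<bar>\<beta>\<bar> \<le> c \<Longrightarrow> r \<in> slit \<Longrightarrow>
      norm (P \<alpha> \<beta> r) \<le> C * (1 + norm r) ^ n" using admissible_bound[OF assms(1) ab, of c] by metis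
  obtain D k where D: "D \<ge> 0" "\<And>\<alpha> \<beta> r. a \<le> \<alpha> \<Longrightarrow> \<alpha> \<le> b \<Longrightarrow> \<bar>\<beta>\<bar> \<le> c \<Longrightarrow> r \<in> slit \<Longrightarrow>
      norm (Q \<alpha> \<beta> r) \<le> D * (1 + norm r) ^ k" using admissible_bound[OF assms(2) ab, of c] by metis
  show "\<exists>C n. C \<ge> 0 \<and> (\<forall>\<alpha> \<beta> r. a \<le> \<alpha> \<longrightarrow> \<alpha> \<le> b \<longrightarrow> \<bar>\<beta>\<bar> \<le> c \<longrightarrow> r \<in> slit \<longrightarrow>
      norm (P \<alpha> \<beta> r + Q \<alpha> \<beta> r) \<le> C * (1 + norm r) ^ n)"
  proof (intro exI[of _ "C + D"] exI[of _ "n + k"] conjI allI impI)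
    fix \<alpha> \<beta> r assume *: "a \<le> \<alpha>" "\<alpha> \<le> b" "\<bar>\<beta>\<bar> \<le> c" "r \<in> slit"
    have "norm (P \<alpha> \<beta> r + Q \<alpha> \<beta> r) \<le> C * (1 + norm r) ^ n + D * (1 + norm r) ^ k"
      using C(2)[OF *] D(2)[OF *] norm_triangle_ineq[of "P \<alpha> \<beta> r" "Q \<alpha> \<beta> r"] by linarith
    also have "\<dots> \<le> C * (1 + norm r) ^ (n + k) + D * (1 + norm r) ^ (n + k)"
      using C D by (intro add_mono mult_left_mono power_increasing) auto
    finally show "norm (P \<alpha> \<beta> r + Q \<alpha> \<beta> r) \<le> (C + D) * (1 + norm r) ^ (n + k)"
      by (simp add: algebra_simps)
  qed (use C D in auto)
qed (use assms in \<open>auto simp: admissible_def intro!: holomorphic_intros continuous_intros\<close>)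

lemma admissible_A: "admissible mA"
  unfolding admissible_def
proof (intro conjI allI impI)
  show "\<exists>C n. C \<ge> 0 \<and> (\<forall>\<alpha> \<beta> r. a \<le> \<alpha> \<longrightarrow> \<alpha> \<le> b \<longrightarrow> \<bar>\<beta>\<bar> \<le> c \<longrightarrow> r \<in> slit \<longrightarrow> norm (mA \<alpha> \<beta> r) \<le> C * (1 + norm r) ^ n)" for a b c
    by (intro exI[of _ 1]) (auto simp: mA_def norm_mult)
qed (auto simp: mA_def[abs_def] intro!: holomorphic_intros continuous_intros)

lemma admissible_B: "admissible (mB j)"
  unfolding admissible_def
proof (intro conjI allI impI ballI)
  fix a b c :: real assume ab: "0 < a" "b < 2"
  then obtain C where "C \<ge> 0" "\<And>\<alpha> r. a \<le> \<alpha> \<Longrightarrow> \<alpha> \<le> b \<Longrightarrow> r \<in> slit \<Longrightarrow> norm (stabKd j \<alpha> r) \<le> C * (1 + norm r) ^ (j + 3)"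
    using stabKd_bound by metis
  then show "\<exists>C n. C \<ge> 0 \<and> (\<forall>\<alpha> \<beta> r. a \<le> \<alpha> \<longrightarrow> \<alpha> \<le> b \<longrightarrow> \<bar>\<beta>\<bar> \<le> c \<longrightarrow> r \<in> slit \<longrightarrow> norm (mB j \<alpha> \<beta> r) \<le> C * (1 + norm r) ^ n)"
    by (intro exI[of _ C] exI[of _ "j + 3"]) (auto simp: mB_def norm_mult)
next
  fix r assume "r \<in> slit"
  have "continuous_on {0<..<2} (\<lambda>\<alpha>. stabKd j \<alpha> r)"
    by (intro continuous_on_vector_derivative[where f' = "\<lambda>\<alpha>. stabKd (Suc j) \<alpha> r"] stabKd_has_vector_derivative) auto
  then have "continuous_on ({0<..<2} \<times> UNIV) (\<lambda>q :: real \<times> real. stabKd j (fst q) r)"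
    by (rule continuous_on_compose2) (auto intro!: continuous_intros)
  then show "continuous_on ({0<..<2} \<times> UNIV) (\<lambda>q. mB j (fst q) (snd q) r)"
    unfolding mB_def by (intro continuous_intros)
qed (auto simp: mB_def[abs_def] intro!: holomorphic_intros stabKd_holomorphic)

lemma admissible_Ln_exp: "admissible (\<lambda>\<alpha> \<beta> r. Ln r ^ j * exp (of_real \<alpha> * Ln r))"
  unfolding admissible_def
proof (intro conjI allI impI ballI)
  fix a b c :: real assume ab: "0 < a" "b < 2"
  then obtain C where C: "C \<ge> 0" "\<And>s \<alpha>. 0 < s \<Longrightarrow> a \<le> \<alpha> \<Longrightarrow> \<alpha> \<le> 2 \<Longrightarrow> s powr \<alpha> * (4 + \<bar>ln s\<bar>) ^ j \<le> C * (1 + s) ^ (j + 2)"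
    using log_powr_bound by metis
  show "\<exists>C n. C \<ge> 0 \<and> (\<forall>\<alpha> \<beta> r. a \<le> \<alpha> \<longrightarrow> \<alpha> \<le> b \<longrightarrow> \<bar>\<beta>\<bar> \<le> c \<longrightarrow> r \<in> slit \<longrightarrow>
      norm (Ln r ^ j * exp (of_real \<alpha> * Ln r)) \<le> C * (1 + norm r) ^ n)"
  proof (intro exI[of _ C] exI[of _ "j + 2"] conjI allI impI)
    fix \<alpha> \<beta> r assume *: "a \<le> \<alpha>" "\<alpha> \<le> b" "\<bar>\<beta>\<bar> \<le> c" "r \<in> slit"
    have r: "r \<noteq> 0" using * slit_nonzero by auto
    have "norm (Ln r ^ j * exp (of_real \<alpha> * Ln r)) = norm (Ln r) ^ j * norm r powr \<alpha>"
      using r by (simp add: norm_mult norm_power powr_def)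
    also have "\<dots> \<le> (4 + \<bar>ln (norm r)\<bar>) ^ j * norm r powr \<alpha>"
      by (intro mult_right_mono power_mono norm_Ln_le r) auto
    also have "\<dots> \<le> C * (1 + norm r) ^ (j + 2)"
      using C(2)[of "norm r" \<alpha>] * ab r by (simp add: mult.commute)
    finally show "norm (Ln r ^ j * exp (of_real \<alpha> * Ln r)) \<le> C * (1 + norm r) ^ (j + 2)" .
  qed (use C in auto)
qed (auto simp: slit_def intro!: holomorphic_intros continuous_intros)

lemma admissible_param: "admissible (\<lambda>\<alpha> \<beta> r. of_real \<beta>)"
  unfolding admissible_def
proof (intro conjI allI impI ballI)
  show "\<exists>C n. C \<ge> 0 \<and> (\<forall>\<alpha> \<beta> r. a \<le> \<alpha> \<longrightarrow> \<alpha> \<le> b \<longrightarrow> \<bar>\<beta>\<bar> \<le> c \<longrightarrow> r \<in> slit \<longrightarrow> norm (complex_of_real \<beta>) \<le> C * (1 + norm r) ^ n)" for a b c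
    by (intro exI[of _ "\<bar>c\<bar>"] exI[of _ 0]) auto
qed (auto intro!: continuous_intros)

lemma admissible_D: "admissible (mD j)"
proof -
  have "admissible (mplus (mtimes (\<lambda>\<alpha> \<beta> r. -1) (\<lambda>\<alpha> \<beta> r. Ln r ^ j * exp (of_real \<alpha> * Ln r)))
      (mtimes (\<lambda>\<alpha> \<beta> r. of_real \<beta>) (mB j)))"
    by (intro admissible_add admissible_mult admissible_const admissible_param admissible_Ln_exp admissible_B)
  then show ?thesis
    by (simp add: mD_def[abs_def])
qed

lemmas admissible_intros =
  admissible_add admissible_mult admissible_const admissible_A admissible_B admissible_D

section \<open>Integrals of multipliers against the kernel\<close>

definition kern :: "real \<Rightarrow> real \<Rightarrow> real \<Rightarrow> complex \<Rightarrow> complex" where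
  "kern m \<alpha> \<beta> r = exp (\<i> * of_real m * r + mD 0 \<alpha> \<beta> r)"

text \<open>On the positive axis \<open>\<i> * m * r\<close> and the skewness part are purely
  imaginary, so neither \<open>m\<close> nor \<open>\<beta>\<close> enters the modulus.\<close>

lemma norm_kern_real:
  assumes "0 < \<alpha>" "\<alpha> < 2" "0 < x"
  shows "norm (kern m \<alpha> \<beta> (of_real x)) = exp (- (x powr \<alpha>))"
  using assms stabKd_real[OF assms, of 0]
  by (simp add: kern_def mD_def mB_def Ln_of_real Re_exp powr_def)

text \<open>For the multiplier \<open>mone\<close> this is, up to scaling, the contribution of the
  positive frequencies to the inversion integral. The negative ones give the complex conjugate, so
  that in the end only the real part matters.\<close>

definition stabI :: "mult \<Rightarrow> real \<Rightarrow> real \<Rightarrow> real \<Rightarrow> complex" where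
  "stabI P m \<alpha> \<beta> = (LINT x|halfline. P \<alpha> \<beta> (of_real x) * kern m \<alpha> \<beta> (of_real x))"

lemma kern_holomorphic: "0 < \<alpha> \<Longrightarrow> \<alpha> < 2 \<Longrightarrow> kern m \<alpha> \<beta> holomorphic_on slit"
  unfolding kern_def
  by (intro holomorphic_intros) (rule admissible_holomorphic[OF admissible_D])

lemma measurable_mult_kern:
  assumes "admissible P" "0 < \<alpha>" "\<alpha> < 2"
  shows "(\<lambda>x. P \<alpha> \<beta> (of_real x) * kern m \<alpha> \<beta> (of_real x)) \<in> borel_measurable halfline"
proof (rule measurable_halfline)
  have "continuous_on slit (\<lambda>r. P \<alpha> \<beta> r * kern m \<alpha> \<beta> r)"
    using assms by (intro holomorphic_on_imp_continuous_on holomorphic_intros admissible_holomorphic kern_holomorphic)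
  then show "continuous_on {0<..} (\<lambda>x. P \<alpha> \<beta> (of_real x) * kern m \<alpha> \<beta> (of_real x))"
    by (rule continuous_on_compose2) (auto intro!: continuous_intros of_real_in_slit)
qed

text \<open>The radius, half the distance from \<open>\<alpha>0\<close> to the ends of the interval
  (0, 2), keeps \<alpha> in a compact subinterval. One majorant serves for every
  \<open>m\<close>.\<close>

lemma mult_kern_dominated:
  assumes P: "admissible P" and \<alpha>0: "0 < \<alpha>0" "\<alpha>0 < 2"
  obtains w where "integrable halfline w"
    "\<And>x. 0 < x \<Longrightarrow> 0 \<le> w x"
    "\<And>m \<alpha> \<beta> x. \<bar>\<alpha> - \<alpha>0\<bar> < min \<alpha>0 (2 - \<alpha>0) / 2 \<Longrightarrow> \<bar>\<beta> - \<beta>0\<bar> < min \<alpha>0 (2 - \<alpha>0) / 2 \<Longrightarrow> 0 < x \<Longrightarrow>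
        norm (P \<alpha> \<beta> (of_real x) * kern m \<alpha> \<beta> (of_real x)) \<le> w x"
proof -
  define e where "e = min \<alpha>0 (2 - \<alpha>0) / 2"
  have e: "0 < e" "0 < \<alpha>0 - e" "\<alpha>0 + e < 2" using \<alpha>0 by (auto simp: e_def min_def field_simps)
  obtain C n where C: "C \<ge> 0" "\<And>\<alpha> \<beta> r. \<alpha>0 - e \<le> \<alpha> \<Longrightarrow> \<alpha> \<le> \<alpha>0 + e \<Longrightarrow> \<bar>\<beta>\<bar> \<le> \<bar>\<beta>0\<bar> + e \<Longrightarrow> r \<in> slit \<Longrightarrow>
      norm (P \<alpha> \<beta> r) \<le> C * (1 + norm r) ^ n" using admissible_bound[OF P e(2,3)] by metis
  show ?thesis
  proof (rule that)
    show "integrable halfline (\<lambda>x. C * exp 1 * ((1 + x) ^ n * exp (- 1 * x powr (\<alpha>0 - e))))"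
      using integrable_power_exp_powr[OF e(2), of 1 n] by simp
    fix m \<alpha> \<beta> x :: real
    assume *: "\<bar>\<alpha> - \<alpha>0\<bar> < min \<alpha>0 (2 - \<alpha>0) / 2" "\<bar>\<beta> - \<beta>0\<bar> < min \<alpha>0 (2 - \<alpha>0) / 2" and x: "0 < x"
    have \<alpha>: "0 < \<alpha>" "\<alpha> < 2" "\<alpha>0 - e \<le> \<alpha>" "\<alpha> \<le> \<alpha>0 + e" using * e unfolding e_def[symmetric] by auto
    \<comment> \<open>The smallest exponent is the worst one for \<open>x > 1\<close>; for
      \<open>x \<le> 1\<close> its power is at most 1, whence the constant
      \<open>exp 1\<close>.\<close>
    have "exp (- (x powr \<alpha>)) \<le> exp (1 - x powr (\<alpha>0 - e))"
    proof (cases "x \<le> 1")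
      case True
      then have "x powr (\<alpha>0 - e) \<le> 1" using x e by (simp add: powr_le1)
      then show ?thesis by (smt (verit) exp_le_cancel_iff powr_ge_zero)
    next
      case False
      then have "x powr (\<alpha>0 - e) \<le> x powr \<alpha>" using \<alpha> by (intro powr_mono) auto
      then show ?thesis by simp
    qed
    moreover have "norm (P \<alpha> \<beta> (of_real x)) \<le> C * (1 + x) ^ n"
      using C(2)[of \<alpha> \<beta> "of_real x"] \<alpha> * x unfolding e_def[symmetric] by (simp add: of_real_in_slit)
    ultimately have "norm (P \<alpha> \<beta> (of_real x)) * exp (- (x powr \<alpha>)) \<le> (C * (1 + x) ^ n) * exp (1 - x powr (\<alpha>0 - e))"
      using C(1) x by (intro mult_mono) auto
    then show "norm (P \<alpha> \<beta> (of_real x) * kern m \<alpha> \<beta> (of_real x)) \<le> C * exp 1 * ((1 + x) ^ n * exp (- 1 * x powr (\<alpha>0 - e)))"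
      unfolding norm_mult norm_kern_real[OF \<alpha>(1,2) x] by (simp add: exp_diff exp_minus field_simps)
  qed (use C in auto)
qed

lemma integrable_mult_kern:
  assumes "admissible P" "0 < \<alpha>" "\<alpha> < 2"
  shows "integrable halfline (\<lambda>x. P \<alpha> \<beta> (of_real x) * kern m \<alpha> \<beta> (of_real x))"
proof -
  obtain w where w: "integrable halfline w" "\<And>x. 0 < x \<Longrightarrow> 0 \<le> w x"
    "\<And>x. 0 < x \<Longrightarrow> norm (P \<alpha> \<beta> (of_real x) * kern m \<alpha> \<beta> (of_real x)) \<le> w x"
    using mult_kern_dominated[OF assms, of \<beta>] assms(2,3)
    by (metis abs_zero diff_self half_gt_zero min_less_iff_conj diff_gt_0_iff_gt)
  show ?thesis
  proof (rule Bochner_Integration.integrable_bound[OF w(1) measurable_mult_kern[OF assms]], rule AE_I2)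
    fix x assume "x \<in> space halfline"
    then show "norm (P \<alpha> \<beta> (of_real x) * kern m \<alpha> \<beta> (of_real x)) \<le> norm (w x)"
      using w(2,3)[of x] by (simp add: space_halfline)
  qed
qed

lemma abs_components_less:
  fixes p :: "real \<times> real \<times> real"
  assumes "p \<in> ball (m0, \<alpha>0, \<beta>0) e"
  shows "\<bar>fst (snd p) - \<alpha>0\<bar> < e" "\<bar>snd (snd p) - \<beta>0\<bar> < e"
proof -
  have "dist (fst (snd p)) \<alpha>0 \<le> dist (snd p) (\<alpha>0, \<beta>0)" "dist (snd (snd p)) \<beta>0 \<le> dist (snd p) (\<alpha>0, \<beta>0)"
    using dist_fst_le[of "snd p" "(\<alpha>0, \<beta>0)"] dist_snd_le[of "snd p" "(\<alpha>0, \<beta>0)"] by auto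
  moreover have "dist (snd p) (\<alpha>0, \<beta>0) \<le> dist p (m0, \<alpha>0, \<beta>0)"
    using dist_snd_le[of p "(m0, \<alpha>0, \<beta>0)"] by simp
  ultimately show "\<bar>fst (snd p) - \<alpha>0\<bar> < e" "\<bar>snd (snd p) - \<beta>0\<bar> < e"
    using assms by (auto simp: dist_real_def dist_commute)
qed

lemma isCont_stabI:
  assumes P: "admissible P" and \<alpha>0: "0 < \<alpha>0" "\<alpha>0 < 2"
  shows "isCont (\<lambda>p. stabI P (fst p) (fst (snd p)) (snd (snd p))) (m0, \<alpha>0, \<beta>0)"
proof -
  define e where "e = min \<alpha>0 (2 - \<alpha>0) / 2"
  have e: "0 < e" "0 < \<alpha>0 - e" "\<alpha>0 + e < 2" using \<alpha>0 by (auto simp: e_def min_def field_simps)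
  obtain w where w: "integrable halfline w"
    "\<And>m \<alpha> \<beta> x. \<bar>\<alpha> - \<alpha>0\<bar> < e \<Longrightarrow> \<bar>\<beta> - \<beta>0\<bar> < e \<Longrightarrow> 0 < x \<Longrightarrow>
        norm (P \<alpha> \<beta> (of_real x) * kern m \<alpha> \<beta> (of_real x)) \<le> w x"
    using mult_kern_dominated[OF assms, of \<beta>0] unfolding e_def by metis
  have "continuous_on (ball (m0, \<alpha>0, \<beta>0) e) (\<lambda>p. stabI P (fst p) (fst (snd p)) (snd (snd p)))"
    unfolding stabI_def
  proof (rule continuous_on_integral_dominated[OF _ _ w(1)])
    fix x assume "x \<in> space halfline"
    then have x: "0 < x" by (simp add: space_halfline)
    have *: "continuous_on (ball (m0, \<alpha>0, \<beta>0) e) (\<lambda>p. Q (fst (snd p)) (snd (snd p)) (of_real x))"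
      if "admissible Q" for Q
    proof -
      have "continuous_on ({0<..<2} \<times> UNIV) (\<lambda>q. Q (fst q) (snd q) (of_real x))"
        using that of_real_in_slit[OF x] by (simp add: admissible_def)
      then show ?thesis
      proof (rule continuous_on_compose2[where f = snd])
        show "snd ` ball (m0, \<alpha>0, \<beta>0) e \<subseteq> {0<..<2} \<times> UNIV"
        proof
          fix q assume "q \<in> snd ` ball (m0, \<alpha>0, \<beta>0) e"
          then obtain p where "p \<in> ball (m0, \<alpha>0, \<beta>0) e" "q = snd p" by blast
          then show "q \<in> {0<..<2} \<times> UNIV"
            using abs_components_less(1)[of p m0 \<alpha>0 \<beta>0 e] e by (auto simp: mem_Times_iff)
        qed
      qed (intro continuous_intros)
    qed
    show "continuous_on (ball (m0, \<alpha>0, \<beta>0) e)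
        (\<lambda>p. P (fst (snd p)) (snd (snd p)) (of_real x) * kern (fst p) (fst (snd p)) (snd (snd p)) (of_real x))"
      unfolding kern_def by (intro continuous_intros * P admissible_D)
  next
    fix p assume p: "p \<in> ball (m0, \<alpha>0, \<beta>0) e"
    show "(\<lambda>x. P (fst (snd p)) (snd (snd p)) (of_real x) * kern (fst p) (fst (snd p)) (snd (snd p)) (of_real x))
        \<in> borel_measurable halfline"
      using abs_components_less[OF p] e by (intro measurable_mult_kern P) auto
    fix x assume "x \<in> space halfline"
    then show "norm (P (fst (snd p)) (snd (snd p)) (of_real x) * kern (fst p) (fst (snd p)) (snd (snd p)) (of_real x)) \<le> w x"
      by (intro w abs_components_less[OF p]) (simp add: space_halfline)
  qed
  then show ?thesis
    using e by (simp add: continuous_on_eq_continuous_at)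
qed

section \<open>Differentiation in m, \<alpha> and \<beta> under the integral\<close>

definition mult_deriv :: "mult \<Rightarrow> mult \<Rightarrow> mult \<Rightarrow> bool" where
  "mult_deriv P Pa Pb \<longleftrightarrow> (\<forall>\<alpha> \<beta> x. 0 < \<alpha> \<longrightarrow> \<alpha> < 2 \<longrightarrow> 0 < x \<longrightarrow>
    ((\<lambda>q. P (fst q) (snd q) (of_real x)) has_derivative
      (\<lambda>h. of_real (fst h) * Pa \<alpha> \<beta> (of_real x) + of_real (snd h) * Pb \<alpha> \<beta> (of_real x))) (at (\<alpha>, \<beta>)))"

lemma has_derivative_of_fst:
  fixes f :: "real \<Rightarrow> complex"
  assumes "(f has_vector_derivative f') (at a)"
  shows "((\<lambda>q :: real \<times> real. f (fst q)) has_derivative (\<lambda>h. of_real (fst h) * f')) (at (a, b))"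
proof -
  have "(f has_derivative (\<lambda>x. x *\<^sub>R f')) (at (fst (a, b)))"
    using assms by (simp add: has_vector_derivative_def)
  from has_derivative_compose[OF has_derivative_fst[OF has_derivative_ident] this] show ?thesis
    by (simp add: scaleR_conv_of_real)
qed

lemma has_derivative_Ln_exp:
  "((\<lambda>q :: real \<times> real. Ln r ^ j * exp (of_real (fst q) * Ln r)) has_derivative
     (\<lambda>h. of_real (fst h) * (Ln r ^ Suc j * exp (of_real \<alpha> * Ln r)))) (at (\<alpha>, \<beta>))"
proof -
  have "((\<lambda>\<alpha>. Ln r ^ j * exp (of_real \<alpha> * Ln r)) has_vector_derivative Ln r ^ Suc j * exp (of_real \<alpha> * Ln r)) (at \<alpha>)"
    by (rule has_vector_derivative_real_field) (auto intro!: derivative_eq_intros)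
  then show ?thesis
    by (rule has_derivative_of_fst)
qed

lemma has_derivative_B:
  assumes "0 < \<alpha>" "\<alpha> < 2"
  shows "((\<lambda>q :: real \<times> real. mB j (fst q) \<gamma> r) has_derivative (\<lambda>h. of_real (fst h) * mB (Suc j) \<alpha> \<gamma> r)) (at (\<alpha>, \<beta>))"
proof -
  have "((\<lambda>\<alpha>. mB j \<alpha> \<gamma> r) has_vector_derivative mB (Suc j) \<alpha> \<gamma> r) (at \<alpha>)"
    unfolding mB_def by (intro has_vector_derivative_mult_right stabKd_has_vector_derivative assms)
  then show ?thesis
    by (rule has_derivative_of_fst)
qed

lemma mult_deriv_const: "mult_deriv (\<lambda>\<alpha> \<beta> r. c) (\<lambda>\<alpha> \<beta> r. 0) (\<lambda>\<alpha> \<beta> r. 0)"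
  by (simp add: mult_deriv_def)

lemma mult_deriv_A: "mult_deriv mA (\<lambda>\<alpha> \<beta> r. 0) (\<lambda>\<alpha> \<beta> r. 0)"
  by (simp add: mult_deriv_def mA_def)

lemma mult_deriv_B: "mult_deriv (mB j) (mB (Suc j)) (\<lambda>\<alpha> \<beta> r. 0)"
  unfolding mult_deriv_def
proof (intro allI impI)
  fix \<alpha> \<beta> x :: real assume "0 < \<alpha>" "\<alpha> < 2"
  then show "((\<lambda>q. mB j (fst q) (snd q) (of_real x)) has_derivative
      (\<lambda>h. of_real (fst h) * mB (Suc j) \<alpha> \<beta> (of_real x) + of_real (snd h) * 0)) (at (\<alpha>, \<beta>))"
    using has_derivative_B[of \<alpha> j 0 "of_real x" \<beta>] by (simp add: mB_def)
qed

lemma mult_deriv_D: "mult_deriv (mD j) (mD (Suc j)) (mB j)"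
  unfolding mult_deriv_def
proof (intro allI impI)
  fix \<alpha> \<beta> x :: real assume \<alpha>: "0 < \<alpha>" "\<alpha> < 2"
  let ?r = "complex_of_real x"
  \<comment> \<open>\<open>mB\<close> does not depend on its \<open>\<beta>\<close> argument; fixing
    it at 0 leaves \<open>of_real (snd q)\<close> as the only occurrence of \<beta>.\<close>
  have "((\<lambda>q :: real \<times> real. - (Ln ?r ^ j * exp (of_real (fst q) * Ln ?r)) + of_real (snd q) * mB j (fst q) 0 ?r) has_derivative
      (\<lambda>h. - (of_real (fst h) * (Ln ?r ^ Suc j * exp (of_real \<alpha> * Ln ?r))) +
        (of_real \<beta> * (of_real (fst h) * mB (Suc j) \<alpha> 0 ?r) + of_real (snd h) * mB j \<alpha> 0 ?r))) (at (\<alpha>, \<beta>))"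
    by (rule derivative_eq_intros has_derivative_Ln_exp[of _ _ \<alpha> \<beta>] has_derivative_B[OF \<alpha>] refl)+ auto
  then show "((\<lambda>q. mD j (fst q) (snd q) ?r) has_derivative
      (\<lambda>h. of_real (fst h) * mD (Suc j) \<alpha> \<beta> ?r + of_real (snd h) * mB j \<alpha> \<beta> ?r)) (at (\<alpha>, \<beta>))"
    by (simp add: mD_def mB_def algebra_simps)
qed

text \<open>By the product rule a derivative of multiplier times kernel is again a multiplier times
  the kernel: the exponent contributes \<open>mA\<close>, \<open>mD 1\<close> and
  \<open>mB 0\<close>, the multiplier itself \<open>Pa\<close> and \<open>Pb\<close>. The same lemma
  therefore yields first and second derivatives.\<close>

lemma has_derivative_stabI:
  assumes P: "admissible P" "admissible Pa" "admissible Pb" and d: "mult_deriv P Pa Pb"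
    and \<alpha>0: "0 < \<alpha>0" "\<alpha>0 < 2"
  shows "((\<lambda>p. stabI P (fst p) (fst (snd p)) (snd (snd p))) has_derivative
    (\<lambda>h. of_real (fst h) * stabI (mtimes mA P) m0 \<alpha>0 \<beta>0 +
      of_real (fst (snd h)) * stabI (mplus Pa (mtimes (mD 1) P)) m0 \<alpha>0 \<beta>0 +
      of_real (snd (snd h)) * stabI (mplus Pb (mtimes (mB 0) P)) m0 \<alpha>0 \<beta>0)) (at (m0, \<alpha>0, \<beta>0))"
proof -
  let ?Qm = "mtimes mA P" and ?Qa = "mplus Pa (mtimes (mD 1) P)" and ?Qb = "mplus Pb (mtimes (mB 0) P)"
  have Q: "admissible ?Qm" "admissible ?Qa" "admissible ?Qb"
    by (intro admissible_intros P)+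
  define e where "e = min \<alpha>0 (2 - \<alpha>0) / 2"
  have e: "0 < e" "0 < \<alpha>0 - e" "\<alpha>0 + e < 2" using \<alpha>0 by (auto simp: e_def min_def field_simps)
  define dom where "dom Q w \<longleftrightarrow> integrable halfline w \<and>
      (\<forall>m \<alpha> \<beta> x. \<bar>\<alpha> - \<alpha>0\<bar> < e \<longrightarrow> \<bar>\<beta> - \<beta>0\<bar> < e \<longrightarrow> 0 < x \<longrightarrow>
        norm (Q \<alpha> \<beta> (of_real x) * kern m \<alpha> \<beta> (of_real x)) \<le> w x)" for Q :: mult and w
  have "\<exists>w. dom Q w" if "admissible Q" for Q
    using mult_kern_dominated[OF that \<alpha>0, of \<beta>0] unfolding dom_def e_def by metis
  then obtain wm wa wb where "dom ?Qm wm" "dom ?Qa wa" "dom ?Qb wb"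
    using Q by meson
  then have wi: "integrable halfline wm" "integrable halfline wa" "integrable halfline wb"
    and wm: "\<And>m \<alpha> \<beta> x. \<bar>\<alpha> - \<alpha>0\<bar> < e \<Longrightarrow> \<bar>\<beta> - \<beta>0\<bar> < e \<Longrightarrow> 0 < x \<Longrightarrow>
        norm (?Qm \<alpha> \<beta> (of_real x) * kern m \<alpha> \<beta> (of_real x)) \<le> wm x"
    and wa: "\<And>m \<alpha> \<beta> x. \<bar>\<alpha> - \<alpha>0\<bar> < e \<Longrightarrow> \<bar>\<beta> - \<beta>0\<bar> < e \<Longrightarrow> 0 < x \<Longrightarrow>
        norm (?Qa \<alpha> \<beta> (of_real x) * kern m \<alpha> \<beta> (of_real x)) \<le> wa x"
    and wb: "\<And>m \<alpha> \<beta> x. \<bar>\<alpha> - \<alpha>0\<bar> < e \<Longrightarrow> \<bar>\<beta> - \<beta>0\<bar> < e \<Longrightarrow> 0 < x \<Longrightarrow>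
        norm (?Qb \<alpha> \<beta> (of_real x) * kern m \<alpha> \<beta> (of_real x)) \<le> wb x"
    unfolding dom_def by blast+
  define f where "f p x = P (fst (snd p)) (snd (snd p)) (of_real x) * kern (fst p) (fst (snd p)) (snd (snd p)) (of_real x)"
    for p :: "real \<times> real \<times> real" and x :: real
  define K where "K Q p x = Q (fst (snd p)) (snd (snd p)) (of_real x) * kern (fst p) (fst (snd p)) (snd (snd p)) (of_real x)"
    for Q :: mult and p :: "real \<times> real \<times> real" and x :: real
  define D where "D p x h = of_real (fst h) * K ?Qm p x + of_real (fst (snd h)) * K ?Qa p x +
      of_real (snd (snd h)) * K ?Qb p x" for p x and h :: "real \<times> real \<times> real"
  have "((\<lambda>p. integral\<^sup>L halfline (f p)) has_derivative (\<lambda>h. integral\<^sup>L halfline (\<lambda>x. D (m0, \<alpha>0, \<beta>0) x h))) (at (m0, \<alpha>0, \<beta>0))"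
  proof (rule has_derivative_integral_dominated[OF \<open>0 < e\<close>])
    fix p x assume p: "p \<in> ball (m0, \<alpha>0, \<beta>0) e" and "x \<in> space halfline"
    then have x: "0 < x" by (simp add: space_halfline)
    obtain m \<alpha> \<beta> where p_eq [simp]: "p = (m, \<alpha>, \<beta>)" by (cases p)
    have \<alpha>: "0 < \<alpha>" "\<alpha> < 2" using abs_components_less[OF p] e by auto
    have *: "((\<lambda>p :: real \<times> real \<times> real. F (fst (snd p)) (snd (snd p)) (of_real x)) has_derivative
        (\<lambda>h. of_real (fst (snd h)) * Fa \<alpha> \<beta> (of_real x) + of_real (snd (snd h)) * Fb \<alpha> \<beta> (of_real x))) (at (m, \<alpha>, \<beta>))"
      if "mult_deriv F Fa Fb" for F Fa Fb
    proof -
      have "((\<lambda>q. F (fst q) (snd q) (of_real x)) has_derivative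
        (\<lambda>h. of_real (fst h) * Fa \<alpha> \<beta> (of_real x) + of_real (snd h) * Fb \<alpha> \<beta> (of_real x))) (at (snd (m, \<alpha>, \<beta>)))"
        using that \<alpha> x by (simp add: mult_deriv_def)
      from has_derivative_compose[OF has_derivative_snd[OF has_derivative_ident] this] show ?thesis by simp
    qed
    show "((\<lambda>p. f p x) has_derivative D p x) (at p)"
    proof -
      have "((\<lambda>p :: real \<times> real \<times> real. \<i> * of_real (fst p) * of_real x + mD 0 (fst (snd p)) (snd (snd p)) (of_real x)) has_derivative
        (\<lambda>h. \<i> * of_real (fst h) * of_real x + (of_real (fst (snd h)) * mD (Suc 0) \<alpha> \<beta> (of_real x) +
          of_real (snd (snd h)) * mB 0 \<alpha> \<beta> (of_real x)))) (at (m, \<alpha>, \<beta>))"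
        by (intro has_derivative_add *[OF mult_deriv_D]) (auto intro!: derivative_eq_intros)
      from has_derivative_mult[OF *[OF d] has_derivative_compose[OF this has_field_derivative_imp_has_derivative[OF DERIV_exp]]]
      show ?thesis
        unfolding f_def kern_def p_eq
        by (rule has_derivative_eq_rhs)
          (auto simp: D_def K_def kern_def mA_def algebra_simps fun_eq_iff)
    qed
    show "norm (D p x h) \<le> (wm x + wa x + wb x) * norm h" for h
    proof -
      note b = abs_components_less[OF p, simplified]
      have "norm (K ?Qm p x) \<le> wm x" "norm (K ?Qa p x) \<le> wa x" "norm (K ?Qb p x) \<le> wb x"
        using wm[OF b x, of m] wa[OF b x, of m] wb[OF b x, of m] by (simp_all add: K_def)
      moreover have "\<bar>fst h\<bar> \<le> norm h" "\<bar>fst (snd h)\<bar> \<le> norm h" "\<bar>snd (snd h)\<bar> \<le> norm h"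
        using norm_fst_le[of "fst h" "snd h"] norm_snd_le[of "snd h" "fst h"]
          norm_fst_le[of "fst (snd h)" "snd (snd h)"] norm_snd_le[of "snd (snd h)" "fst (snd h)"] by simp_all
      ultimately have "\<bar>fst h\<bar> * norm (K ?Qm p x) \<le> norm h * wm x"
        "\<bar>fst (snd h)\<bar> * norm (K ?Qa p x) \<le> norm h * wa x" "\<bar>snd (snd h)\<bar> * norm (K ?Qb p x) \<le> norm h * wb x"
        by (auto intro!: mult_mono)
      moreover have "norm (D p x h) \<le> \<bar>fst h\<bar> * norm (K ?Qm p x) + \<bar>fst (snd h)\<bar> * norm (K ?Qa p x) +
          \<bar>snd (snd h)\<bar> * norm (K ?Qb p x)"
        unfolding D_def by (intro norm_triangle_le add_mono) (auto simp: norm_mult)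
      ultimately show ?thesis by (simp add: algebra_simps)
    qed
  next
    fix p assume p: "p \<in> ball (m0, \<alpha>0, \<beta>0) e"
    show "integrable halfline (f p)"
      unfolding f_def using abs_components_less[OF p] e by (intro integrable_mult_kern P) auto
  next
    show "(\<lambda>x. D (m0, \<alpha>0, \<beta>0) x h) \<in> borel_measurable halfline" for h
      unfolding D_def K_def fst_conv snd_conv
      by (intro borel_measurable_add borel_measurable_times borel_measurable_const measurable_mult_kern Q \<alpha>0)
  qed (use wi in auto)
  moreover have "integral\<^sup>L halfline (\<lambda>x. D (m0, \<alpha>0, \<beta>0) x h) = of_real (fst h) * stabI ?Qm m0 \<alpha>0 \<beta>0 +
      of_real (fst (snd h)) * stabI ?Qa m0 \<alpha>0 \<beta>0 + of_real (snd (snd h)) * stabI ?Qb m0 \<alpha>0 \<beta>0" for h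
  proof -
    have i: "integrable halfline (\<lambda>x. c * (Q \<alpha>0 \<beta>0 (of_real x) * kern m0 \<alpha>0 \<beta>0 (of_real x)))" if "admissible Q" for Q c
      by (intro integrable_mult_right integrable_mult_kern that \<alpha>0)
    show ?thesis
      unfolding D_def K_def fst_conv snd_conv stabI_def
        Bochner_Integration.integral_add[OF Bochner_Integration.integrable_add[OF i[OF Q(1)] i[OF Q(2)]] i[OF Q(3)]]
        Bochner_Integration.integral_add[OF i[OF Q(1)] i[OF Q(2)]] integral_mult_right_zero ..
  qed
  ultimately show ?thesis
    unfolding f_def stabI_def[symmetric] by simp
qed

section \<open>Shifting the contour\<close>

lemma stabKd_0_has_field_derivative:
  fixes \<alpha> :: real
  assumes "r \<in> slit"
  defines "w \<equiv> Ln r * of_real \<alpha> + - Ln r"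
  shows "(stabKd 0 \<alpha> has_field_derivative
    tanC (of_real \<alpha>) * (Ln r * expq w + expq w + Ln r * (of_real (\<alpha> - 1) * (deriv ^^ 1) expq w))) (at r)"
proof -
  have r: "r \<notin> \<real>\<^sub>\<le>\<^sub>0" "r \<noteq> 0" using assms by (auto simp: slit_def)
  have q: "(expq has_field_derivative (deriv ^^ 1) expq w) (at w)"
    using has_field_derivative_higher_deriv[OF expq_holomorphic[of UNIV], of w 0] by simp
  have w: "((\<lambda>r. Ln r * of_real \<alpha> + - Ln r) has_field_derivative (of_real (\<alpha> - 1) / r)) (at r)"
    using r by (auto intro!: derivative_eq_intros simp: field_simps)
  have "((\<lambda>r. expq (Ln r * of_real \<alpha> + - Ln r)) has_field_derivative (deriv ^^ 1) expq w * (of_real (\<alpha> - 1) / r)) (at r)"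
    by (rule DERIV_chain2[OF _ w]) (use q in \<open>simp add: w_def\<close>)
  then have "((\<lambda>r. r * Ln r * (tanC (of_real \<alpha>) * expq (Ln r * of_real \<alpha> + - Ln r))) has_field_derivative
    (1 * Ln r + inverse r * r) * (tanC (of_real \<alpha>) * expq w) +
      (tanC (of_real \<alpha>) * ((deriv ^^ 1) expq w * (of_real (\<alpha> - 1) / r))) * (r * Ln r)) (at r)"
    unfolding w_def using r by (intro DERIV_mult DERIV_cmult DERIV_ident has_field_derivative_Ln) auto
  moreover have "(1 * Ln r + inverse r * r) * (tanC (of_real \<alpha>) * expq w) +
      (tanC (of_real \<alpha>) * ((deriv ^^ 1) expq w * (of_real (\<alpha> - 1) / r))) * (r * Ln r) =
    tanC (of_real \<alpha>) * (Ln r * expq w + expq w + Ln r * (of_real (\<alpha> - 1) * (deriv ^^ 1) expq w))"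
    using r by (simp add: field_simps)
  moreover have "stabKd 0 \<alpha> = (\<lambda>r. r * Ln r * (tanC (of_real \<alpha>) * expq (Ln r * of_real \<alpha> + - Ln r)))"
    by (rule ext) (rule stabKd_0_eq)
  ultimately show ?thesis by simp
qed

text \<open>In the derivative of the skewness term the \<open>1 / r\<close> of the logarithm cancels
  the leading \<open>r\<close>, so the derivative grows at most like |r|^\<gamma> ln |r| with
  \<gamma> = max 0 (\<alpha> - 1). Since \<alpha> < 2, this \<gamma> is below \<alpha> / 2, and the
  gap \<open>\<kappa>\<close> absorbs the logarithm. The exponent \<alpha> / 2 is the right target
  because its square is what the decay on the real axis can compensate.\<close>

lemma mD_0_has_field_derivative_bound:
  assumes \<alpha>: "0 < \<alpha>" "\<alpha> < 2"
  obtains D K where "K \<ge> 0" "\<And>r. 1 \<le> Re r \<Longrightarrow> (mD 0 \<alpha> \<beta> has_field_derivative D r) (at r)"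
    "\<And>r. 1 \<le> Re r \<Longrightarrow> norm (D r) \<le> K * norm r powr (\<alpha> / 2)"
proof -
  define \<gamma> where "\<gamma> = max 0 (\<alpha> - 1)"
  define \<kappa> where "\<kappa> = \<alpha> / 2 - \<gamma>"
  have \<kappa>: "\<kappa> > 0" using \<alpha> by (cases "\<alpha> \<le> 1") (auto simp: \<kappa>_def \<gamma>_def)
  have \<gamma>: "\<gamma> \<ge> 0" "\<alpha> - 1 \<le> \<gamma>" by (auto simp: \<gamma>_def)
  define w where "w r = Ln r * of_real \<alpha> + - Ln r" for r
  define D where "D r = - (exp (of_real \<alpha> * Ln r) * (of_real \<alpha> / r)) +
    of_real \<beta> * (- \<i> * (tanC (of_real \<alpha>) * (Ln r * expq (w r) + expq (w r) + Ln r * (of_real (\<alpha> - 1) * (deriv ^^ 1) expq (w r)))))" for r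
  define T where "T = norm (tanC (of_real \<alpha>))"
  define K where "K = (2 + \<bar>\<beta>\<bar> * (T * (3 * exp 1))) * (5 + 1 / \<kappa>)"
  show ?thesis
  proof
    show "K \<ge> 0" using \<kappa> by (auto simp: K_def T_def)
    fix r assume r: "1 \<le> Re r"
    have r': "r \<in> slit" "r \<noteq> 0" "r \<notin> \<real>\<^sub>\<le>\<^sub>0" using r Re_pos_in_slit[of r] slit_nonzero[of r] by (auto simp: slit_def)
    have "((\<lambda>r. exp (of_real \<alpha> * Ln r)) has_field_derivative exp (of_real \<alpha> * Ln r) * (of_real \<alpha> * inverse r)) (at r)"
      using r' by (auto intro!: derivative_eq_intros)
    then have "((\<lambda>r. - exp (of_real \<alpha> * Ln r) + of_real \<beta> * (- \<i> * stabKd 0 \<alpha> r)) has_field_derivative D r) (at r)"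
      unfolding D_def w_def divide_inverse
      by (intro DERIV_add DERIV_minus DERIV_cmult stabKd_0_has_field_derivative r')
    then show "(mD 0 \<alpha> \<beta> has_field_derivative D r) (at r)"
      by (simp add: mD_def[abs_def] mB_def)
    define s where "s = norm r"
    have s: "s \<ge> 1" using complex_Re_le_cmod[of r] r by (simp add: s_def)
    have L: "norm (Ln r) \<le> 4 + ln s"
      using norm_Ln_le[OF r'(2)] s by (simp add: s_def)
    have mx: "max 1 (s powr (\<alpha> - 1)) \<le> s powr \<gamma>"
      using s \<gamma> by (auto intro: powr_mono ge_one_powr_ge_zero)
    have "exp (Re (w r)) = s powr (\<alpha> - 1)"
      using s r' by (simp add: powr_def s_def w_def algebra_simps)
    then have q: "norm (expq (w r)) \<le> s powr \<gamma>" "norm ((deriv ^^ 1) expq (w r)) \<le> exp 1 * s powr \<gamma>"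
      using order_trans[OF norm_expq_le[of "w r"]] mx
        order_trans[OF norm_higher_deriv_expq[of 1 "w r"]] mult_left_mono[OF mx, of "exp 1"]
      by (simp_all del: max.bounded_iff)
    have sg: "s powr \<gamma> \<ge> 0" "ln s \<ge> 0" "exp 1 \<ge> (1::real)" using s by auto
    have q1: "norm (expq (w r)) \<le> exp 1 * s powr \<gamma>"
      using q(1) sg mult_right_mono[of 1 "exp 1" "s powr \<gamma>"] by simp
    have "norm (Ln r * expq (w r) + expq (w r) + Ln r * (of_real (\<alpha> - 1) * (deriv ^^ 1) expq (w r)))
      \<le> norm (Ln r) * norm (expq (w r)) + norm (expq (w r)) + norm (Ln r) * (\<bar>\<alpha> - 1\<bar> * norm ((deriv ^^ 1) expq (w r)))"
      by (intro norm_triangle_le add_mono) (simp_all only: norm_mult norm_of_real order_refl)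
    also have "\<dots> \<le> (5 + ln s) * (exp 1 * s powr \<gamma>) + (5 + ln s) * (exp 1 * s powr \<gamma>) + (5 + ln s) * (1 * (exp 1 * s powr \<gamma>))"
    proof (intro add_mono mult_mono q q1)
      show "norm (expq (w r)) \<le> (5 + ln s) * (exp 1 * s powr \<gamma>)"
      proof -
        have "1 * (exp 1 * s powr \<gamma>) \<le> (5 + ln s) * (exp 1 * s powr \<gamma>)"
          using sg by (intro mult_right_mono) auto
        then show ?thesis using q1 by linarith
      qed
    qed (use L sg \<alpha> in auto)
    finally have 1: "norm (Ln r * expq (w r) + expq (w r) + Ln r * (of_real (\<alpha> - 1) * (deriv ^^ 1) expq (w r)))
      \<le> 3 * exp 1 * ((5 + ln s) * s powr \<gamma>)" by (simp add: algebra_simps)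
    have "norm (exp (of_real \<alpha> * Ln r) * (of_real \<alpha> / r)) = \<alpha> * s powr (\<alpha> - 1)"
      using \<alpha> r' s by (simp add: norm_mult norm_divide powr_def s_def left_diff_distrib exp_diff)
    also have "\<dots> \<le> 2 * s powr \<gamma>"
      using \<alpha> mx by (intro mult_mono) auto
    also have "\<dots> \<le> 2 * ((5 + ln s) * s powr \<gamma>)"
      using sg mult_right_mono[of 1 "5 + ln s" "s powr \<gamma>"] by simp
    finally have 2: "norm (exp (of_real \<alpha> * Ln r) * (of_real \<alpha> / r)) \<le> 2 * ((5 + ln s) * s powr \<gamma>)" .
    have "norm (D r) \<le> 2 * ((5 + ln s) * s powr \<gamma>) + \<bar>\<beta>\<bar> * (T * (3 * exp 1 * ((5 + ln s) * s powr \<gamma>)))"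
      unfolding D_def
    proof (intro norm_triangle_le add_mono)
      show "norm (of_real \<beta> * (- \<i> * (tanC (of_real \<alpha>) * (Ln r * expq (w r) + expq (w r) + Ln r * (of_real (\<alpha> - 1) * (deriv ^^ 1) expq (w r))))))
        \<le> \<bar>\<beta>\<bar> * (T * (3 * exp 1 * ((5 + ln s) * s powr \<gamma>)))"
        unfolding norm_mult[of "of_real \<beta>"] norm_mult[of "- \<i>"] norm_mult[of "tanC (of_real \<alpha>)"]
        using 1 by (auto simp: T_def intro!: mult_left_mono)
    qed (use 2 in simp)
    also have "\<dots> = (2 + \<bar>\<beta>\<bar> * (T * (3 * exp 1))) * ((5 + ln s) * s powr \<gamma>)"
      by (simp add: algebra_simps)
    also have "\<dots> \<le> (2 + \<bar>\<beta>\<bar> * (T * (3 * exp 1))) * ((5 + 1 / \<kappa>) * s powr (\<alpha> / 2))"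
    proof (intro mult_left_mono)
      have "ln s = 1 / \<kappa> * ln (s powr \<kappa>)" using s \<kappa> by (simp add: ln_powr)
      also have "\<dots> \<le> 1 / \<kappa> * s powr \<kappa>" using s \<kappa> ln_bound[of "s powr \<kappa>"] by (intro mult_left_mono) auto
      finally have "5 + ln s \<le> (5 + 1 / \<kappa>) * s powr \<kappa>"
        using ge_one_powr_ge_zero[of s \<kappa>] s \<kappa> by (simp add: distrib_right)
      then have "(5 + ln s) * s powr \<gamma> \<le> ((5 + 1 / \<kappa>) * s powr \<kappa>) * s powr \<gamma>"
        by (intro mult_right_mono) auto
      also have "\<dots> = (5 + 1 / \<kappa>) * s powr (\<alpha> / 2)"
        using s by (simp add: \<kappa>_def powr_diff)
      finally show "(5 + ln s) * s powr \<gamma> \<le> (5 + 1 / \<kappa>) * s powr (\<alpha> / 2)" .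
    qed (auto simp: T_def)
    finally show "norm (D r) \<le> K * norm r powr (\<alpha> / 2)"
      by (simp add: K_def s_def mult.assoc)
  qed
qed

text \<open>On the real axis the real part is -X^\<alpha>. Descending by at most 1 changes the
  exponent by at most 2 K X^(\<alpha>/2), by the derivative bound, and 2 a b \<le> a^2 + b^2 splits
  this into a constant and half of X^\<alpha>. Small \<open>X\<close> is covered by the polynomial
  bound.\<close>

lemma Re_mD_0_strip:
  assumes \<alpha>: "0 < \<alpha>" "\<alpha> < 2"
  obtains c where "\<And>X v. 0 < X \<Longrightarrow> 0 \<le> v \<Longrightarrow> v \<le> 1 \<Longrightarrow>
    Re (mD 0 \<alpha> \<beta> (Complex X (- v))) \<le> c - X powr \<alpha> / 2"
proof -
  obtain D K where D: "K \<ge> 0" "\<And>r. 1 \<le> Re r \<Longrightarrow> (mD 0 \<alpha> \<beta> has_field_derivative D r) (at r)"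
    "\<And>r. 1 \<le> Re r \<Longrightarrow> norm (D r) \<le> K * norm r powr (\<alpha> / 2)"
    using mD_0_has_field_derivative_bound[OF \<alpha>] by metis
  obtain C n where C: "C \<ge> 0" "\<And>r. r \<in> slit \<Longrightarrow> norm (mD 0 \<alpha> \<beta> r) \<le> C * (1 + norm r) ^ n"
    using admissible_bound[OF admissible_D[of 0], of \<alpha> \<alpha> "\<bar>\<beta>\<bar>"] \<alpha> by (metis order_refl)
  \<comment> \<open>The first summand is the constant left by the quadratic inequality. The others
    treat \<open>X < 1\<close>, where \<open>1 + norm ?r \<le> 3\<close> and the final 1 pays for
    \<open>X powr \<alpha> / 2\<close>.\<close>
  define c where "c = (2 * K)\<^sup>2 / 2 + (C * 3 ^ n + 1)"
  show ?thesis
  proof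
    fix X v :: real assume X: "0 < X" and v: "0 \<le> v" "v \<le> 1"
    let ?r = "Complex X (- v)"
    have nr: "norm ?r \<le> X + 1" using cmod_le[of ?r] X v by simp
    show "Re (mD 0 \<alpha> \<beta> ?r) \<le> c - X powr \<alpha> / 2"
    proof (cases "X < 1")
      case True
      have "Re (mD 0 \<alpha> \<beta> ?r) \<le> C * (1 + norm ?r) ^ n"
        using C(2)[of ?r] X complex_Re_le_cmod[of "mD 0 \<alpha> \<beta> ?r"] Re_pos_in_slit[of ?r] by simp
      also have "\<dots> \<le> C * 3 ^ n" using nr True C(1) by (intro mult_left_mono power_mono) auto
      finally show ?thesis
        using powr_le1[of \<alpha> X] X True \<alpha> zero_le_power2[of "2 * K"] unfolding c_def by linarith
    next
      case False
      have "norm (mD 0 \<alpha> \<beta> ?r - mD 0 \<alpha> \<beta> (of_real X)) \<le> 2 * K * X powr (\<alpha> / 2) * norm (?r - of_real X)"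
      proof (rule field_differentiable_bound[where S = "closed_segment (of_real X) ?r" and f' = D])
        fix z assume "z \<in> closed_segment (of_real X) ?r"
        then obtain t where t: "0 \<le> t" "t \<le> 1" "z = Complex X (- (t * v))"
          by (auto simp: in_segment complex_eq_iff algebra_simps)
        then have Re: "1 \<le> Re z" using False by simp
        show "(mD 0 \<alpha> \<beta> has_field_derivative D z) (at z within closed_segment (of_real X) ?r)"
          using D(2)[OF Re] by (rule has_field_derivative_at_within)
        have "t * v \<le> 1" using t v mult_mono[of t 1 v 1] by simp
        then have "norm z \<le> 2 * X" using cmod_le[of z] t v False by simp
        then have "norm z powr (\<alpha> / 2) \<le> (2 * X) powr (\<alpha> / 2)"
          using \<alpha> by (intro powr_mono2) auto
        also have "\<dots> \<le> 2 * X powr (\<alpha> / 2)"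
          using X \<alpha> powr_mono[of "\<alpha> / 2" 1 2] by (simp add: powr_mult)
        finally have "K * norm z powr (\<alpha> / 2) \<le> K * (2 * X powr (\<alpha> / 2))"
          using D(1) by (rule mult_left_mono)
        then show "norm (D z) \<le> 2 * K * X powr (\<alpha> / 2)"
          using D(3)[OF Re] by simp
      qed auto
      also have "norm (?r - of_real X) \<le> 1" using v cmod_le[of "?r - of_real X"] by simp
      then have "2 * K * X powr (\<alpha> / 2) * norm (?r - of_real X) \<le> 2 * K * X powr (\<alpha> / 2) * 1"
        using D(1) by (intro mult_left_mono) auto
      finally have "Re (mD 0 \<alpha> \<beta> ?r) \<le> Re (mD 0 \<alpha> \<beta> (of_real X)) + 2 * K * X powr (\<alpha> / 2)"
        using complex_Re_le_cmod[of "mD 0 \<alpha> \<beta> ?r - mD 0 \<alpha> \<beta> (of_real X)"] by simp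
      also have "Re (mD 0 \<alpha> \<beta> (of_real X)) = - (X powr \<alpha>)"
        using stabKd_real[OF \<alpha> X, of 0] X by (simp add: mD_def mB_def Ln_of_real Re_exp powr_def)
      also have "2 * K * X powr (\<alpha> / 2) \<le> (2 * K)\<^sup>2 / 2 + X powr \<alpha> / 2"
      proof -
        have "X powr \<alpha> = (X powr (\<alpha> / 2))\<^sup>2" using X by (simp add: power2_eq_square flip: powr_add)
        then show ?thesis using sum_squares_bound[of "2 * K" "X powr (\<alpha> / 2)"] by simp
      qed
      finally show ?thesis using C(1) unfolding c_def by (simp add: field_simps) (smt (verit) zero_le_power mult_nonneg_nonneg)
    qed
  qed
qed

section \<open>The contour shift in a half-strip of depth 1\<close>

abbreviation segment1 :: "real measure" where
  "segment1 \<equiv> restrict_space lborel {0<..1}"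

lemma space_segment1: "space segment1 = {0<..1}"
  by (simp add: space_restrict_space)

lemma integral_segment1_FTC:
  fixes f :: "real \<Rightarrow> 'b::euclidean_space"
  assumes "\<And>x. 0 \<le> x \<Longrightarrow> x \<le> 1 \<Longrightarrow> (F has_vector_derivative f x) (at x within {0..1})" "continuous_on {0..1} f"
  shows "integral\<^sup>L segment1 f = F 1 - F 0"
proof -
  have "integral\<^sup>L segment1 f = (LINT x|lborel. indicator {0<..1} x *\<^sub>R f x)"
    by (simp add: integral_restrict_space)
  also have "\<dots> = (LINT x|lborel. indicator {0..1} x *\<^sub>R f x)"
  proof (rule integral_cong_AE)
    show [measurable]: "(\<lambda>x. indicator {0..1} x *\<^sub>R f x) \<in> borel_measurable lborel"
      using borel_measurable_continuous_on_indicator[OF _ assms(2)] by simp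
    have "(\<lambda>x. indicator {0<..1} x *\<^sub>R (indicator {0..1} x *\<^sub>R f x)) \<in> borel_measurable lborel"
      by measurable
    also have "(\<lambda>x. indicator {0<..1} x *\<^sub>R (indicator {0..1} x *\<^sub>R f x)) = (\<lambda>x. indicator {0<..1} x *\<^sub>R f x)"
      by (auto simp: indicator_def)
    finally show "(\<lambda>x. indicator {0<..1} x *\<^sub>R f x) \<in> borel_measurable lborel" .
    show "AE x in lborel. indicator {0<..1} x *\<^sub>R f x = indicator {0..1} x *\<^sub>R f x"
      using AE_lborel_singleton[of "0::real"] by eventually_elim (auto simp: indicator_def)
  qed
  also have "\<dots> = F 1 - F 0"
    by (rule integral_FTC_atLeastAtMost) (use assms in auto)
  finally show ?thesis .
qed

lemma integrable_segment1_const: "integrable segment1 (\<lambda>x. c :: real)"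
  by (subst integrable_restrict_space) (auto intro!: integrable_mult_left simp: emeasure_lborel_Ioc)

lemma measurable_segment1:
  fixes f :: "real \<Rightarrow> 'b::topological_space"
  shows "continuous_on {0<..1} f \<Longrightarrow> f \<in> borel_measurable segment1"
  using borel_measurable_continuous_on_restrict[of "{0<..1}" f]
  by (simp cong: measurable_cong_sets add: sets_restrict_space_cong[OF sets_lborel])

text \<open>On the convex right half-plane \<open>F\<close> has a primitive \<open>\<Theta>\<close>,
  which gives Cauchy's theorem for rectangles between the abscissae \<epsilon> and R. The imaginary
  axis is only the boundary of this half-plane, hence the limit \<epsilon> to 0. The bound dominates
  the horizontal sides, lets the right side vanish, and bounds the left side, which converges by
  continuity of \<open>F\<close> on \<open>slit\<close>.\<close>

lemma integral_shift_contour: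
  assumes F: "F holomorphic_on slit" and a: "0 < a" "0 < c"
    and bd: "\<And>x v. 0 < x \<Longrightarrow> 0 \<le> v \<Longrightarrow> v \<le> 1 \<Longrightarrow> norm (F (Complex x (- v))) \<le> B * ((1 + x) ^ n * exp (- c * x powr a))"
  shows "(LINT x|halfline. F (of_real x)) =
    - \<i> * (LINT u|segment1. F (- \<i> * of_real u)) + (LINT x|halfline. F (Complex x (- 1)))"
proof -
  have w: "integrable halfline (\<lambda>x. B * ((1 + x) ^ n * exp (- c * x powr a)))"
    using integrable_power_exp_powr[OF a] by (rule integrable_mult_right)
  obtain K where K: "K > 0" "\<And>r. 0 < r \<Longrightarrow> (1 + r) ^ (n + 1) \<le> K * exp (c * r powr a)"
    using power_le_exp_powr[OF a] by metis
  \<comment> \<open>In this form the bound is constant near \<open>x = 0\<close>, which dominates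
    the vertical sides, and tends to 0 at infinity.\<close>
  have bd2: "norm (F (Complex x (- v))) \<le> \<bar>B\<bar> * K / (1 + x)" if "0 < x" "0 \<le> v" "v \<le> 1" for x v
  proof -
    have "(1 + x) ^ n * exp (- c * x powr a) * (1 + x) = exp (- c * x powr a) * (1 + x) ^ (n + 1)"
      by simp
    also have "\<dots> \<le> exp (- c * x powr a) * (K * exp (c * x powr a))"
      using K(2)[OF \<open>0 < x\<close>] by (intro mult_left_mono) auto
    also have "\<dots> = K" by (simp add: exp_minus)
    finally have "(1 + x) ^ n * exp (- c * x powr a) \<le> K / (1 + x)"
      using that by (simp add: pos_le_divide_eq)
    then have "B * ((1 + x) ^ n * exp (- c * x powr a)) \<le> \<bar>B\<bar> * (K / (1 + x))"
      using that by (intro mult_mono) auto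
    then show ?thesis using bd[OF that] by simp
  qed
  have conv: "convex {r. 0 < Re r}" by (simp add: convex_halfspace_Re_gt)
  have op: "open {r. 0 < Re r}" by (simp add: open_halfspace_Re_gt)
  have sub: "{r. 0 < Re r} \<subseteq> slit" using Re_pos_in_slit by auto
  obtain \<Theta> where \<Theta>': "\<And>r. 0 < Re r \<Longrightarrow> (\<Theta> has_field_derivative F r) (at r within {r. 0 < Re r})"
    using holomorphic_convex_primitive'[OF conv op holomorphic_on_subset[OF F sub]] by auto
  then have \<Theta>: "(\<Theta> has_field_derivative F r) (at r)" if "0 < Re r" for r
    using \<Theta>'[OF that] at_within_open[OF _ op, of r] that by simp
  have contF: "continuous_on slit F"
    by (rule holomorphic_on_imp_continuous_on[OF F])
  have vert: "(LINT u|segment1. - \<i> * F (Complex x (- u))) = \<Theta> (Complex x (- 1)) - \<Theta> (of_real x)" if "0 < x" for x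
  proof -
    have "(LINT u|segment1. - \<i> * F (Complex x (- u))) = \<Theta> (Complex x (- 1)) - \<Theta> (Complex x (- 0))"
    proof (rule integral_segment1_FTC)
      fix u :: real
      have "((\<lambda>u. Complex x (- u)) has_vector_derivative - \<i>) (at u within {0..1})"
        unfolding Complex_eq by (auto intro!: derivative_eq_intros)
      from field_vector_diff_chain_within[OF this has_field_derivative_at_within[OF \<Theta>]]
      show "((\<lambda>u. \<Theta> (Complex x (- u))) has_vector_derivative - \<i> * F (Complex x (- u))) (at u within {0..1})"
        using that by (simp add: comp_def)
    next
      show "continuous_on {0..1} (\<lambda>u. - \<i> * F (Complex x (- u)))"
        by (intro continuous_intros continuous_on_compose2[OF contF])
          (auto simp: Complex_eq intro!: continuous_intros Re_pos_in_slit that)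
    qed
    then show ?thesis by (simp add: complex_of_real_def)
  qed
  have horiz: "(LINT x|halfline. indicator {\<epsilon>..R} x *\<^sub>R F (Complex x (- v))) = \<Theta> (Complex R (- v)) - \<Theta> (Complex \<epsilon> (- v))"
    if "0 < \<epsilon>" "\<epsilon> \<le> R" for \<epsilon> R v
  proof -
    have "(LINT x|halfline. indicator {\<epsilon>..R} x *\<^sub>R F (Complex x (- v))) =
        (LINT x|lborel. indicator {\<epsilon>..R} x *\<^sub>R F (Complex x (- v)))"
      by (subst integral_restrict_space) (use that in \<open>auto intro!: Bochner_Integration.integral_cong simp: indicator_def\<close>)
    also have "\<dots> = \<Theta> (Complex R (- v)) - \<Theta> (Complex \<epsilon> (- v))"
    proof (rule integral_FTC_atLeastAtMost[OF \<open>\<epsilon> \<le> R\<close>])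
      fix x assume "\<epsilon> \<le> x" "x \<le> R"
      have "((\<lambda>x. Complex x (- v)) has_vector_derivative 1) (at x within {\<epsilon>..R})"
        unfolding Complex_eq by (auto intro!: derivative_eq_intros)
      from field_vector_diff_chain_within[OF this has_field_derivative_at_within[OF \<Theta>]]
      show "((\<lambda>x. \<Theta> (Complex x (- v))) has_vector_derivative F (Complex x (- v))) (at x within {\<epsilon>..R})"
        using \<open>\<epsilon> \<le> x\<close> that by (simp add: comp_def)
    next
      show "continuous_on {\<epsilon>..R} (\<lambda>x. F (Complex x (- v)))"
        using that by (intro continuous_on_compose2[OF contF])
          (auto simp: Complex_eq intro!: continuous_intros Re_pos_in_slit)
    qed
    finally show ?thesis .
  qed
  define \<epsilon> R where "\<epsilon> k = 1 / real (Suc k)" and "R k = real (Suc k)" for k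
  have \<epsilon>R: "0 < \<epsilon> k" "\<epsilon> k \<le> R k" "0 < R k" for k by (auto simp: \<epsilon>_def R_def field_simps)
  have \<epsilon>0: "\<epsilon> \<longlonglongrightarrow> 0" unfolding \<epsilon>_def by real_asymp
  have lim_h: "(\<lambda>k. LINT x|halfline. indicator {\<epsilon> k..R k} x *\<^sub>R F (Complex x (- v))) \<longlonglongrightarrow> (LINT x|halfline. F (Complex x (- v)))"
    if v: "0 \<le> v" "v \<le> 1" for v
  proof (rule integral_dominated_convergence[OF _ _ w])
    show m: "(\<lambda>x. F (Complex x (- v))) \<in> borel_measurable halfline"
      by (intro measurable_halfline continuous_on_compose2[OF contF])
        (auto simp: Complex_eq intro!: continuous_intros Re_pos_in_slit)
    show "(\<lambda>x. indicator {\<epsilon> k..R k} x *\<^sub>R F (Complex x (- v))) \<in> borel_measurable halfline" for k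
    proof (intro borel_measurable_scaleR m)
      have "indicator {\<epsilon> k..R k} \<in> borel_measurable (lborel :: real measure)" by simp
      then show "(indicator {\<epsilon> k..R k} :: real \<Rightarrow> real) \<in> borel_measurable halfline"
        by (rule measurable_restrict_space1)
    qed
    show "AE x in halfline. (\<lambda>k. indicator {\<epsilon> k..R k} x *\<^sub>R F (Complex x (- v))) \<longlonglongrightarrow> F (Complex x (- v))"
    proof (rule AE_I2)
      fix x assume "x \<in> space halfline"
      then have x: "0 < x" by (simp add: space_halfline)
      have "\<forall>\<^sub>F k in sequentially. \<epsilon> k < x" using \<epsilon>0 x by (rule order_tendstoD)
      moreover have "\<forall>\<^sub>F k in sequentially. x \<le> R k" unfolding R_def by real_asymp
      ultimately have "\<forall>\<^sub>F k in sequentially. indicator {\<epsilon> k..R k} x *\<^sub>R F (Complex x (- v)) = F (Complex x (- v))"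
        by eventually_elim auto
      then show "(\<lambda>k. indicator {\<epsilon> k..R k} x *\<^sub>R F (Complex x (- v))) \<longlonglongrightarrow> F (Complex x (- v))"
        by (rule tendsto_eventually)
    qed
    show "AE x in halfline. norm (indicator {\<epsilon> k..R k} x *\<^sub>R F (Complex x (- v))) \<le> B * ((1 + x) ^ n * exp (- c * x powr a))" for k
    proof (rule AE_I2)
      fix x assume "x \<in> space halfline"
      then have "0 < x" by (simp add: space_halfline)
      from bd[OF this v] show "norm (indicator {\<epsilon> k..R k} x *\<^sub>R F (Complex x (- v))) \<le> B * ((1 + x) ^ n * exp (- c * x powr a))"
        using norm_ge_zero[of "F (Complex x (- v))"] by (auto simp: indicator_def simp del: norm_ge_zero)
    qed
  qed
  have meas_v: "(\<lambda>u. - \<i> * F (Complex x (- u))) \<in> borel_measurable segment1" if "0 \<le> x" for x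
    using that by (intro measurable_segment1 continuous_intros continuous_on_compose2[OF contF])
      (auto simp: Complex_eq slit_def complex_nonpos_Reals_iff intro!: continuous_intros)
  have bdv: "norm (- \<i> * F (Complex x (- u))) \<le> \<bar>B\<bar> * K" if "0 < x" "u \<in> space segment1" for x u
  proof -
    have "norm (F (Complex x (- u))) \<le> \<bar>B\<bar> * K / (1 + x)"
      using that by (intro bd2) (auto simp: space_segment1)
    also have "\<dots> \<le> \<bar>B\<bar> * K / 1"
      using that K(1) by (intro divide_left_mono) auto
    finally show ?thesis by (simp add: norm_mult)
  qed
  have lim_left: "(\<lambda>k. LINT u|segment1. - \<i> * F (Complex (\<epsilon> k) (- u))) \<longlonglongrightarrow> (LINT u|segment1. - \<i> * F (Complex 0 (- u)))"
  proof (rule integral_dominated_convergence[OF _ _ integrable_segment1_const[of "\<bar>B\<bar> * K"]])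
    show "AE u in segment1. (\<lambda>k. - \<i> * F (Complex (\<epsilon> k) (- u))) \<longlonglongrightarrow> - \<i> * F (Complex 0 (- u))"
    proof (rule AE_I2)
      fix u assume "u \<in> space segment1"
      then have "Complex 0 (- u) \<in> slit" by (auto simp: space_segment1 slit_def complex_nonpos_Reals_iff)
      then have "isCont F (Complex 0 (- u))"
        using contF open_slit by (simp add: continuous_on_eq_continuous_at)
      moreover have "(\<lambda>k. Complex (\<epsilon> k) (- u)) \<longlonglongrightarrow> Complex 0 (- u)"
        using \<epsilon>0 by (intro tendsto_Complex) auto
      ultimately show "(\<lambda>k. - \<i> * F (Complex (\<epsilon> k) (- u))) \<longlonglongrightarrow> - \<i> * F (Complex 0 (- u))"
        by (intro tendsto_mult tendsto_const isCont_tendsto_compose[of _ F])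
    qed
  qed (use meas_v \<epsilon>R bdv in \<open>auto intro: less_imp_le\<close>)
  have lim_right: "(\<lambda>k. LINT u|segment1. - \<i> * F (Complex (R k) (- u))) \<longlonglongrightarrow> (LINT u|segment1. 0)"
  proof (rule integral_dominated_convergence[OF _ _ integrable_segment1_const[of "\<bar>B\<bar> * K"]])
    show "AE u in segment1. (\<lambda>k. - \<i> * F (Complex (R k) (- u))) \<longlonglongrightarrow> 0"
    proof (rule AE_I2)
      fix u assume u: "u \<in> space segment1"
      show "(\<lambda>k. - \<i> * F (Complex (R k) (- u))) \<longlonglongrightarrow> 0"
      proof (rule Lim_null_comparison)
        show "\<forall>\<^sub>F k in sequentially. norm (- \<i> * F (Complex (R k) (- u))) \<le> \<bar>B\<bar> * K / (1 + R k)"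
          using bd2[OF \<epsilon>R(3), of u] u by (auto simp: norm_mult space_segment1)
        show "(\<lambda>k. \<bar>B\<bar> * K / (1 + R k)) \<longlonglongrightarrow> 0" unfolding R_def by real_asymp
      qed
    qed
  qed (use meas_v[OF less_imp_le[OF \<epsilon>R(3)]] \<epsilon>R bdv in auto)
  \<comment> \<open>Cauchy's theorem for the rectangle: all four sides are differences of values of
    \<open>\<Theta>\<close> at the corners.\<close>
  have eq: "(LINT x|halfline. indicator {\<epsilon> k..R k} x *\<^sub>R F (Complex x (- 0))) =
      (LINT u|segment1. - \<i> * F (Complex (\<epsilon> k) (- u))) +
      (LINT x|halfline. indicator {\<epsilon> k..R k} x *\<^sub>R F (Complex x (- 1))) -
      (LINT u|segment1. - \<i> * F (Complex (R k) (- u)))" for k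
    unfolding vert[OF \<epsilon>R(1)] vert[OF \<epsilon>R(3)] horiz[OF \<epsilon>R(1,2)] by (simp add: complex_of_real_def)
  have "(\<lambda>k. LINT x|halfline. indicator {\<epsilon> k..R k} x *\<^sub>R F (Complex x (- 0))) \<longlonglongrightarrow>
      (LINT u|segment1. - \<i> * F (Complex 0 (- u))) + (LINT x|halfline. F (Complex x (- 1))) - (LINT u|segment1. 0)"
    unfolding eq by (intro tendsto_add tendsto_diff lim_left lim_right lim_h) auto
  then have "(LINT x|halfline. F (Complex x (- 0))) =
      (LINT u|segment1. - \<i> * F (Complex 0 (- u))) + (LINT x|halfline. F (Complex x (- 1))) - (LINT u|segment1. 0)"
    using lim_h[of 0] LIMSEQ_unique by auto
  moreover have "Complex 0 (- u) = - \<i> * of_real u" "Complex u 0 = of_real u" for u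
    by (simp_all add: complex_eq_iff)
  ultimately show ?thesis by simp
qed

section \<open>Tails\<close>

definition segI :: "(real \<Rightarrow> real) \<Rightarrow> real \<Rightarrow> real" where
  "segI H y = (LINT u|segment1. exp (- y * u) * H u)"

text \<open>On the segment r = -i u one has dr = -i du, so the real part of the contour integral is
  the integral of the imaginary part of the integrand.\<close>

definition rotH :: "mult \<Rightarrow> real \<Rightarrow> real \<Rightarrow> real \<Rightarrow> real" where
  "rotH P \<alpha> \<beta> u = Im (P \<alpha> \<beta> (- \<i> * of_real u) * exp (mD 0 \<alpha> \<beta> (- \<i> * of_real u)))"

lemma Im_of_real_mult: "Im (of_real a * z) = a * Im z"
  by simp

lemma admissible_bound_at:
  assumes "admissible P" "0 < \<alpha>" "\<alpha> < 2"
  obtains C n where "C \<ge> 0" "\<And>r. r \<in> slit \<Longrightarrow> norm (P \<alpha> \<beta> r) \<le> C * (1 + norm r) ^ n"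
  using admissible_bound[OF assms, of "\<bar>\<beta>\<bar>"] assms by (metis order_refl)

lemma admissible_bound_neg_imag:
  assumes "admissible P" "0 < \<alpha>" "\<alpha> < 2"
  obtains C where "C \<ge> 0" "\<And>u. 0 < u \<Longrightarrow> u \<le> 1 \<Longrightarrow> norm (P \<alpha> \<beta> (- \<i> * of_real u)) \<le> C"
proof -
  obtain C n where C: "C \<ge> 0" "\<And>r. r \<in> slit \<Longrightarrow> norm (P \<alpha> \<beta> r) \<le> C * (1 + norm r) ^ n"
    using admissible_bound_at[OF assms] by metis
  show ?thesis
  proof
    show "C * 2 ^ n \<ge> 0" using C by simp
    fix u :: real assume u: "0 < u" "u \<le> 1"
    have "norm (P \<alpha> \<beta> (- \<i> * of_real u)) \<le> C * (1 + u) ^ n"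
      using C(2)[OF neg_imag_in_slit[OF u(1)]] u by (simp add: norm_mult)
    also have "\<dots> \<le> C * 2 ^ n" using u C(1) by (intro mult_left_mono power_mono) auto
    finally show "norm (P \<alpha> \<beta> (- \<i> * of_real u)) \<le> C * 2 ^ n" .
  qed
qed

lemma rotH_bounded:
  assumes "admissible P" "0 < \<alpha>" "\<alpha> < 2"
  obtains B where "\<And>u. 0 < u \<Longrightarrow> u \<le> 1 \<Longrightarrow> \<bar>rotH P \<alpha> \<beta> u\<bar> \<le> B"
proof -
  obtain C where C: "C \<ge> 0" "\<And>u. 0 < u \<Longrightarrow> u \<le> 1 \<Longrightarrow> norm (P \<alpha> \<beta> (- \<i> * of_real u)) \<le> C"
    using admissible_bound_neg_imag[OF assms] by metis
  obtain M where M: "M \<ge> 0" "\<And>u. 0 < u \<Longrightarrow> u \<le> 1 \<Longrightarrow> norm (mD 0 \<alpha> \<beta> (- \<i> * of_real u)) \<le> M"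
    using admissible_bound_neg_imag[OF admissible_D assms(2,3)] by metis
  show ?thesis
  proof
    fix u :: real assume u: "0 < u" "u \<le> 1"
    have "\<bar>rotH P \<alpha> \<beta> u\<bar> \<le> norm (P \<alpha> \<beta> (- \<i> * of_real u)) * exp (Re (mD 0 \<alpha> \<beta> (- \<i> * of_real u)))"
      unfolding rotH_def using abs_Im_le_cmod by (metis norm_mult norm_exp_eq_Re)
    also have "\<dots> \<le> C * exp M"
      using C M(2)[OF u] u complex_Re_le_cmod[of "mD 0 \<alpha> \<beta> (- \<i> * of_real u)"] by (intro mult_mono) auto
    finally show "\<bar>rotH P \<alpha> \<beta> u\<bar> \<le> C * exp M" .
  qed
qed

lemma measurable_rotH:
  assumes "admissible P" "0 < \<alpha>" "\<alpha> < 2"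
  shows "rotH P \<alpha> \<beta> \<in> borel_measurable segment1"
proof -
  have "continuous_on slit (\<lambda>r. P \<alpha> \<beta> r * exp (mD 0 \<alpha> \<beta> r))"
    using assms by (intro holomorphic_on_imp_continuous_on holomorphic_intros admissible_holomorphic admissible_D)
  then have "continuous_on {0<..1} (\<lambda>u. P \<alpha> \<beta> (- \<i> * of_real u) * exp (mD 0 \<alpha> \<beta> (- \<i> * of_real u)))"
    by (rule continuous_on_compose2) (auto intro!: continuous_intros simp: slit_def complex_nonpos_Reals_iff)
  then show ?thesis
    unfolding rotH_def[abs_def] by (intro measurable_segment1 continuous_on_Im)
qed

lemma integrable_segment1_bounded:
  fixes f :: "real \<Rightarrow> 'b::{banach,second_countable_topology}"
  assumes "f \<in> borel_measurable segment1" "\<And>u. 0 < u \<Longrightarrow> u \<le> 1 \<Longrightarrow> norm (f u) \<le> B"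
  shows "integrable segment1 f"
proof (rule Bochner_Integration.integrable_bound[OF integrable_segment1_const[of B] assms(1)], rule AE_I2)
  fix u assume "u \<in> space segment1"
  then show "norm (f u) \<le> norm B" using assms(2)[of u] by (simp add: space_segment1)
qed

lemma integrable_segI:
  assumes "admissible P" "0 < \<alpha>" "\<alpha> < 2" "continuous_on {0<..1} g" "\<And>u. 0 < u \<Longrightarrow> u \<le> 1 \<Longrightarrow> \<bar>g u\<bar> \<le> D"
  shows "integrable segment1 (\<lambda>u. g u * rotH P \<alpha> \<beta> u)"
proof -
  obtain B where B: "\<And>u. 0 < u \<Longrightarrow> u \<le> 1 \<Longrightarrow> \<bar>rotH P \<alpha> \<beta> u\<bar> \<le> B"
    using rotH_bounded[OF assms(1-3)] by metis
  show ?thesis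
  proof (rule integrable_segment1_bounded)
    show "(\<lambda>u. g u * rotH P \<alpha> \<beta> u) \<in> borel_measurable segment1"
      by (intro borel_measurable_times measurable_rotH measurable_segment1 assms)
    fix u :: real assume u: "0 < u" "u \<le> 1"
    show "norm (g u * rotH P \<alpha> \<beta> u) \<le> D * B"
      unfolding real_norm_def abs_mult using assms(5)[OF u] B[OF u] by (intro mult_mono) auto
  qed
qed

lemma Re_stabI_rotate:
  assumes P: "admissible P" and \<alpha>: "0 < \<alpha>" "\<alpha> < 2"
  obtains K where "K \<ge> 0" "\<And>y. \<bar>Re (stabI P (- y) \<alpha> \<beta>) - segI (rotH P \<alpha> \<beta>) y\<bar> \<le> K * exp (- y)"
proof -
  obtain c0 where c0: "\<And>X v. 0 < X \<Longrightarrow> 0 \<le> v \<Longrightarrow> v \<le> 1 \<Longrightarrow>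
    Re (mD 0 \<alpha> \<beta> (Complex X (- v))) \<le> c0 - X powr \<alpha> / 2" using Re_mD_0_strip[OF \<alpha>] by metis
  obtain C n where C: "C \<ge> 0" "\<And>r. r \<in> slit \<Longrightarrow> norm (P \<alpha> \<beta> r) \<le> C * (1 + norm r) ^ n"
    using admissible_bound_at[OF assms] by metis
  define W where "W x = (1 + x) ^ n * exp (- (1/2) * x powr \<alpha>)" for x
  have W: "integrable halfline W" unfolding W_def using integrable_power_exp_powr[OF \<alpha>(1), of "1/2"] by simp
  \<comment> \<open>The depth \<open>v\<close> stays explicit: \<open>v = 1\<close> yields the error
    \<open>exp (- y)\<close> with a constant independent of \<open>y\<close>, while the contour
    shift for fixed \<open>y\<close> is served by \<open>exp \<bar>y\<bar>\<close>.\<close>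
  have bd: "norm (P \<alpha> \<beta> (Complex x (- v)) * kern (- y) \<alpha> \<beta> (Complex x (- v))) \<le> exp (- y * v) * (C * 2 ^ n * exp c0) * W x"
    if xv: "0 < x" "0 \<le> v" "v \<le> 1" for x v y
  proof -
    let ?r = "Complex x (- v)"
    have "norm (P \<alpha> \<beta> ?r) \<le> C * (1 + norm ?r) ^ n"
      using xv by (intro C Re_pos_in_slit) auto
    also have "\<dots> \<le> C * (2 * (1 + x)) ^ n"
      using cmod_le[of ?r] xv C(1) by (intro mult_left_mono power_mono) auto
    finally have 1: "norm (P \<alpha> \<beta> ?r) \<le> C * 2 ^ n * (1 + x) ^ n" by (simp only: power_mult_distrib mult.assoc)
    have "norm (kern (- y) \<alpha> \<beta> ?r) = exp (- y * v) * exp (Re (mD 0 \<alpha> \<beta> ?r))"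
      by (simp add: kern_def flip: exp_add)
    also have "\<dots> \<le> exp (- y * v) * exp (c0 - x powr \<alpha> / 2)"
      using c0[OF xv] by (intro mult_left_mono) auto
    finally have "norm (kern (- y) \<alpha> \<beta> ?r) \<le> exp (- y * v) * (exp c0 * exp (- (1/2) * x powr \<alpha>))"
      by (simp only: exp_add[symmetric]) simp
    with 1 have "norm (P \<alpha> \<beta> ?r) * norm (kern (- y) \<alpha> \<beta> ?r) \<le> (C * 2 ^ n * (1 + x) ^ n) * (exp (- y * v) * (exp c0 * exp (- (1/2) * x powr \<alpha>)))"
      using C(1) xv by (intro mult_mono) auto
    then show ?thesis by (simp add: norm_mult W_def mult_ac)
  qed
  have W0: "0 \<le> W x" if "0 < x" for x using that by (simp add: W_def)
  show ?thesis
  proof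
    let ?K = "C * 2 ^ n * exp c0 * integral\<^sup>L halfline W"
    have "0 \<le> integral\<^sup>L halfline W" using W0 by (intro integral_nonneg_AE AE_I2) (simp add: space_halfline)
    then show "0 \<le> ?K" using C(1) by simp
    fix y
    define F where "F r = P \<alpha> \<beta> r * kern (- y) \<alpha> \<beta> r" for r
    have Fh: "F holomorphic_on slit"
      unfolding F_def using assms by (intro holomorphic_intros admissible_holomorphic kern_holomorphic)
    have "stabI P (- y) \<alpha> \<beta> = - \<i> * (LINT u|segment1. F (- \<i> * of_real u)) + (LINT x|halfline. F (Complex x (- 1)))"
      unfolding stabI_def F_def[symmetric]
    proof (rule integral_shift_contour[OF Fh \<alpha>(1)])
      fix x v :: real assume xv: "0 < x" "0 \<le> v" "v \<le> 1"
      have "- y * v \<le> \<bar>y\<bar>" using xv mult_mono[of "\<bar>y\<bar>" "\<bar>y\<bar>" v 1] abs_le_D2[of "y * v" "\<bar>y\<bar>"] by (simp add: abs_mult)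
      then have "exp (- y * v) * (C * 2 ^ n * exp c0) * W x \<le> exp \<bar>y\<bar> * (C * 2 ^ n * exp c0) * W x"
        using C(1) W0[OF xv(1)] by (intro mult_right_mono) auto
      then show "norm (F (Complex x (- v))) \<le> exp \<bar>y\<bar> * (C * 2 ^ n * exp c0) * ((1 + x) ^ n * exp (- (1/2) * x powr \<alpha>))"
        using bd[OF xv, of y] unfolding F_def W_def by linarith
    qed simp
    moreover have "Re (- \<i> * (LINT u|segment1. F (- \<i> * of_real u))) = segI (rotH P \<alpha> \<beta>) y"
    proof -
      have eq: "Im (F (- \<i> * of_real u)) = exp (- y * u) * rotH P \<alpha> \<beta> u" for u
      proof -
        have "kern (- y) \<alpha> \<beta> (- \<i> * of_real u) = of_real (exp (- y * u)) * exp (mD 0 \<alpha> \<beta> (- \<i> * of_real u))"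
        proof -
          have "\<i> * of_real (- y) * (- \<i> * of_real u) = complex_of_real (- y * u)"
            by (simp add: algebra_simps)
          then show ?thesis unfolding kern_def exp_add by (simp only: exp_of_real)
        qed
        then have "F (- \<i> * of_real u) = of_real (exp (- y * u)) * (P \<alpha> \<beta> (- \<i> * of_real u) * exp (mD 0 \<alpha> \<beta> (- \<i> * of_real u)))"
          by (simp add: F_def)
        then show ?thesis by (simp only: rotH_def Im_of_real_mult)
      qed
      have "integrable segment1 (\<lambda>u. F (- \<i> * of_real u))"
      proof -
        obtain B where B: "B \<ge> 0" "\<And>u. 0 < u \<Longrightarrow> u \<le> 1 \<Longrightarrow> norm (P \<alpha> \<beta> (- \<i> * of_real u)) \<le> B"
          using admissible_bound_neg_imag[OF assms] by metis
        obtain M where M: "M \<ge> 0" "\<And>u. 0 < u \<Longrightarrow> u \<le> 1 \<Longrightarrow> norm (mD 0 \<alpha> \<beta> (- \<i> * of_real u)) \<le> M"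
          using admissible_bound_neg_imag[OF admissible_D \<alpha>] by metis
        show ?thesis
        proof (rule integrable_segment1_bounded)
          have "continuous_on slit F" by (rule holomorphic_on_imp_continuous_on[OF Fh])
          then have "continuous_on {0<..1} (\<lambda>u. F (- \<i> * of_real u))"
            by (rule continuous_on_compose2) (auto intro!: continuous_intros simp: slit_def complex_nonpos_Reals_iff)
          then show "(\<lambda>u. F (- \<i> * of_real u)) \<in> borel_measurable segment1" by (rule measurable_segment1)
          fix u :: real assume u: "0 < u" "u \<le> 1"
          have "- y * u \<le> \<bar>y\<bar>" using u mult_mono[of "\<bar>y\<bar>" "\<bar>y\<bar>" u 1] abs_le_D2[of "y * u" "\<bar>y\<bar>"] by (simp add: abs_mult)
          then have "Re (\<i> * of_real (- y) * (- \<i> * of_real u) + mD 0 \<alpha> \<beta> (- \<i> * of_real u)) \<le> \<bar>y\<bar> + M"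
            using M(2)[OF u] complex_Re_le_cmod[of "mD 0 \<alpha> \<beta> (- \<i> * of_real u)"] by simp
          then show "norm (F (- \<i> * of_real u)) \<le> B * exp (\<bar>y\<bar> + M)"
            unfolding F_def kern_def norm_mult norm_exp_eq_Re using B(1) B(2)[OF u] by (intro mult_mono) auto
        qed
      qed
      then have "Im (LINT u|segment1. F (- \<i> * of_real u)) = (LINT u|segment1. Im (F (- \<i> * of_real u)))"
        by simp
      then show ?thesis unfolding segI_def eq by simp
    qed
    moreover have "norm (LINT x|halfline. F (Complex x (- 1))) \<le> ?K * exp (- y)"
    proof -
      have "norm (LINT x|halfline. F (Complex x (- 1))) \<le> (LINT x|halfline. norm (F (Complex x (- 1))))"
        by (rule integral_norm_bound)
      also have "\<dots> \<le> (LINT x|halfline. exp (- y * 1) * (C * 2 ^ n * exp c0) * W x)"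
        by (rule integral_mono_AE'[OF integrable_mult_right[OF W]])
          (use bd[of _ 1 y] W0 C(1) in \<open>auto intro!: AE_I2 simp: F_def space_halfline\<close>)
      also have "\<dots> = ?K * exp (- y)" by simp
      finally show ?thesis .
    qed
    ultimately show "\<bar>Re (stabI P (- y) \<alpha> \<beta>) - segI (rotH P \<alpha> \<beta>) y\<bar> \<le> ?K * exp (- y)"
      using abs_Re_le_cmod[of "LINT x|halfline. F (Complex x (- 1))"] by (simp add: segI_def)
  qed
qed

section \<open>Decay of Laplace integrals\<close>

lemma exp_minus_le_powr:
  fixes q :: real
  obtains K where "K \<ge> 0" "\<And>y. exp 1 \<le> y \<Longrightarrow> exp (- y) \<le> K * (y powr (- q) * ln y ^ k)"
proof -
  have "\<exists>K>0. \<forall>r>0. (1 + r) ^ nat \<lceil>q\<rceil> \<le> K * exp (1 * r powr (1 :: real))"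
  proof (rule power_le_exp_powr[OF zero_less_one zero_less_one, where k = "nat \<lceil>q\<rceil>"])
    fix K :: real assume "0 < K" "\<And>r. 0 < r \<Longrightarrow> (1 + r) ^ nat \<lceil>q\<rceil> \<le> K * exp (1 * r powr 1)"
    then show ?thesis by (intro exI[of _ K]) auto
  qed
  then obtain K where "K > 0 \<and> (\<forall>r>0. (1 + r) ^ nat \<lceil>q\<rceil> \<le> K * exp (1 * r powr (1 :: real)))" ..
  then have K: "K > 0" "\<And>r. 0 < r \<Longrightarrow> (1 + r) ^ nat \<lceil>q\<rceil> \<le> K * exp (1 * r powr 1)"
    by simp_all
  show ?thesis
  proof
    show "K \<ge> 0" using K by simp
    fix y :: real assume y: "exp 1 \<le> y"
    have y1: "1 \<le> y" using y one_le_exp_iff[of 1] by linarith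
    \<comment> \<open>The threshold \<open>exp 1\<close> is chosen for this: a factor
      \<open>ln y ^ k\<close> can then only enlarge a bound.\<close>
    have ln: "1 \<le> ln y" using y ln_ge_iff[of y 1] y1 by simp
    have "y powr q \<le> y powr real (nat \<lceil>q\<rceil>)" using y1 by (intro powr_mono) linarith+
    also have "\<dots> = y ^ nat \<lceil>q\<rceil>" using y1 by (simp add: powr_realpow)
    also have "\<dots> \<le> (1 + y) ^ nat \<lceil>q\<rceil>" using y1 by (intro power_mono) auto
    also have "\<dots> \<le> K * exp y" using K(2)[of y] y1 by simp
    finally have "exp (- y) * y powr q \<le> K" by (simp add: exp_minus field_simps)
    then have "exp (- y) \<le> K * y powr (- q)"
      using y1 by (simp add: powr_minus field_simps)
    also have "\<dots> \<le> K * y powr (- q) * ln y ^ k"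
      using K(1) ln one_le_power[of "ln y" k] mult_left_mono[of 1 "ln y ^ k" "K * y powr (- q)"] by simp
    finally show "exp (- y) \<le> K * (y powr (- q) * ln y ^ k)" by simp
  qed
qed

text \<open>Substituting u = v / y takes y^-(j + a) out of the powers and a further 1 / y out of du.
  The logarithm of v / y splits into a factor in v, integrable against exp (-v), and a factor ln
  y.\<close>

lemma segI_tail:
  assumes a: "0 < a" "a \<le> 2"
    and H: "\<And>u. 0 < u \<Longrightarrow> u \<le> 1 \<Longrightarrow> \<bar>H u\<bar> \<le> C * (u ^ j * u powr a * (4 + \<bar>ln u\<bar>) ^ k)" and C: "C \<ge> 0"
  obtains K where "K \<ge> 0" "\<And>y. exp 1 \<le> y \<Longrightarrow> \<bar>segI H y\<bar> \<le> K * (y powr (- (1 + real j + a)) * ln y ^ k)"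
proof -
  obtain N where N: "N \<ge> 0" "\<And>s. 0 < s \<Longrightarrow> s powr a * (4 + \<bar>ln s\<bar>) ^ k \<le> N * (1 + s) ^ (k + 2)"
    using log_powr_bound[OF a(1), of k] a by (metis order_refl)
  define W where "W v = (1 + v) ^ (j + (k + 2)) * exp (- 1 * v powr 1)" for v :: real
  have W: "integrable lborel (\<lambda>v. indicator {0<..} v *\<^sub>R W v)"
  proof -
    have "integrable halfline W"
      unfolding W_def by (rule integrable_power_exp_powr) auto
    then show ?thesis by (subst (asm) integrable_restrict_space) auto
  qed
  define I where "I = (LINT v|lborel. indicator {0<..} v *\<^sub>R W v)"
  show ?thesis
  proof
    have "0 \<le> I" unfolding I_def by (intro integral_nonneg_AE AE_I2) (auto simp: W_def indicator_def)
    then show "0 \<le> C * 2 ^ k * N * I" using C N by simp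
    fix y :: real assume y: "exp 1 \<le> y"
    have y1: "1 \<le> y" using y one_le_exp_iff[of 1] by linarith
    have ln: "1 \<le> ln y" using y ln_ge_iff[of y 1] y1 by simp
    define G where "G u = indicator {0<..1} u *\<^sub>R (exp (- y * u) * H u)" for u
    define c where "c = C * 2 ^ k * N * (y powr (- (real j + a)) * ln y ^ k)"
    have c: "c \<ge> 0" using C N ln by (simp add: c_def)
    have "segI H y = (LINT u|lborel. G u)"
      unfolding segI_def G_def by (subst integral_restrict_space) auto
    also have "\<dots> = (1 / y) * (LINT v|lborel. G (v / y))"
      using lborel_integral_real_affine[of "1 / y" G 0] y1 by simp
    finally have eq: "segI H y = (1 / y) * (LINT v|lborel. G (v / y))" .
    have "norm (LINT v|lborel. G (v / y)) \<le> (LINT v|lborel. norm (G (v / y)))"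
      by (rule integral_norm_bound)
    also have "\<dots> \<le> (LINT v|lborel. c * (indicator {0<..} v *\<^sub>R W v))"
    proof (rule integral_mono_AE'[OF integrable_mult_right[OF W]]; rule AE_I2)
      fix v :: real
      show "0 \<le> c * (indicator {0<..} v *\<^sub>R W v)"
        using c by (auto simp: W_def indicator_def)
      show "norm (G (v / y)) \<le> c * (indicator {0<..} v *\<^sub>R W v)"
      proof (cases "0 < v \<and> v \<le> y")
        case False
        then have "G (v / y) = 0" using y1 by (auto simp: G_def indicator_def field_simps)
        then show ?thesis using c by (auto simp: indicator_def W_def)
      next
        case True
        then have v: "0 < v" "v / y \<le> 1" "0 < v / y" using y1 by auto
        have "\<bar>ln (v / y)\<bar> \<le> \<bar>ln v\<bar> + ln y" using v y1 ln by (simp add: ln_div)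
        \<comment> \<open>Expanded, this turns the sum \<open>4 + \<bar>ln v\<bar> + ln y\<close>
          into the product bound that separates \<open>v\<close> from \<open>y\<close>.\<close>
        moreover have "0 \<le> (3 + \<bar>ln v\<bar>) * (ln y - 1)" using ln by (intro mult_nonneg_nonneg) auto
        ultimately have "4 + \<bar>ln (v / y)\<bar> \<le> (4 + \<bar>ln v\<bar>) * (2 * ln y)"
          using mult_nonneg_nonneg[of "\<bar>ln v\<bar>" "ln y"] ln by (simp add: algebra_simps)
        then have l: "(4 + \<bar>ln (v / y)\<bar>) ^ k \<le> (4 + \<bar>ln v\<bar>) ^ k * (2 ^ k * ln y ^ k)"
          using power_mono[of "4 + \<bar>ln (v / y)\<bar>" "(4 + \<bar>ln v\<bar>) * (2 * ln y)" k] by (simp add: power_mult_distrib)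
        have "norm (G (v / y)) = exp (- v) * \<bar>H (v / y)\<bar>"
          using v y1 by (simp add: G_def abs_mult)
        also have "\<dots> \<le> exp (- v) * (C * ((v / y) ^ j * (v / y) powr a * (4 + \<bar>ln (v / y)\<bar>) ^ k))"
          using H[OF v(3,2)] by (intro mult_left_mono) auto
        also have "\<dots> \<le> exp (- v) * (C * ((v / y) ^ j * (v / y) powr a * ((4 + \<bar>ln v\<bar>) ^ k * (2 ^ k * ln y ^ k))))"
          using l C v by (intro mult_left_mono) auto
        also have "\<dots> = C * 2 ^ k * (y powr (- (real j + a)) * ln y ^ k) * (exp (- v) * v ^ j * (v powr a * (4 + \<bar>ln v\<bar>) ^ k))"
          using v y1 by (simp add: power_divide powr_divide powr_add powr_minus powr_realpow field_simps powr_diff)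
        also have "\<dots> \<le> C * 2 ^ k * (y powr (- (real j + a)) * ln y ^ k) * (exp (- v) * (1 + v) ^ j * (N * (1 + v) ^ (k + 2)))"
        proof (rule mult_left_mono[OF mult_mono[OF _ N(2)[OF v(1)]]])
          show "exp (- v) * v ^ j \<le> exp (- v) * (1 + v) ^ j"
            using v by (intro mult_left_mono power_mono) auto
        qed (use C ln v in auto)
        also have "\<dots> = c * (indicator {0<..} v *\<^sub>R W v)"
          using v by (simp only: c_def W_def power_add) (simp add: mult_ac)
        finally show ?thesis .
      qed
    qed
    also have "\<dots> = c * I" by (simp add: I_def)
    finally have "\<bar>segI H y\<bar> \<le> (1 / y) * (c * I)"
      unfolding eq abs_mult using y1 by (intro mult_mono) auto
    also have "\<dots> = C * 2 ^ k * N * I * (y powr (- (1 + real j + a)) * ln y ^ k)"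
    proof -
      have "- (1 + real j + a) = - (real j + a) - 1" by simp
      then have "y powr (- (1 + real j + a)) = y powr (- (real j + a)) / y"
        using y1 by (simp only: powr_diff) simp
      then show ?thesis by (simp only: c_def) (simp add: mult_ac)
    qed
    finally show "\<bar>segI H y\<bar> \<le> C * 2 ^ k * N * I * (y powr (- (1 + real j + a)) * ln y ^ k)" .
  qed
qed

section \<open>Two-sided decay, order of imaginary parts, and reflection\<close>

definition decays :: "(real \<Rightarrow> real) \<Rightarrow> real \<Rightarrow> nat \<Rightarrow> bool" where
  "decays f q k \<longleftrightarrow> (\<exists>K. \<forall>y. exp 1 \<le> \<bar>y\<bar> \<longrightarrow> \<bar>f y\<bar> \<le> K * (\<bar>y\<bar> powr (- q) * ln \<bar>y\<bar> ^ k))"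

text \<open>It measures how far the multiplier is from being real on the rotated ray. Only the
  imaginary part can be so small: for \<open>\<alpha> > 1\<close> the modulus of the skewness term
  may be of order \<open>u\<close>, which exceeds \<open>u powr \<alpha>\<close>.\<close>

definition imO :: "nat \<Rightarrow> mult \<Rightarrow> bool" where
  "imO k P \<longleftrightarrow> (\<forall>\<alpha> \<beta>. 0 < \<alpha> \<longrightarrow> \<alpha> < 2 \<longrightarrow> (\<exists>C\<ge>0. \<forall>u. 0 < u \<longrightarrow> u \<le> 1 \<longrightarrow>
     \<bar>Im (P \<alpha> \<beta> (- \<i> * of_real u))\<bar> \<le> C * (u powr \<alpha> * (4 + \<bar>ln u\<bar>) ^ k)))"

text \<open>On the positive axis conjugation reverses \<beta> up to the sign \<open>s\<close>, and
  for the kernel it reverses both m and \<beta>. This relates the two tails.\<close>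

definition parity :: "real \<Rightarrow> mult \<Rightarrow> bool" where
  "parity s P \<longleftrightarrow> (\<forall>\<alpha> \<beta> x. 0 < \<alpha> \<longrightarrow> \<alpha> < 2 \<longrightarrow> 0 < x \<longrightarrow>
     cnj (P \<alpha> \<beta> (of_real x)) = of_real s * P \<alpha> (- \<beta>) (of_real x))"

lemma parity_one: "parity 1 mone"
  by (simp add: parity_def)

lemma parity_A: "parity (-1) mA"
  by (simp add: parity_def mA_def)

lemma parity_B: "parity (-1) (mB j)"
  using stabKd_real by (simp add: parity_def mB_def complex_eq_iff)

lemma parity_D: "parity 1 (mD j)"
  using stabKd_real by (simp add: parity_def mD_def mB_def Ln_of_real exp_cnj complex_eq_iff)

lemma parity_mult: "parity s P \<Longrightarrow> parity t Q \<Longrightarrow> parity (s * t) (mtimes P Q)"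
  by (simp add: parity_def mult_ac)

lemma parity_add: "parity s P \<Longrightarrow> parity s Q \<Longrightarrow> parity s (mplus P Q)"
  by (simp add: parity_def distrib_left)

lemma parity_power: "parity s P \<Longrightarrow> parity (s ^ j) (\<lambda>\<alpha> \<beta> r. P \<alpha> \<beta> r ^ j)"
  by (simp add: parity_def power_mult_distrib)

lemma stabI_parity:
  assumes "parity s P" "0 < \<alpha>" "\<alpha> < 2"
  shows "cnj (stabI P m \<alpha> \<beta>) = of_real s * stabI P (- m) \<alpha> (- \<beta>)"
proof -
  have "cnj (stabI P m \<alpha> \<beta>) = (LINT x|halfline. cnj (P \<alpha> \<beta> (of_real x) * kern m \<alpha> \<beta> (of_real x)))"
    unfolding stabI_def by (rule Bochner_Integration.integral_cnj[symmetric])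
  also have "\<dots> = (LINT x|halfline. of_real s * (P \<alpha> (- \<beta>) (of_real x) * kern (- m) \<alpha> (- \<beta>) (of_real x)))"
  proof (rule Bochner_Integration.integral_cong)
    fix x assume "x \<in> space halfline"
    then have x: "0 < x" by (simp add: space_halfline)
    have "cnj (kern m \<alpha> \<beta> (of_real x)) = kern (- m) \<alpha> (- \<beta>) (of_real x)"
      using parity_D[of 0] assms x by (simp add: kern_def exp_cnj parity_def)
    then show "cnj (P \<alpha> \<beta> (of_real x) * kern m \<alpha> \<beta> (of_real x)) =
        of_real s * (P \<alpha> (- \<beta>) (of_real x) * kern (- m) \<alpha> (- \<beta>) (of_real x))"
      using assms x by (simp add: parity_def)
  qed simp
  finally show ?thesis by (simp add: stabI_def)
qed

text \<open>The one-sided bound is required for every \<open>\<beta>\<close>, because the tail at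
  plus infinity for \<beta> is the tail at minus infinity for -\<beta>.\<close>

lemma decaysI_neg:
  assumes par: "\<And>m \<beta>. \<bar>f \<beta> m\<bar> = \<bar>f (- \<beta>) (- m)\<bar>"
    and tail: "\<And>\<beta>. \<exists>K. \<forall>y. exp 1 \<le> y \<longrightarrow> \<bar>f \<beta> (- y)\<bar> \<le> K * (y powr (- q) * ln y ^ k)"
  shows "decays (f \<beta>) q k"
proof -
  obtain K1 where K1: "\<And>y. exp 1 \<le> y \<Longrightarrow> \<bar>f \<beta> (- y)\<bar> \<le> K1 * (y powr (- q) * ln y ^ k)"
    using tail by metis
  obtain K2 where K2: "\<And>y. exp 1 \<le> y \<Longrightarrow> \<bar>f (- \<beta>) (- y)\<bar> \<le> K2 * (y powr (- q) * ln y ^ k)"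
    using tail by metis
  show ?thesis
    unfolding decays_def
  proof (intro exI[of _ "max K1 K2"] allI impI)
    fix m :: real assume m: "exp 1 \<le> \<bar>m\<bar>"
    then have "1 \<le> \<bar>m\<bar>" using one_le_exp_iff[of 1] by linarith
    then have nn: "0 \<le> \<bar>m\<bar> powr (- q) * ln \<bar>m\<bar> ^ k" by simp
    have "\<bar>f \<beta> m\<bar> \<le> K1 * (\<bar>m\<bar> powr (- q) * ln \<bar>m\<bar> ^ k) \<or> \<bar>f \<beta> m\<bar> \<le> K2 * (\<bar>m\<bar> powr (- q) * ln \<bar>m\<bar> ^ k)"
      using K1[of "- m"] K2[of m] m par[of \<beta> m] by (cases "m \<ge> 0") auto
    then show "\<bar>f \<beta> m\<bar> \<le> max K1 K2 * (\<bar>m\<bar> powr (- q) * ln \<bar>m\<bar> ^ k)"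
      using mult_right_mono[OF max.cobounded1 nn, of K1 K2] mult_right_mono[OF max.cobounded2 nn, of K2 K1] by linarith
  qed
qed

lemma Re_stabI_parity:
  assumes "parity s P" "0 < \<alpha>" "\<alpha> < 2"
  shows "Re (stabI P m \<alpha> \<beta>) = s * Re (stabI P (- m) \<alpha> (- \<beta>))"
  using arg_cong[OF stabI_parity[OF assms, of m \<beta>], of Re] by simp

section \<open>Imaginary parts of the multipliers on the negative imaginary axis\<close>

lemma imO_one: "imO 0 mone"
  unfolding imO_def by (auto intro!: exI[of _ 0])

lemma norm_rotated_log_le: "0 < u \<Longrightarrow> norm (of_real (ln u) + \<i> * of_real (pi / 2)) \<le> 4 + \<bar>ln u\<bar>"
  using norm_triangle_ineq[of "of_real (ln u)" "\<i> * of_real (pi / 2)"] pi_less_4 by (simp add: norm_mult)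

lemma imO_B: "imO j (mB j)"
  unfolding imO_def
proof (intro allI impI exI[of _ 1] conjI)
  fix \<alpha> \<beta> u :: real assume \<alpha>: "0 < \<alpha>" "\<alpha> < 2" and u: "0 < u"
  let ?c = "complex_of_real (ln u) + \<i> * of_real (pi / 2)"
  have "\<bar>Im (?c ^ j * exp (of_real \<alpha> * ?c))\<bar> \<le> norm ?c ^ j * u powr \<alpha>"
    using abs_Im_le_cmod[of "?c ^ j * exp (of_real \<alpha> * ?c)"] u
    by (simp add: norm_mult norm_power powr_def)
  also have "\<dots> \<le> (4 + \<bar>ln u\<bar>) ^ j * u powr \<alpha>"
    using norm_rotated_log_le[OF u] by (intro mult_right_mono power_mono) auto
  finally show "\<bar>Im (mB j \<alpha> \<beta> (- \<i> * of_real u))\<bar> \<le> 1 * (u powr \<alpha> * (4 + \<bar>ln u\<bar>) ^ j)"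
    unfolding mB_def Im_stabKd_neg_imag[OF \<alpha> u] by (simp add: mult.commute)
qed simp

text \<open>The first summand is of the required order already in modulus; the cancellation on the
  rotated ray is used for the skewness part.\<close>

lemma imO_D: "imO j (mD j)"
  unfolding imO_def
proof (intro allI impI)
  fix \<alpha> \<beta> :: real assume \<alpha>: "0 < \<alpha>" "\<alpha> < 2"
  obtain C where C: "C \<ge> 0" "\<And>u. 0 < u \<Longrightarrow> u \<le> 1 \<Longrightarrow> \<bar>Im (mB j \<alpha> \<beta> (- \<i> * of_real u))\<bar> \<le> C * (u powr \<alpha> * (4 + \<bar>ln u\<bar>) ^ j)"
    using imO_B[of j] \<alpha> unfolding imO_def by metis
  show "\<exists>C\<ge>0. \<forall>u. 0 < u \<longrightarrow> u \<le> 1 \<longrightarrow> \<bar>Im (mD j \<alpha> \<beta> (- \<i> * of_real u))\<bar> \<le> C * (u powr \<alpha> * (4 + \<bar>ln u\<bar>) ^ j)"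
  proof (intro exI[of _ "1 + \<bar>\<beta>\<bar> * C"] conjI allI impI)
    fix u :: real assume u: "0 < u" "u \<le> 1"
    let ?r = "- \<i> * complex_of_real u"
    have r: "?r \<noteq> 0" and nr: "norm ?r = u" using u by (auto simp: norm_mult)
    have "norm (Ln ?r ^ j * exp (of_real \<alpha> * Ln ?r)) = norm (Ln ?r) ^ j * u powr \<alpha>"
      using r nr u by (simp add: norm_mult norm_power powr_def del: mult_minus_left)
    also have "\<dots> \<le> (4 + \<bar>ln u\<bar>) ^ j * u powr \<alpha>"
      using norm_Ln_le[OF r] unfolding nr by (intro mult_right_mono power_mono) auto
    finally have "\<bar>Im (Ln ?r ^ j * exp (of_real \<alpha> * Ln ?r))\<bar> \<le> u powr \<alpha> * (4 + \<bar>ln u\<bar>) ^ j"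
      using abs_Im_le_cmod[of "Ln ?r ^ j * exp (of_real \<alpha> * Ln ?r)"] by (simp only: mult.commute)
    moreover have "\<bar>\<beta> * Im (mB j \<alpha> \<beta> ?r)\<bar> \<le> \<bar>\<beta>\<bar> * (C * (u powr \<alpha> * (4 + \<bar>ln u\<bar>) ^ j))"
      unfolding abs_mult using C(2)[OF u] by (intro mult_left_mono) auto
    moreover have "Im (mD j \<alpha> \<beta> ?r) = - Im (Ln ?r ^ j * exp (of_real \<alpha> * Ln ?r)) + \<beta> * Im (mB j \<alpha> \<beta> ?r)"
      unfolding mD_def by simp
    ultimately show "\<bar>Im (mD j \<alpha> \<beta> ?r)\<bar> \<le> (1 + \<bar>\<beta>\<bar> * C) * (u powr \<alpha> * (4 + \<bar>ln u\<bar>) ^ j)"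
      unfolding distrib_right by linarith
  qed (use C in auto)
qed

lemma imO_mono:
  assumes "imO k P" "k \<le> l"
  shows "imO l P"
  unfolding imO_def
proof (intro allI impI)
  fix \<alpha> \<beta> :: real assume \<alpha>: "0 < \<alpha>" "\<alpha> < 2"
  obtain C where C: "C \<ge> 0" "\<And>u. 0 < u \<Longrightarrow> u \<le> 1 \<Longrightarrow> \<bar>Im (P \<alpha> \<beta> (- \<i> * of_real u))\<bar> \<le> C * (u powr \<alpha> * (4 + \<bar>ln u\<bar>) ^ k)"
    using assms(1) \<alpha> unfolding imO_def by metis
  show "\<exists>C\<ge>0. \<forall>u. 0 < u \<longrightarrow> u \<le> 1 \<longrightarrow> \<bar>Im (P \<alpha> \<beta> (- \<i> * of_real u))\<bar> \<le> C * (u powr \<alpha> * (4 + \<bar>ln u\<bar>) ^ l)"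
  proof (intro exI[of _ C] conjI allI impI)
    fix u :: real assume u: "0 < u" "u \<le> 1"
    have "C * (u powr \<alpha> * (4 + \<bar>ln u\<bar>) ^ k) \<le> C * (u powr \<alpha> * (4 + \<bar>ln u\<bar>) ^ l)"
      using C(1) assms(2) by (intro mult_left_mono power_increasing) auto
    then show "\<bar>Im (P \<alpha> \<beta> (- \<i> * of_real u))\<bar> \<le> C * (u powr \<alpha> * (4 + \<bar>ln u\<bar>) ^ l)"
      using C(2)[OF u] by linarith
  qed (use C in auto)
qed

lemma imO_add:
  assumes "imO k P" "imO k Q"
  shows "imO k (mplus P Q)"
  unfolding imO_def
proof (intro allI impI)
  fix \<alpha> \<beta> :: real assume \<alpha>: "0 < \<alpha>" "\<alpha> < 2"
  obtain C where C: "C \<ge> 0" "\<And>u. 0 < u \<Longrightarrow> u \<le> 1 \<Longrightarrow> \<bar>Im (P \<alpha> \<beta> (- \<i> * of_real u))\<bar> \<le> C * (u powr \<alpha> * (4 + \<bar>ln u\<bar>) ^ k)"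
    using assms(1) \<alpha> unfolding imO_def by metis
  obtain D where D: "D \<ge> 0" "\<And>u. 0 < u \<Longrightarrow> u \<le> 1 \<Longrightarrow> \<bar>Im (Q \<alpha> \<beta> (- \<i> * of_real u))\<bar> \<le> D * (u powr \<alpha> * (4 + \<bar>ln u\<bar>) ^ k)"
    using assms(2) \<alpha> unfolding imO_def by metis
  show "\<exists>C\<ge>0. \<forall>u. 0 < u \<longrightarrow> u \<le> 1 \<longrightarrow> \<bar>Im (P \<alpha> \<beta> (- \<i> * of_real u) + Q \<alpha> \<beta> (- \<i> * of_real u))\<bar> \<le> C * (u powr \<alpha> * (4 + \<bar>ln u\<bar>) ^ k)"
  proof (intro exI[of _ "C + D"] conjI allI impI)
    fix u :: real assume u: "0 < u" "u \<le> 1"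
    show "\<bar>Im (P \<alpha> \<beta> (- \<i> * of_real u) + Q \<alpha> \<beta> (- \<i> * of_real u))\<bar> \<le> (C + D) * (u powr \<alpha> * (4 + \<bar>ln u\<bar>) ^ k)"
      using C(2)[OF u] D(2)[OF u] unfolding distrib_right plus_complex.sel by linarith
  qed (use C D in auto)
qed

text \<open>Each term of \<open>Im (P * Q)\<close> contains one imaginary part, while the real part
  beside it is bounded on the segment by admissibility. Hence the logarithmic orders do not add
  up.\<close>

lemma imO_mult:
  assumes "imO k P" "imO k Q" "admissible P" "admissible Q"
  shows "imO k (mtimes P Q)"
  unfolding imO_def
proof (intro allI impI)
  fix \<alpha> \<beta> :: real assume \<alpha>: "0 < \<alpha>" "\<alpha> < 2"
  obtain C where C: "C \<ge> 0" "\<And>u. 0 < u \<Longrightarrow> u \<le> 1 \<Longrightarrow> \<bar>Im (P \<alpha> \<beta> (- \<i> * of_real u))\<bar> \<le> C * (u powr \<alpha> * (4 + \<bar>ln u\<bar>) ^ k)"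
    using assms(1) \<alpha> unfolding imO_def by metis
  obtain D where D: "D \<ge> 0" "\<And>u. 0 < u \<Longrightarrow> u \<le> 1 \<Longrightarrow> \<bar>Im (Q \<alpha> \<beta> (- \<i> * of_real u))\<bar> \<le> D * (u powr \<alpha> * (4 + \<bar>ln u\<bar>) ^ k)"
    using assms(2) \<alpha> unfolding imO_def by metis
  obtain M where M: "M \<ge> 0" "\<And>u. 0 < u \<Longrightarrow> u \<le> 1 \<Longrightarrow> norm (P \<alpha> \<beta> (- \<i> * of_real u)) \<le> M"
    using admissible_bound_neg_imag[OF assms(3) \<alpha>] by metis
  obtain N where N: "N \<ge> 0" "\<And>u. 0 < u \<Longrightarrow> u \<le> 1 \<Longrightarrow> norm (Q \<alpha> \<beta> (- \<i> * of_real u)) \<le> N"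
    using admissible_bound_neg_imag[OF assms(4) \<alpha>] by metis
  show "\<exists>C\<ge>0. \<forall>u. 0 < u \<longrightarrow> u \<le> 1 \<longrightarrow> \<bar>Im (P \<alpha> \<beta> (- \<i> * of_real u) * Q \<alpha> \<beta> (- \<i> * of_real u))\<bar> \<le> C * (u powr \<alpha> * (4 + \<bar>ln u\<bar>) ^ k)"
  proof (intro exI[of _ "M * D + C * N"] conjI allI impI)
    fix u :: real assume u: "0 < u" "u \<le> 1"
    let ?P = "P \<alpha> \<beta> (- \<i> * of_real u)" and ?Q = "Q \<alpha> \<beta> (- \<i> * of_real u)"
    define w where "w = u powr \<alpha> * (4 + \<bar>ln u\<bar>) ^ k"
    have "\<bar>Re ?P\<bar> \<le> M" "\<bar>Re ?Q\<bar> \<le> N"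
      using M(2)[OF u] N(2)[OF u] abs_Re_le_cmod order_trans by blast+
    moreover have "\<bar>Im ?P\<bar> \<le> C * w" "\<bar>Im ?Q\<bar> \<le> D * w"
      using C(2)[OF u] D(2)[OF u] by (simp_all only: w_def)
    moreover have "0 \<le> w" by (simp add: w_def)
    ultimately have "\<bar>Re ?P\<bar> * \<bar>Im ?Q\<bar> \<le> M * (D * w)" "\<bar>Im ?P\<bar> * \<bar>Re ?Q\<bar> \<le> (C * w) * N"
      using M(1) C(1) by (auto intro!: mult_mono)
    then have "\<bar>Re ?P * Im ?Q\<bar> \<le> M * (D * w)" "\<bar>Im ?P * Re ?Q\<bar> \<le> (C * w) * N"
      by (simp_all only: abs_mult)
    then have "\<bar>Re ?P * Im ?Q + Im ?P * Re ?Q\<bar> \<le> M * (D * w) + (C * w) * N"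
      by linarith
    moreover have "M * (D * w) + (C * w) * N = (M * D + C * N) * w" by (simp add: algebra_simps)
    ultimately show "\<bar>Im (?P * ?Q)\<bar> \<le> (M * D + C * N) * (u powr \<alpha> * (4 + \<bar>ln u\<bar>) ^ k)"
      unfolding times_complex.sel w_def[symmetric] by simp
  qed (use C D M N in auto)
qed

text \<open>With d the exponent, Im (Q exp d) = exp (Re d) (Re Q sin (Im d) + Im Q cos (Im d)). Both
  terms are small, since \<open>\<bar>sin x\<bar> \<le> \<bar>x\<bar>\<close> and the exponent
  itself has a small imaginary part. At r = -i u the factor \<open>mA\<close> is the real number
  \<open>u\<close>, so each power of it gains one order.\<close>

lemma rotH_imO:
  assumes "imO k Q" "admissible Q" and \<alpha>: "0 < \<alpha>" "\<alpha> < 2"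
  obtains C where "C \<ge> 0" "\<And>u. 0 < u \<Longrightarrow> u \<le> 1 \<Longrightarrow>
    \<bar>rotH (\<lambda>\<alpha> \<beta> r. mA \<alpha> \<beta> r ^ j * Q \<alpha> \<beta> r) \<alpha> \<beta> u\<bar> \<le> C * (u ^ j * u powr \<alpha> * (4 + \<bar>ln u\<bar>) ^ k)"
proof -
  obtain C where C: "C \<ge> 0" "\<And>u. 0 < u \<Longrightarrow> u \<le> 1 \<Longrightarrow> \<bar>Im (Q \<alpha> \<beta> (- \<i> * of_real u))\<bar> \<le> C * (u powr \<alpha> * (4 + \<bar>ln u\<bar>) ^ k)"
    using assms(1) \<alpha> unfolding imO_def by metis
  obtain D where D: "D \<ge> 0" "\<And>u. 0 < u \<Longrightarrow> u \<le> 1 \<Longrightarrow> \<bar>Im (mD 0 \<alpha> \<beta> (- \<i> * of_real u))\<bar> \<le> D * (u powr \<alpha> * (4 + \<bar>ln u\<bar>) ^ k)"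
    using imO_mono[OF imO_D[of 0] le0, of k] \<alpha> unfolding imO_def by metis
  obtain M where M: "M \<ge> 0" "\<And>u. 0 < u \<Longrightarrow> u \<le> 1 \<Longrightarrow> norm (mD 0 \<alpha> \<beta> (- \<i> * of_real u)) \<le> M"
    using admissible_bound_neg_imag[OF admissible_D \<alpha>] by metis
  obtain N where N: "N \<ge> 0" "\<And>u. 0 < u \<Longrightarrow> u \<le> 1 \<Longrightarrow> norm (Q \<alpha> \<beta> (- \<i> * of_real u)) \<le> N"
    using admissible_bound_neg_imag[OF assms(2) \<alpha>] by metis
  show ?thesis
  proof
    show "0 \<le> (N * D + C) * exp M" using C D M N by simp
    fix u :: real assume u: "0 < u" "u \<le> 1"
    let ?Q = "Q \<alpha> \<beta> (- \<i> * of_real u)" and ?d = "mD 0 \<alpha> \<beta> (- \<i> * of_real u)" and ?w = "u powr \<alpha> * (4 + \<bar>ln u\<bar>) ^ k"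
    have "\<bar>Re ?Q\<bar> \<le> N" using N(2)[OF u] abs_Re_le_cmod order_trans by blast
    have "Re ?d \<le> M" using M(2)[OF u] complex_Re_le_cmod order_trans by blast
    have "\<bar>sin (Im ?d)\<bar> \<le> D * ?w" using D(2)[OF u] abs_sin_x_le_abs_x order_trans by blast
    then have "\<bar>Re ?Q * sin (Im ?d)\<bar> \<le> N * (D * ?w)"
      unfolding abs_mult using \<open>\<bar>Re ?Q\<bar> \<le> N\<close> N(1) by (intro mult_mono) auto
    moreover have "\<bar>Im ?Q * cos (Im ?d)\<bar> \<le> (C * ?w) * 1"
      unfolding abs_mult using C(1) C(2)[OF u] by (intro mult_mono) auto
    ultimately have "\<bar>Re ?Q * sin (Im ?d) + Im ?Q * cos (Im ?d)\<bar> \<le> (N * D + C) * ?w"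
      unfolding distrib_right by linarith
    then have "exp (Re ?d) * \<bar>Re ?Q * sin (Im ?d) + Im ?Q * cos (Im ?d)\<bar> \<le> exp M * ((N * D + C) * ?w)"
      using \<open>Re ?d \<le> M\<close> by (intro mult_mono) auto
    moreover have "Im (?Q * exp ?d) = exp (Re ?d) * (Re ?Q * sin (Im ?d) + Im ?Q * cos (Im ?d))"
      by (simp add: Re_exp Im_exp algebra_simps)
    ultimately have "\<bar>Im (?Q * exp ?d)\<bar> \<le> (N * D + C) * exp M * ?w"
      by (simp add: abs_mult mult_ac)
    moreover have "rotH (\<lambda>\<alpha> \<beta> r. mA \<alpha> \<beta> r ^ j * Q \<alpha> \<beta> r) \<alpha> \<beta> u = u ^ j * Im (?Q * exp ?d)"
    proof -
      have "mA \<alpha> \<beta> (- \<i> * of_real u) = of_real u" by (simp add: mA_def)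
      then show ?thesis unfolding rotH_def mult.assoc by (simp only: of_real_power[symmetric] Im_of_real_mult)
    qed
    ultimately show "\<bar>rotH (\<lambda>\<alpha> \<beta> r. mA \<alpha> \<beta> r ^ j * Q \<alpha> \<beta> r) \<alpha> \<beta> u\<bar> \<le> (N * D + C) * exp M * (u ^ j * u powr \<alpha> * (4 + \<bar>ln u\<bar>) ^ k)"
      using u by (simp add: abs_mult mult_left_mono mult_ac)
  qed
qed

lemma Re_stabI_tail_of_rotH:
  assumes P: "admissible P" and \<alpha>: "0 < \<alpha>" "\<alpha> < 2" and a: "0 < a" "a \<le> 2"
    and H: "\<And>u. 0 < u \<Longrightarrow> u \<le> 1 \<Longrightarrow> \<bar>rotH P \<alpha> \<beta> u\<bar> \<le> C * (u ^ j * u powr a * (4 + \<bar>ln u\<bar>) ^ k)" and C: "C \<ge> 0"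
  shows "\<exists>K. \<forall>y. exp 1 \<le> y \<longrightarrow> \<bar>Re (stabI P (- y) \<alpha> \<beta>)\<bar> \<le> K * (y powr (- (1 + real j + a)) * ln y ^ k)"
proof -
  obtain K1 where K1: "K1 \<ge> 0" "\<And>y. exp 1 \<le> y \<Longrightarrow> \<bar>segI (rotH P \<alpha> \<beta>) y\<bar> \<le> K1 * (y powr (- (1 + real j + a)) * ln y ^ k)"
    using segI_tail[OF a H C] by metis
  obtain K2 where K2: "K2 \<ge> 0" "\<And>y. \<bar>Re (stabI P (- y) \<alpha> \<beta>) - segI (rotH P \<alpha> \<beta>) y\<bar> \<le> K2 * exp (- y)"
    using Re_stabI_rotate[OF P \<alpha>] by metis
  obtain K3 where K3: "K3 \<ge> 0" "\<And>y. exp 1 \<le> y \<Longrightarrow> exp (- y) \<le> K3 * (y powr (- (1 + real j + a)) * ln y ^ k)"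
    using exp_minus_le_powr[of "1 + real j + a" k] by metis
  show ?thesis
  proof (intro exI[of _ "K1 + K2 * K3"] allI impI)
    fix y :: real assume y: "exp 1 \<le> y"
    have "K2 * exp (- y) \<le> K2 * (K3 * (y powr (- (1 + real j + a)) * ln y ^ k))"
      using K3(2)[OF y] K2(1) by (rule mult_left_mono)
    then show "\<bar>Re (stabI P (- y) \<alpha> \<beta>)\<bar> \<le> (K1 + K2 * K3) * (y powr (- (1 + real j + a)) * ln y ^ k)"
      using K1(2)[OF y] K2(2)[of y] unfolding distrib_right mult.assoc by linarith
  qed
qed

text \<open>Source of all the general tail exponents: \<open>j\<close> counts the factors
  \<open>mA\<close>, that is, the m-derivatives, and \<open>k\<close> the logarithms.\<close>

lemma decays_stabI:
  assumes "imO k Q" "admissible Q" "parity s Q" "\<bar>s\<bar> = 1" and \<alpha>: "0 < \<alpha>" "\<alpha> < 2"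
    and eq: "P = (\<lambda>\<alpha> \<beta> r. mA \<alpha> \<beta> r ^ j * Q \<alpha> \<beta> r)"
  shows "decays (\<lambda>m. Re (stabI P m \<alpha> \<beta>)) (1 + real j + \<alpha>) k"
proof (rule decaysI_neg[where f = "\<lambda>\<beta> m. Re (stabI P m \<alpha> \<beta>)"])
  have Aj: "admissible (\<lambda>\<alpha> \<beta> r. mA \<alpha> \<beta> r ^ j)"
    by (induction j) (auto intro: admissible_const admissible_mult admissible_A)
  have adm: "admissible P"
    unfolding eq by (intro admissible_mult Aj assms)
  have par: "parity ((-1) ^ j * s) P"
    unfolding eq by (intro parity_mult parity_power parity_A assms)
  show "\<bar>Re (stabI P m \<alpha> \<beta>)\<bar> = \<bar>Re (stabI P (- m) \<alpha> (- \<beta>))\<bar>" for m \<beta>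
    using Re_stabI_parity[OF par \<alpha>, of m \<beta>] assms(4) by (simp add: abs_mult)
  fix \<beta>
  show "\<exists>K. \<forall>y. exp 1 \<le> y \<longrightarrow> \<bar>Re (stabI P (- y) \<alpha> \<beta>)\<bar> \<le> K * (y powr (- (1 + real j + \<alpha>)) * ln y ^ k)"
  proof (rule rotH_imO[OF assms(1,2) \<alpha>, where j = j and \<beta> = \<beta>])
    fix C assume "0 \<le> C" and "\<And>u. 0 < u \<Longrightarrow> u \<le> 1 \<Longrightarrow>
      \<bar>rotH (\<lambda>\<alpha> \<beta> r. mA \<alpha> \<beta> r ^ j * Q \<alpha> \<beta> r) \<alpha> \<beta> u\<bar> \<le> C * (u ^ j * u powr \<alpha> * (4 + \<bar>ln u\<bar>) ^ k)"
    then show ?thesis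
      using \<alpha> unfolding eq by (intro Re_stabI_tail_of_rotH[OF adm[unfolded eq] \<alpha>, where C = C]) auto
  qed
qed

section \<open>The stable density\<close>

text \<open>Normal form in which every derivative of the density is a linear combination. The powers
  of (\<mu> - x) / \<sigma> and of 1 / \<sigma> are those that the derivatives in \<mu> and \<sigma>
  create.\<close>

definition stabW :: "nat \<Rightarrow> nat \<Rightarrow> mult \<Rightarrow> real \<Rightarrow> real ^ 4 \<Rightarrow> real" where
  "stabW n k P x \<theta> = ((\<theta> $ 1 - x) / \<theta> $ 2) ^ k / (\<theta> $ 2) ^ n *
     (Re (stabI P ((\<theta> $ 1 - x) / \<theta> $ 2) (\<theta> $ 3) (\<theta> $ 4)) / pi)"

abbreviation (input) Theta :: "(real ^ 4) set" where "Theta \<equiv> interior Theta_M"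

lemma Theta_D: "\<theta> \<in> Theta \<Longrightarrow> 0 < \<theta> $ 2" "\<theta> \<in> Theta \<Longrightarrow> 0 < \<theta> $ 3" "\<theta> \<in> Theta \<Longrightarrow> \<theta> $ 3 < 2"
  by (auto simp: interior_Theta_M)

lemma has_derivative_Re_stabI:
  assumes "admissible P" "admissible Pa" "admissible Pb" "mult_deriv P Pa Pb" "0 < \<alpha>0" "\<alpha>0 < 2"
  shows "((\<lambda>p. Re (stabI P (fst p) (fst (snd p)) (snd (snd p)))) has_derivative
    (\<lambda>h. fst h * Re (stabI (mtimes mA P) m0 \<alpha>0 \<beta>0) +
      fst (snd h) * Re (stabI (mplus Pa (mtimes (mD 1) P)) m0 \<alpha>0 \<beta>0) +
      snd (snd h) * Re (stabI (mplus Pb (mtimes (mB 0) P)) m0 \<alpha>0 \<beta>0))) (at (m0, \<alpha>0, \<beta>0))"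
  using has_derivative_Re[OF has_derivative_stabI[OF assms, of m0 \<beta>0]] by simp

text \<open>Chain rule: m = (\<mu> - x) / \<sigma> has differential (d\<mu> - m d\<sigma>) /
  \<sigma>. The new multipliers enter through equations, so that an instance may present them in
  simplified form.\<close>

lemma has_derivative_stabW:
  assumes P: "admissible P" "admissible Pa" "admissible Pb" "mult_deriv P Pa Pb" and \<theta>: "\<theta> \<in> Theta"
    and eqs: "Qm = mtimes mA P" "Qa = mplus Pa (mtimes (mD 1) P)" "Qb = mplus Pb (mtimes (mB 0) P)"
  shows "(stabW n k P x has_derivative
    (\<lambda>h. h $ 1 * (real k * stabW (n + 1) (k - 1) P x \<theta> + stabW (n + 1) k Qm x \<theta>) +
      h $ 2 * (- real (n + k) * stabW (n + 1) k P x \<theta> - stabW (n + 1) (k + 1) Qm x \<theta>) +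
      h $ 3 * stabW n k Qa x \<theta> + h $ 4 * stabW n k Qb x \<theta>)) (at \<theta>)"
proof -
  define \<sigma> m where "\<sigma> = \<theta> $ 2" and "m = (\<theta> $ 1 - x) / \<theta> $ 2"
  have \<sigma>: "\<sigma> > 0" using Theta_D[OF \<theta>] by (simp add: \<sigma>_def)
  let ?dm = "\<lambda>h :: real ^ 4. (h $ 1 - m * h $ 2) / \<sigma>"
  have dm: "((\<lambda>\<theta>. (\<theta> $ 1 - x) / \<theta> $ 2) has_derivative ?dm) (at \<theta>)"
    using \<sigma> unfolding \<sigma>_def m_def
    by (auto intro!: derivative_eq_intros bounded_linear_imp_has_derivative bounded_linear_vec_nth
        simp: fun_eq_iff field_simps)
  have "((\<lambda>\<theta>. ((\<theta> $ 1 - x) / \<theta> $ 2, \<theta> $ 3, \<theta> $ 4)) has_derivative (\<lambda>h. (?dm h, h $ 3, h $ 4))) (at \<theta>)"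
    by (intro has_derivative_Pair dm bounded_linear_imp_has_derivative bounded_linear_vec_nth)
  from has_derivative_compose[OF this has_derivative_Re_stabI[OF P]]
  have dI: "((\<lambda>\<theta>. Re (stabI P ((\<theta> $ 1 - x) / \<theta> $ 2) (\<theta> $ 3) (\<theta> $ 4))) has_derivative
      (\<lambda>h. ?dm h * Re (stabI Qm m (\<theta> $ 3) (\<theta> $ 4)) + h $ 3 * Re (stabI Qa m (\<theta> $ 3) (\<theta> $ 4)) +
        h $ 4 * Re (stabI Qb m (\<theta> $ 3) (\<theta> $ 4)))) (at \<theta>)"
    using Theta_D[OF \<theta>] by (simp add: m_def eqs)
  have dk: "((\<lambda>\<theta>. ((\<theta> $ 1 - x) / \<theta> $ 2) ^ k) has_derivative (\<lambda>h. real k * m ^ (k - 1) * ?dm h)) (at \<theta>)"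
    using has_derivative_power[OF dm, of k] by (simp add: m_def mult_ac)
  have dn: "((\<lambda>\<theta> :: real ^ 4. inverse ((\<theta> $ 2) ^ n)) has_derivative (\<lambda>h. - (real n * h $ 2 / \<sigma> ^ (n + 1)))) (at \<theta>)"
  proof -
    have "((\<lambda>s. inverse (s ^ n)) has_field_derivative - (real n / \<sigma> ^ (n + 1))) (at \<sigma>)"
    proof (cases n)
      case (Suc j)
      have "((\<lambda>s. s ^ n) has_field_derivative real n * \<sigma> ^ (n - 1)) (at \<sigma>)"
        by (auto intro!: derivative_eq_intros)
      then show ?thesis
        by (rule DERIV_cong[OF DERIV_inverse_fun]) (use \<sigma> Suc in \<open>simp_all add: field_simps\<close>)
    qed simp
    then have "((\<lambda>s. inverse (s ^ n)) has_derivative (*) (- (real n / \<sigma> ^ (n + 1)))) (at (\<theta> $ 2))"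
      by (simp add: has_field_derivative_def \<sigma>_def)
    from has_derivative_compose[OF bounded_linear_imp_has_derivative[OF bounded_linear_vec_nth] this]
    show ?thesis by (simp add: mult.commute)
  qed
  have "((\<lambda>\<theta>. ((\<theta> $ 1 - x) / \<theta> $ 2) ^ k * inverse ((\<theta> $ 2) ^ n) *
     (Re (stabI P ((\<theta> $ 1 - x) / \<theta> $ 2) (\<theta> $ 3) (\<theta> $ 4)) * inverse pi)) has_derivative
    (\<lambda>h. (m ^ k * inverse (\<sigma> ^ n)) * ((?dm h * Re (stabI Qm m (\<theta> $ 3) (\<theta> $ 4)) + h $ 3 * Re (stabI Qa m (\<theta> $ 3) (\<theta> $ 4)) +
        h $ 4 * Re (stabI Qb m (\<theta> $ 3) (\<theta> $ 4))) * inverse pi) +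
       (m ^ k * (- (real n * h $ 2 / \<sigma> ^ (n + 1))) + (real k * m ^ (k - 1) * ?dm h) * inverse (\<sigma> ^ n)) *
        (Re (stabI P m (\<theta> $ 3) (\<theta> $ 4)) * inverse pi))) (at \<theta>)"
    unfolding m_def \<sigma>_def
    by (rule has_derivative_mult[OF has_derivative_mult[OF dk[unfolded m_def \<sigma>_def] dn[unfolded \<sigma>_def]]
          has_derivative_mult_left[OF dI[unfolded m_def \<sigma>_def]]])
  moreover have "stabW n k P x = (\<lambda>\<theta>. ((\<theta> $ 1 - x) / \<theta> $ 2) ^ k * inverse ((\<theta> $ 2) ^ n) *
     (Re (stabI P ((\<theta> $ 1 - x) / \<theta> $ 2) (\<theta> $ 3) (\<theta> $ 4)) * inverse pi))"
    by (simp only: fun_eq_iff stabW_def divide_inverse) simp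
  ultimately have "(stabW n k P x has_derivative
    (\<lambda>h. (m ^ k * inverse (\<sigma> ^ n)) * ((?dm h * Re (stabI Qm m (\<theta> $ 3) (\<theta> $ 4)) + h $ 3 * Re (stabI Qa m (\<theta> $ 3) (\<theta> $ 4)) +
        h $ 4 * Re (stabI Qb m (\<theta> $ 3) (\<theta> $ 4))) * inverse pi) +
       (m ^ k * (- (real n * h $ 2 / \<sigma> ^ (n + 1))) + (real k * m ^ (k - 1) * ?dm h) * inverse (\<sigma> ^ n)) *
        (Re (stabI P m (\<theta> $ 3) (\<theta> $ 4)) * inverse pi))) (at \<theta>)"
    by (simp only:)
  then show ?thesis
  proof (rule has_derivative_eq_rhs, intro ext)
    fix h :: "real ^ 4"
    define s where "s = inverse \<sigma>"
    have W: "stabW n k P x \<theta> = m ^ k * s ^ n * (Re (stabI P m (\<theta> $ 3) (\<theta> $ 4)) * inverse pi)" for n k P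
      unfolding stabW_def m_def[symmetric] unfolding s_def \<sigma>_def[symmetric] by (simp add: divide_inverse power_inverse)
    \<comment> \<open>For \<open>k = 0\<close> the truncated exponent \<open>k - 1\<close> is
      harmless, as the factor \<open>real k\<close> vanishes.\<close>
    have k: "real k * m ^ (k - 1) * ((a - m * b) * s) = real k * m ^ (k - 1) * (a * s) - real k * m ^ k * (b * s)" for a b
      by (cases k) (simp_all add: algebra_simps)
    show "(m ^ k * inverse (\<sigma> ^ n)) * ((?dm h * Re (stabI Qm m (\<theta> $ 3) (\<theta> $ 4)) + h $ 3 * Re (stabI Qa m (\<theta> $ 3) (\<theta> $ 4)) +
        h $ 4 * Re (stabI Qb m (\<theta> $ 3) (\<theta> $ 4))) * inverse pi) +
       (m ^ k * (- (real n * h $ 2 / \<sigma> ^ (n + 1))) + (real k * m ^ (k - 1) * ?dm h) * inverse (\<sigma> ^ n)) *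
        (Re (stabI P m (\<theta> $ 3) (\<theta> $ 4)) * inverse pi) =
      h $ 1 * (real k * stabW (n + 1) (k - 1) P x \<theta> + stabW (n + 1) k Qm x \<theta>) +
      h $ 2 * (- real (n + k) * stabW (n + 1) k P x \<theta> - stabW (n + 1) (k + 1) Qm x \<theta>) +
      h $ 3 * stabW n k Qa x \<theta> + h $ 4 * stabW n k Qb x \<theta>"
      unfolding W divide_inverse power_inverse[symmetric] s_def[symmetric] k
      by (simp add: algebra_simps)
  qed
qed

lemma continuous_on_stabW:
  assumes "admissible P"
  shows "continuous_on (UNIV \<times> Theta) (\<lambda>p. stabW n k P (fst p) (snd p))"
proof -
  have 1: "continuous_on (UNIV \<times> {0<..<2} \<times> UNIV) (\<lambda>p. stabI P (fst p) (fst (snd p)) (snd (snd p)))"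
    using isCont_stabI[OF assms] by (intro continuous_at_imp_continuous_on) auto
  have 2: "continuous_on (UNIV \<times> Theta) (\<lambda>p :: real \<times> (real ^ 4). ((snd p $ 1 - fst p) / snd p $ 2, snd p $ 3, snd p $ 4))"
    by (intro continuous_intros) (auto dest: Theta_D)
  have 3: "(\<lambda>p :: real \<times> (real ^ 4). ((snd p $ 1 - fst p) / snd p $ 2, snd p $ 3, snd p $ 4)) ` (UNIV \<times> Theta)
      \<subseteq> UNIV \<times> {0<..<2} \<times> UNIV"
    by (auto dest: Theta_D)
  have I: "continuous_on (UNIV \<times> Theta)
      (\<lambda>p. stabI P ((snd p $ 1 - fst p) / snd p $ 2) (snd p $ 3) (snd p $ 4))"
    using continuous_on_compose2[OF 1 2 3] by simp
  show ?thesis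
    unfolding stabW_def
    by (intro continuous_intros I) (auto dest: Theta_D simp: less_imp_neq[OF Theta_D(1), symmetric])
qed

text \<open>With t = r / \<sigma> the location phases combine to i m r. For
  \<open>\<alpha> \<noteq> 1\<close> the centring of the parameterization gives \<open>r powr
  \<alpha> * (r powr (1 - \<alpha>) - 1) = r - r powr \<alpha>\<close>, the shape of the skewness
  term; at \<open>\<alpha> = 1\<close> both sides carry \<open>2 / pi * r * ln r\<close>.\<close>

lemma stable_cf_eq_kern:
  assumes "0 < \<sigma>" "0 < r"
  shows "exp (- \<i> * of_real (r / \<sigma> * x)) * stable_cf \<mu> \<sigma> \<alpha> \<beta> (r / \<sigma>) = kern ((\<mu> - x) / \<sigma>) \<alpha> \<beta> (of_real r)"
proof (cases "\<alpha> = 1")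
  case True
  have "mD 0 1 \<beta> (of_real r) = - of_real r - \<i> * of_real (\<beta> * (2 / pi) * (r * ln r))"
    using assms by (simp add: mD_def mB_def stabKd_0_1 Ln_of_real exp_of_real)
  then have k: "kern ((\<mu> - x) / \<sigma>) \<alpha> \<beta> (of_real r) =
      exp (\<i> * of_real ((\<mu> - x) / \<sigma>) * of_real r + (- of_real r - \<i> * of_real (\<beta> * (2 / pi) * (r * ln r))))"
    by (simp only: kern_def True)
  have c: "stable_cf \<mu> \<sigma> \<alpha> \<beta> (r / \<sigma>) =
      exp (- of_real r - \<i> * of_real (r * (2 * \<beta> / pi) * ln r) + \<i> * of_real (\<mu> * (r / \<sigma>)))"
    using assms True by (simp add: stable_cf_def)
  show ?thesis
    unfolding k c exp_add[symmetric]
    by (rule arg_cong[of _ _ exp]) (use assms in \<open>simp add: complex_eq_iff field_simps\<close>)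
next
  case False
  have rp: "r powr \<alpha> * r powr (1 - \<alpha>) = r" using assms by (simp flip: powr_add)
  have "exp (of_real \<alpha> * Ln (of_real r)) = complex_of_real (r powr \<alpha>)"
    using assms by (simp add: Ln_of_real powr_def flip: exp_of_real)
  then have "mD 0 \<alpha> \<beta> (of_real r) = - of_real (r powr \<alpha>) - \<i> * of_real (\<beta> * tan (pi * \<alpha> / 2) * (r - r powr \<alpha>))"
    using assms False by (simp add: mD_def mB_def stabKd_0_neq_1 algebra_simps)
  also have "r - r powr \<alpha> = r powr \<alpha> * (r powr (1 - \<alpha>) - 1)" using rp by (simp add: right_diff_distrib)
  finally have "mD 0 \<alpha> \<beta> (of_real r) = - of_real (r powr \<alpha>) * (1 + \<i> * of_real (\<beta> * tan (pi * \<alpha> / 2) * (r powr (1 - \<alpha>) - 1)))"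
    by (simp add: algebra_simps)
  then have k: "kern ((\<mu> - x) / \<sigma>) \<alpha> \<beta> (of_real r) =
      exp (\<i> * of_real ((\<mu> - x) / \<sigma>) * of_real r + - of_real (r powr \<alpha>) * (1 + \<i> * of_real (\<beta> * tan (pi * \<alpha> / 2) * (r powr (1 - \<alpha>) - 1))))"
    by (simp only: kern_def)
  have c: "stable_cf \<mu> \<sigma> \<alpha> \<beta> (r / \<sigma>) =
      exp (- of_real (r powr \<alpha>) * (1 + \<i> * of_real (\<beta> * tan (pi * \<alpha> / 2) * (r powr (1 - \<alpha>) - 1))) + \<i> * of_real (\<mu> * (r / \<sigma>)))"
    using assms False by (simp add: stable_cf_def)
  show ?thesis
    unfolding k c exp_add[symmetric]
    by (rule arg_cong[of _ _ exp]) (use assms in \<open>simp add: complex_eq_iff diff_divide_distrib algebra_simps\<close>)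
qed

text \<open>Negative frequencies contribute the conjugate of the positive ones, so the whole
  integral is twice a real part and 1 / (2 pi) becomes 1 / pi. The substitution r = \<sigma> t
  supplies the factor 1 / \<sigma>.\<close>

lemma stable_pdf_eq_stabW:
  assumes \<theta>: "\<theta> \<in> Theta"
  shows "stable_pdf x \<theta> = stabW 1 0 mone x \<theta>"
proof -
  note \<theta>D = Theta_D[OF \<theta>]
  define \<sigma> m where "\<sigma> = \<theta> $ 2" and "m = (\<theta> $ 1 - x) / \<theta> $ 2"
  have \<sigma>: "\<sigma> > 0" using \<theta>D by (simp add: \<sigma>_def)
  define h where "h t = exp (- \<i> * of_real (t * x)) * stable_cf (\<theta> $ 1) (\<theta> $ 2) (\<theta> $ 3) (\<theta> $ 4) t" for t
  let ?g = "\<lambda>t. indicator {0<..} t *\<^sub>R h t"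
  let ?k = "\<lambda>r. indicator {0<..} r *\<^sub>R kern m (\<theta> $ 3) (\<theta> $ 4) (of_real r)"
  have hk: "?g (r / \<sigma>) = ?k r" for r
    using \<sigma> stable_cf_eq_kern[of \<sigma> r x "\<theta> $ 1" "\<theta> $ 3" "\<theta> $ 4"]
    by (auto simp: h_def \<sigma>_def m_def indicator_def zero_less_divide_iff)
  have "integrable halfline (\<lambda>r. kern m (\<theta> $ 3) (\<theta> $ 4) (of_real r))"
    using integrable_mult_kern[OF admissible_const[of 1] \<theta>D(2,3), where m = m and \<beta> = "\<theta> $ 4"] by simp
  then have ik: "integrable lborel ?k"
    by (subst (asm) integrable_restrict_space) auto
  then have ig: "integrable lborel ?g"
    using lborel_integrable_real_affine_iff[of "1 / \<sigma>" ?g 0] hk \<sigma> by simp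
  have "(LINT t|lborel. ?g t) = (1 / \<sigma>) *\<^sub>R (LINT r|lborel. ?k r)"
    using lborel_integral_real_affine[of "1 / \<sigma>" ?g 0] hk \<sigma> by simp
  also have "(LINT r|lborel. ?k r) = stabI mone m (\<theta> $ 3) (\<theta> $ 4)"
    unfolding stabI_def by (subst integral_restrict_space) auto
  finally have I: "(LINT t|lborel. ?g t) = (1 / \<sigma>) *\<^sub>R stabI mone m (\<theta> $ 3) (\<theta> $ 4)" .
  have hc: "h (- t) = cnj (h t)" for t
    by (simp add: h_def cnj_stable_cf exp_cnj)
  have ig': "integrable lborel (\<lambda>t. ?g (- t))"
    using lborel_integrable_real_affine_iff[of "- 1" ?g 0] ig by simp
  have igc: "integrable lborel (\<lambda>t. cnj (?g (- t)))"
    by (rule integrable_bounded_linear[OF bounded_linear_cnj ig'])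
  have "(LINT t|lborel. h t) = (LINT t|lborel. ?g t + cnj (?g (- t)))"
  proof (rule integral_cong_AE)
    have m: "(\<lambda>t. ?g t + cnj (?g (- t))) \<in> borel_measurable lborel"
      using ig igc by (intro borel_measurable_integrable Bochner_Integration.integrable_add)
    then show "(\<lambda>t. ?g t + cnj (?g (- t))) \<in> borel_measurable lborel" .
    \<comment> \<open>The sum of the two halves misses only the point 0, so correcting it there also
      gives the measurability of \<open>h\<close>.\<close>
    have "(\<lambda>t. if t = 0 then h 0 else ?g t + cnj (?g (- t))) \<in> borel_measurable lborel"
      using m by measurable
    also have "(\<lambda>t. if t = 0 then h 0 else ?g t + cnj (?g (- t))) = h"
      using hc by (auto simp: fun_eq_iff indicator_def)
    finally show "h \<in> borel_measurable lborel" .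
    show "AE t in lborel. h t = ?g t + cnj (?g (- t))"
      using AE_lborel_singleton[of "0 :: real"]
      by eventually_elim (use hc in \<open>auto simp: indicator_def\<close>)
  qed
  also have "\<dots> = (LINT t|lborel. ?g t) + cnj (LINT t|lborel. ?g (- t))"
    unfolding Bochner_Integration.integral_add[OF ig igc] Bochner_Integration.integral_cnj ..
  also have "(LINT t|lborel. ?g (- t)) = (LINT t|lborel. ?g t)"
    using lborel_integral_real_affine[of "- 1" ?g 0] by simp
  finally have "(LINT t|lborel. h t) = (1 / \<sigma>) *\<^sub>R stabI mone m (\<theta> $ 3) (\<theta> $ 4) + cnj ((1 / \<sigma>) *\<^sub>R stabI mone m (\<theta> $ 3) (\<theta> $ 4))"
    unfolding I .
  then have "Re (LINT t|lborel. h t) = 2 / \<sigma> * Re (stabI mone m (\<theta> $ 3) (\<theta> $ 4))"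
    by simp
  moreover have "stable_pdf x \<theta> = Re (LINT t|lborel. h t) / (2 * pi)"
    unfolding stable_pdf_def h_def by (simp add: Re_divide_of_real flip: of_real_mult)
  ultimately show ?thesis
    by (simp add: stabW_def m_def \<sigma>_def)
qed

section \<open>From decay in (\<mu> - x) / \<sigma> to decay in x\<close>

lemma decays_bigo:
  assumes f: "decays f q k" and \<sigma>: "0 < \<sigma>" and q: "real l \<le> q"
  shows "(\<lambda>x. ((\<mu> - x) / \<sigma>) ^ l * f ((\<mu> - x) / \<sigma>)) \<in> O[at_infinity](\<lambda>x. \<bar>x\<bar> powr (- (q - real l)) * ln \<bar>x\<bar> ^ k)"
proof -
  obtain K where K: "\<And>y. exp 1 \<le> \<bar>y\<bar> \<Longrightarrow> \<bar>f y\<bar> \<le> K * (\<bar>y\<bar> powr (- q) * ln \<bar>y\<bar> ^ k)"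
    using f unfolding decays_def by metis
  define p where "p = q - real l"
  have p: "p \<ge> 0" using q by (simp add: p_def)
  \<comment> \<open>\<open>2 * \<bar>\<mu>\<bar>\<close> makes \<open>\<bar>\<mu> - x\<bar>\<close>
    comparable to \<open>\<bar>x\<bar>\<close> up to a factor 2. \<open>2 / \<sigma>\<close> gives
    \<open>\<bar>y\<bar> \<le> \<bar>x\<bar> * \<bar>x\<bar>\<close>, hence
    \<open>ln \<bar>y\<bar> \<le> 2 * ln \<bar>x\<bar>\<close>. The last summand puts
    \<open>\<bar>y\<bar>\<close> above the threshold \<open>exp 1\<close>, and the 1 keeps
    \<open>ln \<bar>x\<bar>\<close> nonnegative.\<close>
  define X where "X = 1 + 2 * \<bar>\<mu>\<bar> + 2 / \<sigma> + 2 * \<sigma> * exp 1"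
  show ?thesis
  proof (rule bigoI[where c = "\<bar>K\<bar> * (2 * \<sigma>) powr p * 2 ^ k"])
    have "\<forall>\<^sub>F x in at_infinity. X \<le> norm (x :: real)"
      unfolding eventually_at_infinity by auto
    then show "\<forall>\<^sub>F x in at_infinity. norm (((\<mu> - x) / \<sigma>) ^ l * f ((\<mu> - x) / \<sigma>)) \<le>
        \<bar>K\<bar> * (2 * \<sigma>) powr p * 2 ^ k * norm (\<bar>x\<bar> powr (- (q - real l)) * ln \<bar>x\<bar> ^ k)"
    proof eventually_elim
      case (elim x)
      define y where "y = (\<mu> - x) / \<sigma>"
      have "0 < 2 / \<sigma>" "0 < 2 * \<sigma> * exp 1" using \<sigma> by auto
      then have x: "2 * \<bar>\<mu>\<bar> \<le> \<bar>x\<bar>" "1 \<le> \<bar>x\<bar>" "2 / \<sigma> \<le> \<bar>x\<bar>" "2 * \<sigma> * exp 1 \<le> \<bar>x\<bar>"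
        using elim unfolding X_def real_norm_def by linarith+
      have "\<bar>x\<bar> \<le> 2 * \<bar>\<mu> - x\<bar>" "\<bar>\<mu> - x\<bar> \<le> 2 * \<bar>x\<bar>"
        using x(1) abs_triangle_ineq2_sym[of x \<mu>] abs_triangle_ineq4[of \<mu> x] by linarith+
      then have y1: "\<bar>x\<bar> / (2 * \<sigma>) \<le> \<bar>y\<bar>" and y2: "\<bar>y\<bar> \<le> 2 * \<bar>x\<bar> / \<sigma>"
        using \<sigma> by (simp_all add: y_def abs_divide field_simps)
      have ye: "exp 1 \<le> \<bar>y\<bar>"
      proof (rule mult_left_le_imp_le)
        have "\<bar>x\<bar> \<le> \<bar>y\<bar> * (2 * \<sigma>)" using y1 \<sigma> by (simp add: pos_divide_le_eq)
        then show "2 * \<sigma> * exp 1 \<le> 2 * \<sigma> * \<bar>y\<bar>" using x(4) by (simp only: mult.commute[of "\<bar>y\<bar>"])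
      qed (use \<sigma> in simp)
      then have y0: "1 \<le> \<bar>y\<bar>" using one_le_exp_iff[of 1] by linarith
      have "2 * \<bar>x\<bar> / \<sigma> \<le> \<bar>x\<bar> * \<bar>x\<bar>" using mult_right_mono[OF x(3), of "\<bar>x\<bar>"] by simp
      then have "ln \<bar>y\<bar> \<le> ln (\<bar>x\<bar> * \<bar>x\<bar>)" using y0 y2 by (intro ln_mono) auto
      also have "\<dots> = 2 * ln \<bar>x\<bar>" using x by (subst ln_mult) auto
      finally have l: "ln \<bar>y\<bar> ^ k \<le> 2 ^ k * ln \<bar>x\<bar> ^ k"
        using power_mono[of "ln \<bar>y\<bar>" "2 * ln \<bar>x\<bar>" k] y0 by (simp add: power_mult_distrib)
      have "\<bar>y\<bar> powr (- p) \<le> (\<bar>x\<bar> / (2 * \<sigma>)) powr (- p)"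
        using y1 p x \<sigma> by (intro powr_mono2') auto
      also have "\<dots> = (2 * \<sigma>) powr p * \<bar>x\<bar> powr (- p)"
        using x \<sigma> by (simp add: powr_divide powr_minus field_simps)
      finally have yp: "\<bar>y\<bar> powr (- p) \<le> (2 * \<sigma>) powr p * \<bar>x\<bar> powr (- p)" .
      have "norm (y ^ l * f y) = \<bar>y\<bar> ^ l * \<bar>f y\<bar>" by (simp add: abs_mult power_abs)
      also have "\<dots> \<le> \<bar>y\<bar> ^ l * (\<bar>K\<bar> * (\<bar>y\<bar> powr (- q) * ln \<bar>y\<bar> ^ k))"
      proof (rule mult_left_mono)
        have "0 \<le> \<bar>y\<bar> powr (- q) * ln \<bar>y\<bar> ^ k" using y0 by simp
        then show "\<bar>f y\<bar> \<le> \<bar>K\<bar> * (\<bar>y\<bar> powr (- q) * ln \<bar>y\<bar> ^ k)"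
          using K[OF ye] mult_right_mono[OF abs_ge_self[of K]] order_trans by blast
      qed auto
      also have "\<dots> = \<bar>K\<bar> * (\<bar>y\<bar> powr (- p) * ln \<bar>y\<bar> ^ k)"
      proof -
        have "\<bar>y\<bar> powr (- p) = \<bar>y\<bar> ^ l * \<bar>y\<bar> powr (- q)"
          using y0 by (simp add: p_def powr_realpow[symmetric] flip: powr_add)
        then show ?thesis by simp
      qed
      also have "\<dots> \<le> \<bar>K\<bar> * (((2 * \<sigma>) powr p * \<bar>x\<bar> powr (- p)) * (2 ^ k * ln \<bar>x\<bar> ^ k))"
        using yp l y0 by (intro mult_left_mono mult_mono) auto
      finally show ?case
        using x by (simp add: y_def p_def abs_mult mult_ac)
    qed
  qed
qed

section \<open>The case \<open>\<alpha> = 1\<close>\<close>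

lemma mB_0_at_1: "0 < u \<Longrightarrow> mB 0 1 \<beta> (- \<i> * of_real u) = Complex (- (2 / pi) * (u * ln u)) u"
  by (simp add: mB_def stabKd_0_1 Ln_neg_imag[simplified] complex_eq_iff)

lemma mD_0_at_1:
  assumes "0 < u"
  shows "mD 0 1 \<beta> (- \<i> * of_real u) = Complex (- \<beta> * (2 / pi) * (u * ln u)) ((1 + \<beta>) * u)"
proof -
  have "mD 0 1 \<beta> (- \<i> * of_real u) = \<i> * of_real u + of_real \<beta> * Complex (- (2 / pi) * (u * ln u)) u"
    unfolding mD_def mB_0_at_1[OF assms] using assms by simp
  then show ?thesis by (simp add: complex_eq_iff algebra_simps)
qed

lemma abs_exp_minus_1_le: "\<bar>exp a - 1\<bar> \<le> \<bar>a\<bar> * exp \<bar>a\<bar>" for a :: real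
proof -
  have "\<bar>exp a - 1\<bar> = norm (of_real a * expq (of_real a))"
    unfolding mult_expq by (metis exp_of_real norm_of_real of_real_1 of_real_diff)
  also have "\<dots> \<le> \<bar>a\<bar> * max 1 (exp a)"
    using norm_expq_le[of "of_real a"] by (simp add: norm_mult mult_left_mono)
  also have "\<dots> \<le> \<bar>a\<bar> * exp \<bar>a\<bar>"
    by (intro mult_left_mono) auto
  finally show ?thesis .
qed

lemma log_bound_unit:
  obtains N where "N \<ge> 0" "\<And>u. 0 < u \<Longrightarrow> u \<le> (1::real) \<Longrightarrow> u * (4 + \<bar>ln u\<bar>) ^ k \<le> N"
proof -
  obtain C where C: "C \<ge> 0" "\<And>s :: real. 0 < s \<Longrightarrow> s powr 1 * (4 + \<bar>ln s\<bar>) ^ k \<le> C * (1 + s) ^ (k + 2)"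
    using log_powr_bound[of 1 k] by (metis order_refl one_le_numeral zero_less_one)
  show ?thesis
  proof
    show "C * 2 ^ (k + 2) \<ge> 0" using C(1) by simp
    fix u :: real assume u: "0 < u" "u \<le> 1"
    have "u * (4 + \<bar>ln u\<bar>) ^ k \<le> C * (1 + u) ^ (k + 2)" using C(2)[OF u(1)] u by simp
    also have "\<dots> \<le> C * 2 ^ (k + 2)" using u C(1) by (intro mult_left_mono power_mono) auto
    finally show "u * (4 + \<bar>ln u\<bar>) ^ k \<le> C * 2 ^ (k + 2)" .
  qed
qed

lemma abs_log_term_le: "0 < u \<Longrightarrow> u \<le> 1 \<Longrightarrow> \<bar>c * (2 / pi) * (u * ln u)\<bar> \<le> \<bar>c\<bar> * (u * (4 + \<bar>ln u\<bar>))"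
proof -
  assume u: "0 < u" "u \<le> 1"
  have "\<bar>c * (2 / pi) * (u * ln u)\<bar> = \<bar>c\<bar> * ((2 / pi) * (u * \<bar>ln u\<bar>))"
  proof -
    have "\<bar>u * ln u\<bar> = u * \<bar>ln u\<bar>" using u by (simp only: abs_mult abs_of_pos)
    then show ?thesis by (simp only: abs_mult[of "c * (2 / pi)"] abs_mult[of c]) simp
  qed
  also have "\<dots> \<le> \<bar>c\<bar> * (1 * (u * (4 + \<bar>ln u\<bar>)))"
  proof (intro mult_left_mono mult_mono)
    show "2 / pi \<le> 1" using pi_ge_two by simp
    show "0 \<le> u * \<bar>ln u\<bar>" using u by (intro mult_nonneg_nonneg) auto
  qed (use u in auto)
  finally show ?thesis by simp
qed

text \<open>At \<open>\<alpha> = 1\<close> the rotated \<open>mB 0\<close> is p + i u with p of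
  order u ln u, so its square has the imaginary part 2 p u, of order u^2 ln u. The general product
  estimate treats the real part p only as bounded and would lose this extra factor u.\<close>

lemma decays_BB_1: "decays (\<lambda>m. Re (stabI (mtimes (mB 0) (mB 0)) m 1 \<beta>)) 3 1"
proof (rule decaysI_neg[where f = "\<lambda>\<beta> m. Re (stabI (mtimes (mB 0) (mB 0)) m 1 \<beta>)"])
  show "\<bar>Re (stabI (mtimes (mB 0) (mB 0)) m 1 \<beta>)\<bar> = \<bar>Re (stabI (mtimes (mB 0) (mB 0)) (- m) 1 (- \<beta>))\<bar>" for m \<beta>
    using Re_stabI_parity[OF parity_mult[OF parity_B parity_B], of 1 0 0 m \<beta>] by simp
  fix \<beta> :: real
  have adm: "admissible (mtimes (mB 0) (mB 0))" by (intro admissible_intros)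
  obtain M where M: "M \<ge> 0" "\<And>u. 0 < u \<Longrightarrow> u \<le> 1 \<Longrightarrow> norm (mD 0 1 \<beta> (- \<i> * of_real u)) \<le> M"
    using admissible_bound_neg_imag[OF admissible_D, of 1 0 \<beta>] by auto
  obtain N where N: "N \<ge> 0" "\<And>u. 0 < u \<Longrightarrow> u \<le> (1::real) \<Longrightarrow> u * (4 + \<bar>ln u\<bar>) ^ 1 \<le> N"
    using log_bound_unit by metis
  have "\<exists>K. \<forall>y. exp 1 \<le> y \<longrightarrow> \<bar>Re (stabI (mtimes (mB 0) (mB 0)) (- y) 1 \<beta>)\<bar> \<le> K * (y powr (- (1 + real 1 + 1)) * ln y ^ 1)"
  \<comment> \<open>\<open>exp M\<close> bounds the real exponential, 2 comes from the cosine term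
    with 2 p u, and the rest from p^2 - u^2 times the sine of (1 + \<beta>) u.\<close>
  proof (rule Re_stabI_tail_of_rotH[OF adm, where C = "exp M * (2 + (N + 1) * \<bar>1 + \<beta>\<bar>)"])
    show "0 \<le> exp M * (2 + (N + 1) * \<bar>1 + \<beta>\<bar>)" using N by simp
    fix u :: real assume u: "0 < u" "u \<le> 1"
    define p where "p = - (2 / pi) * (u * ln u)"
    define l where "l = 4 + \<bar>ln u\<bar>"
    have l: "l \<ge> 4" by (simp add: l_def)
    have p: "\<bar>p\<bar> \<le> u * l" using abs_log_term_le[OF u, of "-1"] by (simp add: p_def l_def)
    have ul: "u * l \<le> N" using N(2)[OF u] by (simp add: l_def)
    define z where "z = mD 0 1 \<beta> (- \<i> * of_real u)"
    have Im_z: "Im z = (1 + \<beta>) * u" unfolding z_def mD_0_at_1[OF u(1)] by simp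
    have ez: "exp (Re z) \<le> exp M" using M(2)[OF u] complex_Re_le_cmod[of z] by (simp add: z_def)
    have eq: "rotH (mtimes (mB 0) (mB 0)) 1 \<beta> u = exp (Re z) * ((p * p - u * u) * sin (Im z) + (2 * p * u) * cos (Im z))"
      unfolding rotH_def mB_0_at_1[OF u(1)] z_def[symmetric] p_def[symmetric]
      by (simp add: Re_exp Im_exp algebra_simps)
    \<comment> \<open>Of the two factors \<open>u * l\<close> that bound p^2, one is traded for the
      constant \<open>N\<close>, so that a single logarithm remains; the sine later restores a
      factor \<open>u\<close>.\<close>
    have pp: "\<bar>p * p - u * u\<bar> \<le> (N + 1) * (u * l)"
    proof -
      have "p * p \<le> N * (u * l)"
      proof -
        have "\<bar>p\<bar> * \<bar>p\<bar> \<le> (u * l) * (u * l)" using p u l by (intro mult_mono) auto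
        also have "\<dots> \<le> N * (u * l)" using ul u l by (intro mult_right_mono) auto
        finally show ?thesis by simp
      qed
      moreover have "u * u \<le> 1 * (u * l)" using u l mult_mono[of u 1 u "u * l"] mult_left_mono[of 1 l u] by simp
      moreover have "0 \<le> p * p" "0 \<le> u * u" by simp_all
      ultimately show ?thesis unfolding distrib_right abs_le_iff using N(1) u l
        by (smt (verit) mult_nonneg_nonneg)
    qed
    have s: "\<bar>sin (Im z)\<bar> \<le> \<bar>1 + \<beta>\<bar> * u"
      using abs_sin_x_le_abs_x[of "Im z"] u unfolding Im_z by (simp add: abs_mult)
    have "\<bar>(p * p - u * u) * sin (Im z)\<bar> \<le> ((N + 1) * (u * l)) * (\<bar>1 + \<beta>\<bar> * u)"
      unfolding abs_mult using pp s N u l by (intro mult_mono) auto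
    moreover have "\<bar>(2 * p * u) * cos (Im z)\<bar> \<le> (2 * (u * l) * u) * 1"
      unfolding abs_mult using p u by (intro mult_mono) auto
    ultimately have "\<bar>(p * p - u * u) * sin (Im z) + (2 * p * u) * cos (Im z)\<bar> \<le> (2 + (N + 1) * \<bar>1 + \<beta>\<bar>) * (u * u * l)"
      by (simp add: algebra_simps)
    then have "exp (Re z) * \<bar>(p * p - u * u) * sin (Im z) + (2 * p * u) * cos (Im z)\<bar> \<le> exp M * ((2 + (N + 1) * \<bar>1 + \<beta>\<bar>) * (u * u * l))"
      using ez by (intro mult_mono) auto
    then show "\<bar>rotH (mtimes (mB 0) (mB 0)) 1 \<beta> u\<bar> \<le> exp M * (2 + (N + 1) * \<bar>1 + \<beta>\<bar>) * (u ^ 1 * u powr 1 * (4 + \<bar>ln u\<bar>) ^ 1)"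
      using u by (simp add: eq abs_mult l_def mult_ac)
  qed auto
  then show "\<exists>K. \<forall>y. exp 1 \<le> y \<longrightarrow> \<bar>Re (stabI (mtimes (mB 0) (mB 0)) (- y) 1 \<beta>)\<bar> \<le> K * (y powr (- 3) * ln y ^ 1)"
    by simp
qed

text \<open>At \<open>\<alpha> = 1\<close> the rotated integrand is exactly exp a sin b with a of
  order u ln u and b = (1 + \<beta>) u. Its linear part is b; replacing exp a by 1 and sin b by b
  costs one more factor u and at most one logarithm.\<close>

lemma rotH_one_at_1:
  obtains C where "C \<ge> 0" "\<And>u. 0 < u \<Longrightarrow> u \<le> 1 \<Longrightarrow> \<bar>rotH mone 1 \<beta> u - (1 + \<beta>) * u\<bar> \<le> C * (u * u * (4 + \<bar>ln u\<bar>))"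
proof -
  obtain N where N: "N \<ge> 0" "\<And>u. 0 < u \<Longrightarrow> u \<le> (1::real) \<Longrightarrow> u * (4 + \<bar>ln u\<bar>) ^ 1 \<le> N"
    using log_bound_unit by metis
  \<comment> \<open>The first summand belongs to \<open>(exp a - 1) * sin b\<close>, the second to
    \<open>sin b - b\<close>.\<close>
  define C where "C = \<bar>\<beta>\<bar> * exp (\<bar>\<beta>\<bar> * N) * \<bar>1 + \<beta>\<bar> + (1 + \<beta>)\<^sup>2"
  show ?thesis
  proof
    show "C \<ge> 0" by (simp add: C_def)
    fix u :: real assume u: "0 < u" "u \<le> 1"
    define l where "l = 4 + \<bar>ln u\<bar>"
    have l: "l \<ge> 4" by (simp add: l_def)
    define a b where "a = - \<beta> * (2 / pi) * (u * ln u)" and "b = (1 + \<beta>) * u"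
    have eq: "rotH mone 1 \<beta> u = exp a * sin b"
      unfolding rotH_def mD_0_at_1[OF u(1)] by (simp add: Im_exp a_def b_def)
    have a: "\<bar>a\<bar> \<le> \<bar>\<beta>\<bar> * (u * l)" using abs_log_term_le[OF u, of "- \<beta>"] by (simp add: a_def l_def)
    also have "\<dots> \<le> \<bar>\<beta>\<bar> * N" using N(2)[OF u] by (intro mult_left_mono) (auto simp: l_def)
    finally have "exp \<bar>a\<bar> \<le> exp (\<bar>\<beta>\<bar> * N)" by simp
    then have "\<bar>a\<bar> * exp \<bar>a\<bar> \<le> (\<bar>\<beta>\<bar> * (u * l)) * exp (\<bar>\<beta>\<bar> * N)"
      using a u l by (intro mult_mono) auto
    then have e: "\<bar>exp a - 1\<bar> \<le> (\<bar>\<beta>\<bar> * (u * l)) * exp (\<bar>\<beta>\<bar> * N)"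
      using abs_exp_minus_1_le[of a] by linarith
    have "\<bar>sin b\<bar> \<le> \<bar>1 + \<beta>\<bar> * u" using abs_sin_x_le_abs_x[of b] u by (simp add: b_def abs_mult)
    then have 1: "\<bar>(exp a - 1) * sin b\<bar> \<le> ((\<bar>\<beta>\<bar> * (u * l)) * exp (\<bar>\<beta>\<bar> * N)) * (\<bar>1 + \<beta>\<bar> * u)"
      unfolding abs_mult using e u l by (intro mult_mono) auto
    have "\<bar>sin b - b\<bar> \<le> b\<^sup>2"
    proof -
      have *: "\<bar>sin b - b\<bar> * 2 \<le> b\<^sup>2"
        using Maclaurin_sin_bound[of b 2] by (simp add: numeral_2_eq_2 sin_coeff_def)
      show ?thesis by (rule order_trans[OF _ *]) simp
    qed
    also have "b\<^sup>2 \<le> (1 + \<beta>)\<^sup>2 * (u * u * l)"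
    proof -
      have "u * u * 1 \<le> u * u * l" using u l by (intro mult_left_mono) auto
      then have "(1 + \<beta>)\<^sup>2 * (u * u) \<le> (1 + \<beta>)\<^sup>2 * (u * u * l)" by (intro mult_left_mono) auto
      moreover have "b\<^sup>2 = (1 + \<beta>)\<^sup>2 * (u * u)" by (simp only: b_def power_mult_distrib power2_eq_square[of u])
      ultimately show ?thesis by simp
    qed
    finally have 2: "\<bar>sin b - b\<bar> \<le> (1 + \<beta>)\<^sup>2 * (u * u * l)" .
    have "exp a * sin b - b = (exp a - 1) * sin b + (sin b - b)" by (simp add: algebra_simps)
    then have "\<bar>exp a * sin b - b\<bar> \<le> \<bar>(exp a - 1) * sin b\<bar> + \<bar>sin b - b\<bar>" by linarith
    also have "\<dots> \<le> C * (u * u * l)" using 1 2 by (simp add: C_def algebra_simps)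
    finally show "\<bar>rotH mone 1 \<beta> u - (1 + \<beta>) * u\<bar> \<le> C * (u * u * (4 + \<bar>ln u\<bar>))"
      by (simp add: eq b_def l_def)
  qed
qed

lemma rotH_mA: "rotH (mtimes mA P) \<alpha> \<beta> u = u * rotH P \<alpha> \<beta> u"
proof -
  have "mA \<alpha> \<beta> (- \<i> * of_real u) = of_real u" by (simp add: mA_def)
  then show ?thesis unfolding rotH_def mult.assoc by (simp only: Im_of_real_mult)
qed

text \<open>The weight is \<open>(u\<^sup>2 exp (- y u))''\<close>, so that the linear term of the rotated integrand drops out
  by partial integration.\<close>

lemma integral_weight_linear:
  "(LINT u|segment1. exp (- y * u) * (2 * u - 4 * y * u\<^sup>2 + y\<^sup>2 * u ^ 3)) = (1 - y) * exp (- y)"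
proof -
  have "(LINT u|segment1. exp (- y * u) * (2 * u - 4 * y * u\<^sup>2 + y\<^sup>2 * u ^ 3)) =
      (\<lambda>u. (u\<^sup>2 - y * u ^ 3) * exp (- y * u)) 1 - (\<lambda>u. (u\<^sup>2 - y * u ^ 3) * exp (- y * u)) 0"
  proof (rule integral_segment1_FTC)
    show "((\<lambda>u. (u\<^sup>2 - y * u ^ 3) * exp (- y * u)) has_vector_derivative
        exp (- y * u) * (2 * u - 4 * y * u\<^sup>2 + y\<^sup>2 * u ^ 3)) (at u within {0..1})" for u
      unfolding has_real_derivative_iff_has_vector_derivative[symmetric]
      by (auto intro!: derivative_eq_intros simp: power2_eq_square power3_eq_cube algebra_simps)
  qed (intro continuous_intros)
  then show ?thesis by simp
qed

text \<open>For m = -y the combination is a Laplace integral with weight 2 - 4 y u + y^2 u^2. On the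
  linear part of the integrand this weight leaves only the exponentially small boundary term of
  \<open>integral_weight_linear\<close>. The remainder \<open>R\<close> is of order u^2 ln u, which
  gives the exponent 3 and one logarithm.\<close>

lemma decays_sigma_sigma_1:
  "decays (\<lambda>m. 2 * Re (stabI mone m 1 \<beta>) + 4 * (m * Re (stabI mA m 1 \<beta>)) + m\<^sup>2 * Re (stabI (mtimes mA mA) m 1 \<beta>)) 3 1"
proof (rule decaysI_neg[where f = "\<lambda>\<beta> m. 2 * Re (stabI mone m 1 \<beta>) + 4 * (m * Re (stabI mA m 1 \<beta>)) + m\<^sup>2 * Re (stabI (mtimes mA mA) m 1 \<beta>)"])
  show "\<bar>2 * Re (stabI mone m 1 \<beta>) + 4 * (m * Re (stabI mA m 1 \<beta>)) + m\<^sup>2 * Re (stabI (mtimes mA mA) m 1 \<beta>)\<bar> =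
    \<bar>2 * Re (stabI mone (- m) 1 (- \<beta>)) + 4 * (- m * Re (stabI mA (- m) 1 (- \<beta>))) + (- m)\<^sup>2 * Re (stabI (mtimes mA mA) (- m) 1 (- \<beta>))\<bar>" for m \<beta>
  proof -
    have \<alpha>: "(0::real) < 1" "(1::real) < 2" by auto
    show ?thesis
      unfolding Re_stabI_parity[OF parity_mult[OF parity_A parity_A] \<alpha>, of m \<beta>]
        Re_stabI_parity[OF parity_A \<alpha>, of m \<beta>] Re_stabI_parity[OF parity_one \<alpha>, of m \<beta>]
      by simp
  qed
  fix \<beta> :: real
  have \<alpha>: "(0::real) < 1" "(1::real) < 2" by auto
  have adm: "admissible mone" "admissible mA" "admissible (mtimes mA mA)" by (intro admissible_intros)+
  obtain C where C: "C \<ge> 0" "\<And>u. 0 < u \<Longrightarrow> u \<le> 1 \<Longrightarrow> \<bar>rotH mone 1 \<beta> u - (1 + \<beta>) * u\<bar> \<le> C * (u * u * (4 + \<bar>ln u\<bar>))"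
    using rotH_one_at_1 by metis
  define H where "H = rotH mone 1 \<beta>"
  define R where "R u = H u - (1 + \<beta>) * u" for u
  have HA: "rotH mA 1 \<beta> = (\<lambda>u. u * H u)" using rotH_mA[of mone 1 \<beta>] by (auto simp: H_def fun_eq_iff)
  have HAA: "rotH (mtimes mA mA) 1 \<beta> = (\<lambda>u. u\<^sup>2 * H u)"
    using rotH_mA[of mA 1 \<beta>] by (auto simp: HA fun_eq_iff power2_eq_square)
  have rot: "\<exists>K\<ge>0. \<forall>y. \<bar>Re (stabI P (- y) 1 \<beta>) - segI (rotH P 1 \<beta>) y\<bar> \<le> K * exp (- y)" if "admissible P" for P
    using Re_stabI_rotate[OF that \<alpha>, of \<beta>] by metis
  obtain K0 where K0: "K0 \<ge> 0" "\<And>y. \<bar>Re (stabI mone (- y) 1 \<beta>) - segI H y\<bar> \<le> K0 * exp (- y)"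
    using rot[OF adm(1)] unfolding H_def by blast
  obtain K1 where K1: "K1 \<ge> 0" "\<And>y. \<bar>Re (stabI mA (- y) 1 \<beta>) - segI (\<lambda>u. u * H u) y\<bar> \<le> K1 * exp (- y)"
    using rot[OF adm(2)] unfolding HA by blast
  obtain K2 where K2: "K2 \<ge> 0" "\<And>y. \<bar>Re (stabI (mtimes mA mA) (- y) 1 \<beta>) - segI (\<lambda>u. u\<^sup>2 * H u) y\<bar> \<le> K2 * exp (- y)"
    using rot[OF adm(3)] unfolding HAA by blast
  \<comment> \<open>Each factor \<open>y\<close> of the weight is compensated by the factor
    \<open>u\<close> that accompanies it, so all three terms have the same order.\<close>
  have tail: "\<exists>K\<ge>0. \<forall>y. exp 1 \<le> y \<longrightarrow> y ^ i * \<bar>segI (\<lambda>u. u ^ i * R u) y\<bar> \<le> K * (y powr (- 3) * ln y ^ 1)" for i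
  proof -
    have b: "\<bar>u ^ i * R u\<bar> \<le> C * (u ^ (i + 1) * u powr 1 * (4 + \<bar>ln u\<bar>) ^ 1)" if u: "0 < u" "u \<le> 1" for u
    proof -
      have "u ^ i * \<bar>R u\<bar> \<le> u ^ i * (C * (u * u * (4 + \<bar>ln u\<bar>)))"
        using C(2)[OF u] u unfolding R_def H_def by (intro mult_left_mono) auto
      then show ?thesis using u by (simp add: abs_mult mult_ac)
    qed
    show ?thesis
    proof (rule segI_tail[OF zero_less_one one_le_numeral b C(1)])
      fix K assume K: "K \<ge> 0" "\<And>y. exp 1 \<le> y \<Longrightarrow> \<bar>segI (\<lambda>u. u ^ i * R u) y\<bar> \<le> K * (y powr (- (1 + real (i + 1) + 1)) * ln y ^ 1)"
      show ?thesis
      proof (intro exI[of _ K] conjI allI impI)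
      fix y :: real assume y: "exp 1 \<le> y"
      have y1: "1 \<le> y" using y one_le_exp_iff[of 1] by linarith
      have "y ^ i * y powr (- (1 + real (i + 1) + 1)) = y powr (real i + - (1 + real (i + 1) + 1))"
        using y1 by (simp only: powr_add powr_realpow)
      then have e: "y ^ i * y powr (- (1 + real (i + 1) + 1)) = y powr (- 3)" by simp
      have "y ^ i * \<bar>segI (\<lambda>u. u ^ i * R u) y\<bar> \<le> y ^ i * (K * (y powr (- (1 + real (i + 1) + 1)) * ln y ^ 1))"
        using K(2)[OF y] y1 by (intro mult_left_mono) auto
      also have "\<dots> = K * ((y ^ i * y powr (- (1 + real (i + 1) + 1))) * ln y ^ 1)" by (simp only: mult_ac)
      finally show "y ^ i * \<bar>segI (\<lambda>u. u ^ i * R u) y\<bar> \<le> K * (y powr (- 3) * ln y ^ 1)" unfolding e .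
      qed (rule K)
    qed
  qed
  obtain L0 where L0: "L0 \<ge> 0" "\<And>y. exp 1 \<le> y \<Longrightarrow> \<bar>segI R y\<bar> \<le> L0 * (y powr (- 3) * ln y ^ 1)"
    using tail[of 0] by auto
  obtain L1 where L1: "L1 \<ge> 0" "\<And>y. exp 1 \<le> y \<Longrightarrow> y * \<bar>segI (\<lambda>u. u * R u) y\<bar> \<le> L1 * (y powr (- 3) * ln y ^ 1)"
    using tail[of 1] by auto
  obtain L2 where L2: "L2 \<ge> 0" "\<And>y. exp 1 \<le> y \<Longrightarrow> y\<^sup>2 * \<bar>segI (\<lambda>u. u\<^sup>2 * R u) y\<bar> \<le> L2 * (y powr (- 3) * ln y ^ 1)"
    using tail[of 2] by auto
  \<comment> \<open>The exponent is 5 since the exponential errors are multiplied by up to y^2 and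
    order 3 must remain.\<close>
  obtain E where E: "E \<ge> 0" "\<And>y :: real. exp 1 \<le> y \<Longrightarrow> exp (- y) \<le> E * (y powr (- 5) * ln y ^ 1)"
    using exp_minus_le_powr by metis
  have decomp: "2 * segI H y - 4 * y * segI (\<lambda>u. u * H u) y + y\<^sup>2 * segI (\<lambda>u. u\<^sup>2 * H u) y =
      (1 + \<beta>) * ((1 - y) * exp (- y)) + (2 * segI R y - 4 * y * segI (\<lambda>u. u * R u) y + y\<^sup>2 * segI (\<lambda>u. u\<^sup>2 * R u) y)" for y
  proof -
    have iH: "integrable segment1 (\<lambda>u. exp (- y * u) * (u ^ i * H u))" for i
    proof -
      have "integrable segment1 (\<lambda>u. (exp (- y * u) * u ^ i) * rotH mone 1 \<beta> u)"
      proof (rule integrable_segI[OF adm(1) \<alpha>])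
        fix u :: real assume u: "0 < u" "u \<le> 1"
        have "- y * u \<le> \<bar>y\<bar>" using u mult_mono[of "\<bar>y\<bar>" "\<bar>y\<bar>" u 1] abs_le_D2[of "y * u" "\<bar>y\<bar>"] by (simp add: abs_mult)
        then show "\<bar>exp (- y * u) * u ^ i\<bar> \<le> exp \<bar>y\<bar> * 1"
          using u unfolding abs_mult by (intro mult_mono) (auto simp: power_le_one)
      qed (intro continuous_intros)
      then show ?thesis by (simp add: H_def mult.assoc)
    qed
    have iu: "integrable segment1 (\<lambda>u. exp (- y * u) * (u ^ i * ((1 + \<beta>) * u)))" for i
    proof (rule integrable_segment1_bounded)
      fix u :: real assume u: "0 < u" "u \<le> 1"
      have "- y * u \<le> \<bar>y\<bar>" using u mult_mono[of "\<bar>y\<bar>" "\<bar>y\<bar>" u 1] abs_le_D2[of "y * u" "\<bar>y\<bar>"] by (simp add: abs_mult)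
      then show "norm (exp (- y * u) * (u ^ i * ((1 + \<beta>) * u))) \<le> exp \<bar>y\<bar> * (1 * (\<bar>1 + \<beta>\<bar> * 1))"
        using u unfolding real_norm_def abs_mult by (intro mult_mono) (auto simp: power_le_one)
    qed (intro measurable_segment1 continuous_intros)
    define s where "s i = segI (\<lambda>u. u ^ i * ((1 + \<beta>) * u)) y" for i
    have iR: "segI (\<lambda>u. u ^ i * R u) y = segI (\<lambda>u. u ^ i * H u) y - s i" for i
      unfolding s_def segI_def Bochner_Integration.integral_diff[OF iH iu, symmetric] R_def
      by (simp add: right_diff_distrib)
    have "(1 + \<beta>) * ((1 - y) * exp (- y)) = (LINT u|segment1. (1 + \<beta>) * (exp (- y * u) * (2 * u - 4 * y * u\<^sup>2 + y\<^sup>2 * u ^ 3)))"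
      unfolding integral_mult_right_zero integral_weight_linear ..
    also have "\<dots> = (LINT u|segment1. 2 * (exp (- y * u) * (u ^ 0 * ((1 + \<beta>) * u))) - 4 * y * (exp (- y * u) * (u ^ 1 * ((1 + \<beta>) * u)))
        + y\<^sup>2 * (exp (- y * u) * (u ^ 2 * ((1 + \<beta>) * u))))"
      by (intro Bochner_Integration.integral_cong refl) (simp add: power2_eq_square power3_eq_cube algebra_simps)
    also have "\<dots> = 2 * s 0 - 4 * y * s 1 + y\<^sup>2 * s 2"
      unfolding s_def segI_def
        Bochner_Integration.integral_add[OF Bochner_Integration.integrable_diff[OF integrable_mult_right[OF iu] integrable_mult_right[OF iu]] integrable_mult_right[OF iu]]
        Bochner_Integration.integral_diff[OF integrable_mult_right[OF iu] integrable_mult_right[OF iu]] integral_mult_right_zero ..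
    finally have main: "(1 + \<beta>) * ((1 - y) * exp (- y)) = 2 * s 0 - 4 * y * s 1 + y\<^sup>2 * s 2" .
    have "segI R y = segI H y - s 0" "segI (\<lambda>u. u * R u) y = segI (\<lambda>u. u * H u) y - s 1"
      using iR[of 0] iR[of 1] by simp_all
    then show ?thesis
      unfolding main by (simp only: iR[of 2]) (simp add: algebra_simps)
  qed
  let ?S = "\<lambda>m. 2 * Re (stabI mone m 1 \<beta>) + 4 * (m * Re (stabI mA m 1 \<beta>)) + m\<^sup>2 * Re (stabI (mtimes mA mA) m 1 \<beta>)"
  \<comment> \<open>All exponentially small parts: the three rotation errors with the weights of the
    combination, and the boundary term of the linear part.\<close>
  define KK where "KK = 2 * K0 + 4 * K1 + K2 + 2 * \<bar>1 + \<beta>\<bar>"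
  show "\<exists>K. \<forall>y. exp 1 \<le> y \<longrightarrow> \<bar>?S (- y)\<bar> \<le> K * (y powr (- 3) * ln y ^ 1)"
  proof (intro exI[of _ "KK * E + 2 * L0 + 4 * L1 + L2"] allI impI)
    fix y :: real assume y: "exp 1 \<le> y"
    have y1: "1 \<le> y" using y one_le_exp_iff[of 1] by linarith
    let ?e = "exp (- y)" and ?w = "y powr (- 3) * ln y ^ 1"
    have yy: "1 \<le> y\<^sup>2" "y \<le> y\<^sup>2"
      using y1 one_le_power[of y 2] mult_left_mono[of 1 y y] by (simp_all add: power2_eq_square)
    define d0 d1 d2 where "d0 = Re (stabI mone (- y) 1 \<beta>) - segI H y"
      and "d1 = Re (stabI mA (- y) 1 \<beta>) - segI (\<lambda>u. u * H u) y"
      and "d2 = Re (stabI (mtimes mA mA) (- y) 1 \<beta>) - segI (\<lambda>u. u\<^sup>2 * H u) y"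
    define r0 r1 r2 where "r0 = segI R y" and "r1 = y * segI (\<lambda>u. u * R u) y" and "r2 = y\<^sup>2 * segI (\<lambda>u. u\<^sup>2 * R u) y"
    have "?S (- y) = 2 * d0 - 4 * (y * d1) + y\<^sup>2 * d2 + (1 + \<beta>) * ((1 - y) * ?e) + (2 * r0 - 4 * r1 + r2)"
      using decomp[of y] by (simp add: d0_def d1_def d2_def r0_def r1_def r2_def algebra_simps)
    moreover have "\<bar>d0\<bar> \<le> K0 * (y\<^sup>2 * ?e)"
      using K0(2)[of y] mult_left_mono[OF mult_right_mono[OF yy(1), of ?e] K0(1)] by (simp add: d0_def)
    moreover have "\<bar>y * d1\<bar> \<le> K1 * (y\<^sup>2 * ?e)"
    proof -
      have "y * \<bar>d1\<bar> \<le> y\<^sup>2 * (K1 * ?e)" using K1(1) K1(2)[of y] yy y1 by (intro mult_mono) (auto simp: d1_def)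
      then show ?thesis using y1 by (simp add: abs_mult mult_ac)
    qed
    moreover have "\<bar>y\<^sup>2 * d2\<bar> \<le> K2 * (y\<^sup>2 * ?e)"
      using K2(2)[of y] mult_left_mono[of "\<bar>d2\<bar>" "K2 * ?e" "y\<^sup>2"] by (simp add: d2_def abs_mult mult_ac)
    moreover have "\<bar>(1 + \<beta>) * ((1 - y) * ?e)\<bar> \<le> 2 * \<bar>1 + \<beta>\<bar> * (y\<^sup>2 * ?e)"
    proof -
      have "\<bar>1 - y\<bar> \<le> 2 * y\<^sup>2" using y1 yy by linarith
      then have "\<bar>1 + \<beta>\<bar> * (\<bar>1 - y\<bar> * ?e) \<le> \<bar>1 + \<beta>\<bar> * (2 * y\<^sup>2 * ?e)"
        by (intro mult_left_mono mult_right_mono) auto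
      then show ?thesis by (simp add: abs_mult mult_ac)
    qed
    moreover have "\<bar>r0\<bar> \<le> L0 * ?w" "\<bar>r1\<bar> \<le> L1 * ?w" "\<bar>r2\<bar> \<le> L2 * ?w"
      using L0(2)[OF y] L1(2)[OF y] L2(2)[OF y] y1 by (simp_all add: r0_def r1_def r2_def abs_mult)
    ultimately have "\<bar>?S (- y)\<bar> \<le> KK * (y\<^sup>2 * ?e) + (2 * L0 + 4 * L1 + L2) * ?w"
      unfolding KK_def distrib_right abs_le_iff by linarith
    moreover have "KK * (y\<^sup>2 * ?e) \<le> KK * (E * ?w)"
    proof (rule mult_left_mono)
      have "y\<^sup>2 * ?e \<le> y\<^sup>2 * (E * (y powr (- 5) * ln y ^ 1))"
        using E(2)[OF y] by (intro mult_left_mono) auto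
      also have "\<dots> = E * ((y powr 2 * y powr (- 5)) * ln y ^ 1)" using y1 by (simp add: powr_numeral mult_ac)
      also have "y powr 2 * y powr (- 5) = y powr (- 3)" by (simp flip: powr_add)
      finally show "y\<^sup>2 * ?e \<le> E * ?w" .
      show "0 \<le> KK" using K0 K1 K2 by (simp add: KK_def)
    qed
    ultimately show "\<bar>?S (- y)\<bar> \<le> (KK * E + 2 * L0 + 4 * L1 + L2) * ?w"
      by (simp add: algebra_simps)
  qed
qed

section \<open>Derivatives of the density\<close>

definition sel4 :: "'a \<Rightarrow> 'a \<Rightarrow> 'a \<Rightarrow> 'a \<Rightarrow> 4 \<Rightarrow> 'a" where
  "sel4 a b c d i = (if i = 1 then a else if i = 2 then b else if i = 3 then c else d)"

lemma sel4_simps [simp]: "sel4 a b c d 1 = a" "sel4 a b c d 2 = b" "sel4 a b c d 3 = c" "sel4 a b c d 4 = d"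
  by (simp_all add: sel4_def)

abbreviation "mDD \<equiv> mplus (mD 2) (mtimes (mD 1) (mD 1))"
abbreviation "mDB \<equiv> mplus (mB 1) (mtimes (mD 1) (mB 0))"
abbreviation "mBB \<equiv> mtimes (mB 0) (mB 0)"
abbreviation "mAA \<equiv> mtimes mA mA"
abbreviation "mAD \<equiv> mtimes mA (mD 1)"
abbreviation "mAB \<equiv> mtimes mA (mB 0)"

definition pdf_d :: "4 \<Rightarrow> real \<Rightarrow> real ^ 4 \<Rightarrow> real" where
  "pdf_d i x \<theta> = sel4 (stabW 2 0 mA x \<theta>) (- stabW 2 0 mone x \<theta> - stabW 2 1 mA x \<theta>)
    (stabW 1 0 (mD 1) x \<theta>) (stabW 1 0 (mB 0) x \<theta>) i"

text \<open>Sharing the mixed entries makes the array symmetric by construction; that either order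
  of differentiation produces them is verified in \<open>pdf_d_has_derivative\<close>. The
  coefficients 2, 4, 1 are those of the second \<sigma>-derivative of G(m) / \<sigma> with m
  proportional to 1 / \<sigma>.\<close>

definition pdf_dd :: "4 \<Rightarrow> 4 \<Rightarrow> real \<Rightarrow> real ^ 4 \<Rightarrow> real" where
  "pdf_dd i j x \<theta> =
    (let ms = - 2 * stabW 3 0 mA x \<theta> - stabW 3 1 mAA x \<theta>;
         ma = stabW 2 0 mAD x \<theta>;
         mb = stabW 2 0 mAB x \<theta>;
         sa = - stabW 2 0 (mD 1) x \<theta> - stabW 2 1 mAD x \<theta>;
         sb = - stabW 2 0 (mB 0) x \<theta> - stabW 2 1 mAB x \<theta>;
         ab = stabW 1 0 mDB x \<theta>
     in sel4 (sel4 (stabW 3 0 mAA x \<theta>) ms ma mb j)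
          (sel4 ms (2 * stabW 3 0 mone x \<theta> + 4 * stabW 3 1 mA x \<theta> + stabW 3 2 mAA x \<theta>) sa sb j)
          (sel4 ma sa (stabW 1 0 mDD x \<theta>) ab j)
          (sel4 mb sb ab (stabW 1 0 mBB x \<theta>) j) i)"

lemma pdf_dd_sym: "pdf_dd i j x \<theta> = pdf_dd j i x \<theta>"
  using exhaust_4[of i] exhaust_4[of j] by (auto simp: pdf_dd_def Let_def)

lemma stable_pdf_has_derivative:
  assumes "\<theta> \<in> Theta"
  shows "(stable_pdf x has_derivative (\<lambda>h. \<Sum>i\<in>UNIV. h $ i * pdf_d i x \<theta>)) (at \<theta>)"
proof -
  have "(stabW 1 0 mone x has_derivative (\<lambda>h. \<Sum>i\<in>UNIV. h $ i * pdf_d i x \<theta>)) (at \<theta>)"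
    by (rule has_derivative_eq_rhs[OF has_derivative_stabW[OF admissible_const admissible_const admissible_const mult_deriv_const assms refl refl refl]])
      (simp add: fun_eq_iff sum_4 pdf_d_def numeral_2_eq_2)
  then show ?thesis
    by (rule has_derivative_transform_within_open[OF _ open_interior assms]) (simp add: stable_pdf_eq_stabW)
qed

lemma pdf_d_has_derivative:
  assumes "\<theta> \<in> Theta"
  shows "(pdf_d i x has_derivative (\<lambda>h. \<Sum>j\<in>UNIV. h $ j * pdf_dd i j x \<theta>)) (at \<theta>)"
proof -
  have dA: "(stabW n k mA x has_derivative
    (\<lambda>h. h $ 1 * (real k * stabW (n + 1) (k - 1) mA x \<theta> + stabW (n + 1) k mAA x \<theta>) +
      h $ 2 * (- real (n + k) * stabW (n + 1) k mA x \<theta> - stabW (n + 1) (k + 1) mAA x \<theta>) +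
      h $ 3 * stabW n k mAD x \<theta> + h $ 4 * stabW n k mAB x \<theta>)) (at \<theta>)" for n k
    by (rule has_derivative_stabW[OF admissible_A admissible_const admissible_const mult_deriv_A assms])
      (simp_all add: mult.commute)
  have d1: "(stabW n k mone x has_derivative
    (\<lambda>h. h $ 1 * (real k * stabW (n + 1) (k - 1) mone x \<theta> + stabW (n + 1) k mA x \<theta>) +
      h $ 2 * (- real (n + k) * stabW (n + 1) k mone x \<theta> - stabW (n + 1) (k + 1) mA x \<theta>) +
      h $ 3 * stabW n k (mD 1) x \<theta> + h $ 4 * stabW n k (mB 0) x \<theta>)) (at \<theta>)" for n k
    by (rule has_derivative_stabW[OF admissible_const admissible_const admissible_const mult_deriv_const assms])
      simp_all
  have dD: "(stabW n k (mD 1) x has_derivative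
    (\<lambda>h. h $ 1 * (real k * stabW (n + 1) (k - 1) (mD 1) x \<theta> + stabW (n + 1) k mAD x \<theta>) +
      h $ 2 * (- real (n + k) * stabW (n + 1) k (mD 1) x \<theta> - stabW (n + 1) (k + 1) mAD x \<theta>) +
      h $ 3 * stabW n k mDD x \<theta> + h $ 4 * stabW n k mDB x \<theta>)) (at \<theta>)" for n k
    by (rule has_derivative_stabW[OF admissible_D admissible_D admissible_B mult_deriv_D assms])
      (simp_all add: mult.commute numeral_2_eq_2)
  have dB: "(stabW n k (mB 0) x has_derivative
    (\<lambda>h. h $ 1 * (real k * stabW (n + 1) (k - 1) (mB 0) x \<theta> + stabW (n + 1) k mAB x \<theta>) +
      h $ 2 * (- real (n + k) * stabW (n + 1) k (mB 0) x \<theta> - stabW (n + 1) (k + 1) mAB x \<theta>) +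
      h $ 3 * stabW n k mDB x \<theta> + h $ 4 * stabW n k mBB x \<theta>)) (at \<theta>)" for n k
    by (rule has_derivative_stabW[OF admissible_B admissible_B admissible_const mult_deriv_B assms])
      simp_all
  consider "i = 1" | "i = 2" | "i = 3" | "i = 4" using exhaust_4[of i] by blast
  then show ?thesis
  proof cases
    case 1
    have "pdf_d i x = stabW 2 0 mA x" by (simp add: 1 pdf_d_def fun_eq_iff)
    then show ?thesis
      by (simp only:) (rule has_derivative_eq_rhs[OF dA],
        simp add: fun_eq_iff 1 sum_4 pdf_dd_def Let_def numeral_eq_Suc algebra_simps)
  next
    case 2
    have "pdf_d i x = (\<lambda>\<theta>. - stabW 2 0 mone x \<theta> - stabW 2 1 mA x \<theta>)" by (simp add: 2 pdf_d_def fun_eq_iff)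
    then show ?thesis
      by (simp only:) (rule has_derivative_eq_rhs[OF has_derivative_diff[OF has_derivative_minus[OF d1] dA]],
        simp add: fun_eq_iff 2 sum_4 pdf_dd_def Let_def numeral_eq_Suc algebra_simps)
  next
    case 3
    have "pdf_d i x = stabW 1 0 (mD 1) x" by (simp add: 3 pdf_d_def fun_eq_iff)
    then show ?thesis
      by (simp only:) (rule has_derivative_eq_rhs[OF dD],
        simp add: fun_eq_iff 3 sum_4 pdf_dd_def Let_def numeral_eq_Suc algebra_simps)
  next
    case 4
    have "pdf_d i x = stabW 1 0 (mB 0) x" by (simp add: 4 pdf_d_def fun_eq_iff)
    then show ?thesis
      by (simp only:) (rule has_derivative_eq_rhs[OF dB],
        simp add: fun_eq_iff 4 sum_4 pdf_dd_def Let_def numeral_eq_Suc algebra_simps)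
  qed
qed

lemma stable_pdf_d_eq: "\<theta> \<in> Theta \<Longrightarrow> stable_pdf_d i x \<theta> = pdf_d i x \<theta>"
  unfolding stable_pdf_d_def by (rule partial_deriv_eq[OF stable_pdf_has_derivative])

lemma stable_pdf_d_has_derivative:
  assumes "\<theta> \<in> Theta"
  shows "(stable_pdf_d i x has_derivative (\<lambda>h. \<Sum>j\<in>UNIV. h $ j * pdf_dd i j x \<theta>)) (at \<theta>)"
  by (rule has_derivative_transform_within_open[OF pdf_d_has_derivative[OF assms] open_interior assms])
    (simp add: stable_pdf_d_eq)

lemma stable_pdf_dd_eq: "\<theta> \<in> Theta \<Longrightarrow> stable_pdf_dd i j x \<theta> = pdf_dd i j x \<theta>"
  unfolding stable_pdf_dd_def by (rule partial_deriv_eq[OF stable_pdf_d_has_derivative])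

text \<open>The density depends on x and \<mu> only through \<mu> - x. Moving x is thus a
  translation of the parameter, and derivatives in x are minus derivatives in \<mu>.\<close>

lemma stabW_shift: "stabW n k P x \<theta> = stabW n k P 0 (\<theta> - x *\<^sub>R axis 1 1)"
  by (simp add: stabW_def axis_def)

lemma Theta_shift: "\<theta> - x *\<^sub>R axis 1 1 \<in> Theta \<longleftrightarrow> \<theta> \<in> Theta"
  by (simp add: interior_Theta_M axis_def)

lemma pdf_d_shift: "pdf_d i x \<theta> = pdf_d i 0 (\<theta> - x *\<^sub>R axis 1 1)"
  unfolding pdf_d_def stabW_shift[of _ _ _ x] ..

lemma pdf_dd_shift: "pdf_dd i j x \<theta> = pdf_dd i j 0 (\<theta> - x *\<^sub>R axis 1 1)"
  unfolding pdf_dd_def stabW_shift[of _ _ _ x] ..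

lemma stable_pdf_shift: "\<theta> \<in> Theta \<Longrightarrow> stable_pdf x \<theta> = stable_pdf 0 (\<theta> - x *\<^sub>R axis 1 1)"
  by (simp add: stable_pdf_eq_stabW Theta_shift flip: stabW_shift)

lemma has_real_derivative_shift:
  fixes g :: "real ^ 4 \<Rightarrow> real"
  assumes "(g has_derivative (\<lambda>h. \<Sum>j\<in>UNIV. h $ j * q j)) (at (\<theta> - x *\<^sub>R axis 1 1))"
  shows "((\<lambda>y. g (\<theta> - y *\<^sub>R axis 1 1)) has_real_derivative - q 1) (at x)"
proof -
  have "((\<lambda>y. \<theta> - y *\<^sub>R axis 1 1) has_derivative (\<lambda>y. - (y *\<^sub>R axis 1 (1::real)))) (at x)"
    by (auto intro!: derivative_eq_intros)
  from has_derivative_compose[OF this assms] show ?thesis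
    unfolding has_field_derivative_def
    by (rule has_derivative_eq_rhs) (simp add: fun_eq_iff sum_4 axis_def)
qed

lemma pdf_d_has_real_derivative:
  assumes "\<theta> \<in> Theta"
  shows "((\<lambda>y. pdf_d i y \<theta>) has_real_derivative - pdf_dd i 1 x \<theta>) (at x)"
  unfolding pdf_d_shift[of i _ \<theta>] pdf_dd_shift[of i 1 x \<theta>]
  by (rule has_real_derivative_shift[OF pdf_d_has_derivative]) (simp add: assms Theta_shift)

lemma stable_pdf_has_real_derivative:
  assumes "\<theta> \<in> Theta"
  shows "((\<lambda>y. stable_pdf y \<theta>) has_real_derivative - pdf_d 1 x \<theta>) (at x)"
  unfolding stable_pdf_shift[OF assms] pdf_d_shift[of 1 x \<theta>]
  by (rule has_real_derivative_shift[OF stable_pdf_has_derivative]) (simp add: assms Theta_shift)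

text \<open>Translation gives the \<mu>-derivative of the i-th partial derivative; the symmetry of
  the second derivatives exchanges the order into the required one.\<close>

lemma stable_pdf_d_x_eq:
  assumes "\<theta> \<in> Theta"
  shows "stable_pdf_d_x i x \<theta> = - pdf_dd 1 i x \<theta>"
  unfolding stable_pdf_d_x_def stable_pdf_d_eq[OF assms] pdf_dd_sym[of 1 i]
  by (rule DERIV_imp_deriv[OF pdf_d_has_real_derivative[OF assms]])

section \<open>Joint continuity and tails of the derivatives\<close>

lemma continuous_on_sel4:
  assumes "continuous_on S a" "continuous_on S b" "continuous_on S c" "continuous_on S d"
  shows "continuous_on S (\<lambda>p. sel4 (a p) (b p) (c p) (d p) i)"
  using exhaust_4[of i] assms by (auto)

lemma continuous_on_pdf_d: "continuous_on (UNIV \<times> Theta) (\<lambda>p. pdf_d i (fst p) (snd p))"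
  unfolding pdf_d_def
  by (intro continuous_on_sel4 continuous_intros continuous_on_stabW admissible_intros)

lemma continuous_on_pdf_dd: "continuous_on (UNIV \<times> Theta) (\<lambda>p. pdf_dd i j (fst p) (snd p))"
  unfolding pdf_dd_def Let_def
  by (intro continuous_on_sel4 continuous_intros continuous_on_stabW admissible_intros)

lemma continuous_on_slice:
  assumes "continuous_on (UNIV \<times> S) (\<lambda>p. g (fst p) (snd p))"
  shows "continuous_on S (g x)" "\<theta> \<in> S \<Longrightarrow> continuous_on UNIV (\<lambda>x. g x \<theta>)"
proof -
  have "continuous_on S (\<lambda>\<theta>. (x, \<theta>))" "continuous_on UNIV (\<lambda>x. (x, \<theta>))"
    by (intro continuous_intros)+
  from this(1)[THEN continuous_on_compose2[OF assms]] this(2)[THEN continuous_on_compose2[OF assms]]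
  show "continuous_on S (g x)" "\<theta> \<in> S \<Longrightarrow> continuous_on UNIV (\<lambda>x. g x \<theta>)"
    by auto
qed

lemma stabW_bigo:
  assumes \<theta>: "\<theta> \<in> Theta" and dec: "decays (\<lambda>m. Re (stabI P m (\<theta> $ 3) (\<theta> $ 4))) q k" and "real l \<le> q" "p = q - real l"
  shows "(\<lambda>x. stabW n l P x \<theta>) \<in> O[at_infinity](\<lambda>x. \<bar>x\<bar> powr (- p) * ln \<bar>x\<bar> ^ k)"
proof -
  have "(\<lambda>x. inverse ((\<theta> $ 2) ^ n * pi) * (((\<theta> $ 1 - x) / \<theta> $ 2) ^ l * Re (stabI P ((\<theta> $ 1 - x) / \<theta> $ 2) (\<theta> $ 3) (\<theta> $ 4))))
      \<in> O[at_infinity](\<lambda>x. \<bar>x\<bar> powr (- p) * ln \<bar>x\<bar> ^ k)"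
    unfolding assms(4) using decays_bigo[OF dec Theta_D(1)[OF \<theta>] assms(3)] by simp
  then show ?thesis
    by (simp add: stabW_def field_simps)
qed

lemma pdf_bigo:
  assumes \<theta>: "\<theta> \<in> Theta"
  defines "\<alpha> \<equiv> \<theta> $ 3"
  shows "(\<lambda>x. stable_pdf x \<theta>) \<in> O[at_infinity](\<lambda>x. \<bar>x\<bar> powr (- (1 + \<alpha>)))"
    and "(\<lambda>x. pdf_d 1 x \<theta>) \<in> O[at_infinity](\<lambda>x. \<bar>x\<bar> powr (- (2 + \<alpha>)))"
    and "(\<lambda>x. pdf_d 2 x \<theta>) \<in> O[at_infinity](\<lambda>x. \<bar>x\<bar> powr (- (1 + \<alpha>)))"
    and "(\<lambda>x. pdf_d 3 x \<theta>) \<in> O[at_infinity](\<lambda>x. \<bar>x\<bar> powr (- (1 + \<alpha>)) * ln \<bar>x\<bar>)"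
    and "(\<lambda>x. pdf_d 4 x \<theta>) \<in> O[at_infinity](\<lambda>x. \<bar>x\<bar> powr (- (1 + \<alpha>)))"
    and "(\<lambda>x. pdf_dd 1 1 x \<theta>) \<in> O[at_infinity](\<lambda>x. \<bar>x\<bar> powr (- (3 + \<alpha>)))"
    and "(\<lambda>x. pdf_dd 1 2 x \<theta>) \<in> O[at_infinity](\<lambda>x. \<bar>x\<bar> powr (- (2 + \<alpha>)))"
    and "(\<lambda>x. pdf_dd 1 3 x \<theta>) \<in> O[at_infinity](\<lambda>x. \<bar>x\<bar> powr (- (2 + \<alpha>)) * ln \<bar>x\<bar>)"
    and "(\<lambda>x. pdf_dd 1 4 x \<theta>) \<in> O[at_infinity](\<lambda>x. \<bar>x\<bar> powr (- (2 + \<alpha>)))"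
    and "(\<lambda>x. pdf_dd 2 2 x \<theta>) \<in> O[at_infinity](\<lambda>x. \<bar>x\<bar> powr (- (1 + \<alpha>)))"
    and "(\<lambda>x. pdf_dd 2 3 x \<theta>) \<in> O[at_infinity](\<lambda>x. \<bar>x\<bar> powr (- (1 + \<alpha>)) * ln \<bar>x\<bar>)"
    and "(\<lambda>x. pdf_dd 2 4 x \<theta>) \<in> O[at_infinity](\<lambda>x. \<bar>x\<bar> powr (- (1 + \<alpha>)))"
    and "(\<lambda>x. pdf_dd 3 3 x \<theta>) \<in> O[at_infinity](\<lambda>x. \<bar>x\<bar> powr (- (1 + \<alpha>)) * (ln \<bar>x\<bar>)\<^sup>2)"
    and "(\<lambda>x. pdf_dd 3 4 x \<theta>) \<in> O[at_infinity](\<lambda>x. \<bar>x\<bar> powr (- (1 + \<alpha>)) * ln \<bar>x\<bar>)"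
    and "(\<lambda>x. pdf_dd 4 4 x \<theta>) \<in> O[at_infinity](\<lambda>x. \<bar>x\<bar> powr (- (1 + \<alpha>)))"
    and "\<alpha> = 1 \<Longrightarrow> (\<lambda>x. pdf_dd 2 2 x \<theta>) \<in> O[at_infinity](\<lambda>x. \<bar>x\<bar> powr (- 3) * ln \<bar>x\<bar>)"
    and "\<alpha> = 1 \<Longrightarrow> (\<lambda>x. pdf_dd 4 4 x \<theta>) \<in> O[at_infinity](\<lambda>x. \<bar>x\<bar> powr (- 3) * ln \<bar>x\<bar>)"
proof -
  have \<alpha>: "0 < \<alpha>" "\<alpha> < 2" using Theta_D[OF \<theta>] by (auto simp: \<alpha>_def)
  define \<beta> where "\<beta> = \<theta> $ 4"
  have iB: "imO 0 (mB 0)" "imO 1 (mB 1)" and iD: "imO 1 (mD 1)" "imO 2 (mD 2)"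
    by (rule imO_B imO_D)+
  \<comment> \<open>The rule for products wants both factors at the same logarithmic order, so the
    lower ones are raised to the order of the result.\<close>
  have i1B: "imO 1 (mB 0)" and i2D: "imO 2 (mD 1)"
    using imO_mono[OF imO_B[of 0], of 1] imO_mono[OF imO_D[of 1], of 2] by simp_all
  have sgn: "\<bar>1::real\<bar> = 1" "\<bar>-1::real\<bar> = 1" by auto
  have pBB: "parity 1 mBB" and pDD: "parity 1 mDD" and pDB: "parity (-1) mDB"
    using parity_mult[OF parity_B[of 0] parity_B[of 0]]
      parity_add[OF parity_D[of 2] parity_mult[OF parity_D[of 1] parity_D[of 1], simplified]]
      parity_add[OF parity_B[of 1] parity_mult[OF parity_D[of 1] parity_B[of 0], simplified]]
    by simp_all
  have d1: "decays (\<lambda>m. Re (stabI mone m \<alpha> \<beta>)) (1 + \<alpha>) 0"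
    using decays_stabI[OF imO_one admissible_const parity_one sgn(1) \<alpha>, of mone 0 \<beta>] by simp
  have dA: "decays (\<lambda>m. Re (stabI mA m \<alpha> \<beta>)) (2 + \<alpha>) 0"
    using decays_stabI[OF imO_one admissible_const parity_one sgn(1) \<alpha>, of mA 1 \<beta>] by simp
  have dAA: "decays (\<lambda>m. Re (stabI mAA m \<alpha> \<beta>)) (3 + \<alpha>) 0"
    using decays_stabI[OF imO_one admissible_const parity_one sgn(1) \<alpha>, of mAA 2 \<beta>] by (simp add: power2_eq_square)
  have dD: "decays (\<lambda>m. Re (stabI (mD 1) m \<alpha> \<beta>)) (1 + \<alpha>) 1"
    using decays_stabI[OF iD(1) admissible_D parity_D sgn(1) \<alpha>, of "mD 1" 0 \<beta>] by simp
  have dAD: "decays (\<lambda>m. Re (stabI mAD m \<alpha> \<beta>)) (2 + \<alpha>) 1"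
    using decays_stabI[OF iD(1) admissible_D parity_D sgn(1) \<alpha>, of mAD 1 \<beta>] by simp
  have dB: "decays (\<lambda>m. Re (stabI (mB 0) m \<alpha> \<beta>)) (1 + \<alpha>) 0"
    using decays_stabI[OF iB(1) admissible_B parity_B sgn(2) \<alpha>, of "mB 0" 0 \<beta>] by simp
  have dAB: "decays (\<lambda>m. Re (stabI mAB m \<alpha> \<beta>)) (2 + \<alpha>) 0"
    using decays_stabI[OF iB(1) admissible_B parity_B sgn(2) \<alpha>, of mAB 1 \<beta>] by simp
  have dDD: "decays (\<lambda>m. Re (stabI mDD m \<alpha> \<beta>)) (1 + \<alpha>) 2"
    using decays_stabI[OF imO_add[OF iD(2) imO_mult[OF i2D i2D admissible_D admissible_D]]
        admissible_add[OF admissible_D admissible_mult[OF admissible_D admissible_D]] pDD sgn(1) \<alpha>, of mDD 0 \<beta>] by simp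
  have dDB: "decays (\<lambda>m. Re (stabI mDB m \<alpha> \<beta>)) (1 + \<alpha>) 1"
    using decays_stabI[OF imO_add[OF iB(2) imO_mult[OF iD(1) i1B admissible_D admissible_B]]
        admissible_add[OF admissible_B admissible_mult[OF admissible_D admissible_B]] pDB sgn(2) \<alpha>, of mDB 0 \<beta>] by simp
  have dBB: "decays (\<lambda>m. Re (stabI mBB m \<alpha> \<beta>)) (1 + \<alpha>) 0"
    using decays_stabI[OF imO_mult[OF iB(1) iB(1) admissible_B admissible_B]
        admissible_mult[OF admissible_B admissible_B] pBB sgn(1) \<alpha>, of mBB 0 \<beta>] by simp
  note W = stabW_bigo[OF \<theta>, folded \<alpha>_def \<beta>_def]
  have W1: "(\<lambda>x. stabW n 0 mone x \<theta>) \<in> O[at_infinity](\<lambda>x. \<bar>x\<bar> powr (- (1 + \<alpha>)))" for n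
    by (rule W[OF d1, of 0 "1 + \<alpha>" n, unfolded power_0 mult_1_right power_one_right]) (use \<alpha> in simp_all)
  have WA: "(\<lambda>x. stabW n 0 mA x \<theta>) \<in> O[at_infinity](\<lambda>x. \<bar>x\<bar> powr (- (2 + \<alpha>)))" for n
    by (rule W[OF dA, of 0 "2 + \<alpha>" n, unfolded power_0 mult_1_right power_one_right]) (use \<alpha> in simp_all)
  have WA1: "(\<lambda>x. stabW n 1 mA x \<theta>) \<in> O[at_infinity](\<lambda>x. \<bar>x\<bar> powr (- (1 + \<alpha>)))" for n
    by (rule W[OF dA, of 1 "1 + \<alpha>" n, unfolded power_0 mult_1_right power_one_right]) (use \<alpha> in simp_all)
  have WAA1: "(\<lambda>x. stabW n 1 mAA x \<theta>) \<in> O[at_infinity](\<lambda>x. \<bar>x\<bar> powr (- (2 + \<alpha>)))" for n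
    by (rule W[OF dAA, of 1 "2 + \<alpha>" n, unfolded power_0 mult_1_right power_one_right]) (use \<alpha> in simp_all)
  have WAA2: "(\<lambda>x. stabW n 2 mAA x \<theta>) \<in> O[at_infinity](\<lambda>x. \<bar>x\<bar> powr (- (1 + \<alpha>)))" for n
    by (rule W[OF dAA, of 2 "1 + \<alpha>" n, unfolded power_0 mult_1_right power_one_right]) (use \<alpha> in simp_all)
  have WD: "(\<lambda>x. stabW n 0 (mD 1) x \<theta>) \<in> O[at_infinity](\<lambda>x. \<bar>x\<bar> powr (- (1 + \<alpha>)) * ln \<bar>x\<bar>)" for n
    by (rule W[OF dD, of 0 "1 + \<alpha>" n, unfolded power_0 mult_1_right power_one_right]) (use \<alpha> in simp_all)
  have WAD1: "(\<lambda>x. stabW n 1 mAD x \<theta>) \<in> O[at_infinity](\<lambda>x. \<bar>x\<bar> powr (- (1 + \<alpha>)) * ln \<bar>x\<bar>)" for n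
    by (rule W[OF dAD, of 1 "1 + \<alpha>" n, unfolded power_0 mult_1_right power_one_right]) (use \<alpha> in simp_all)
  have WB: "(\<lambda>x. stabW n 0 (mB 0) x \<theta>) \<in> O[at_infinity](\<lambda>x. \<bar>x\<bar> powr (- (1 + \<alpha>)))" for n
    by (rule W[OF dB, of 0 "1 + \<alpha>" n, unfolded power_0 mult_1_right power_one_right]) (use \<alpha> in simp_all)
  have WAB1: "(\<lambda>x. stabW n 1 mAB x \<theta>) \<in> O[at_infinity](\<lambda>x. \<bar>x\<bar> powr (- (1 + \<alpha>)))" for n
    by (rule W[OF dAB, of 1 "1 + \<alpha>" n, unfolded power_0 mult_1_right power_one_right]) (use \<alpha> in simp_all)
  have add: "f \<in> O[at_infinity](h) \<Longrightarrow> g \<in> O[at_infinity](h) \<Longrightarrow> (\<lambda>x. f x + g x) \<in> O[at_infinity](h)"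
    and diff: "f \<in> O[at_infinity](h) \<Longrightarrow> g \<in> O[at_infinity](h) \<Longrightarrow> (\<lambda>x. f x - g x) \<in> O[at_infinity](h)"
    and neg: "f \<in> O[at_infinity](h) \<Longrightarrow> (\<lambda>x. - f x) \<in> O[at_infinity](h)"
    and cm: "f \<in> O[at_infinity](h) \<Longrightarrow> (\<lambda>x. c * f x) \<in> O[at_infinity](h)"
    for f g h :: "real \<Rightarrow> real" and c
    by (auto intro: sum_in_bigo)
  show "(\<lambda>x. stable_pdf x \<theta>) \<in> O[at_infinity](\<lambda>x. \<bar>x\<bar> powr (- (1 + \<alpha>)))"
    using W[OF d1, of 0 "1 + \<alpha>" 1] \<alpha> by (simp add: stable_pdf_eq_stabW[OF \<theta>])
  show "(\<lambda>x. pdf_d 1 x \<theta>) \<in> O[at_infinity](\<lambda>x. \<bar>x\<bar> powr (- (2 + \<alpha>)))"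
    using W[OF dA, of 0 "2 + \<alpha>" 2] \<alpha> by (simp add: pdf_d_def)
  show "(\<lambda>x. pdf_d 2 x \<theta>) \<in> O[at_infinity](\<lambda>x. \<bar>x\<bar> powr (- (1 + \<alpha>)))"
    unfolding pdf_d_def sel4_simps by (rule diff[OF neg[OF W1] WA1])
  show "(\<lambda>x. pdf_d 3 x \<theta>) \<in> O[at_infinity](\<lambda>x. \<bar>x\<bar> powr (- (1 + \<alpha>)) * ln \<bar>x\<bar>)"
    using W[OF dD, of 0 "1 + \<alpha>" 1] \<alpha> by (simp add: pdf_d_def)
  show "(\<lambda>x. pdf_d 4 x \<theta>) \<in> O[at_infinity](\<lambda>x. \<bar>x\<bar> powr (- (1 + \<alpha>)))"
    using W[OF dB, of 0 "1 + \<alpha>" 1] \<alpha> by (simp add: pdf_d_def)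
  show "(\<lambda>x. pdf_dd 1 1 x \<theta>) \<in> O[at_infinity](\<lambda>x. \<bar>x\<bar> powr (- (3 + \<alpha>)))"
    using W[OF dAA, of 0 "3 + \<alpha>" 3] \<alpha> by (simp add: pdf_dd_def)
  show "(\<lambda>x. pdf_dd 1 2 x \<theta>) \<in> O[at_infinity](\<lambda>x. \<bar>x\<bar> powr (- (2 + \<alpha>)))"
    unfolding pdf_dd_def Let_def sel4_simps by (rule diff[OF cm[OF WA, of "- 2"] WAA1])
  show "(\<lambda>x. pdf_dd 1 3 x \<theta>) \<in> O[at_infinity](\<lambda>x. \<bar>x\<bar> powr (- (2 + \<alpha>)) * ln \<bar>x\<bar>)"
    using W[OF dAD, of 0 "2 + \<alpha>" 2] \<alpha> by (simp add: pdf_dd_def)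
  show "(\<lambda>x. pdf_dd 1 4 x \<theta>) \<in> O[at_infinity](\<lambda>x. \<bar>x\<bar> powr (- (2 + \<alpha>)))"
    using W[OF dAB, of 0 "2 + \<alpha>" 2] \<alpha> by (simp add: pdf_dd_def)
  show "(\<lambda>x. pdf_dd 2 2 x \<theta>) \<in> O[at_infinity](\<lambda>x. \<bar>x\<bar> powr (- (1 + \<alpha>)))"
    unfolding pdf_dd_def Let_def sel4_simps
    by (rule add[OF add[OF cm[OF W1, of 2] cm[OF WA1, of 4]] WAA2])
  show "(\<lambda>x. pdf_dd 2 3 x \<theta>) \<in> O[at_infinity](\<lambda>x. \<bar>x\<bar> powr (- (1 + \<alpha>)) * ln \<bar>x\<bar>)"
    unfolding pdf_dd_def Let_def sel4_simps by (rule diff[OF neg[OF WD] WAD1])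
  show "(\<lambda>x. pdf_dd 2 4 x \<theta>) \<in> O[at_infinity](\<lambda>x. \<bar>x\<bar> powr (- (1 + \<alpha>)))"
    unfolding pdf_dd_def Let_def sel4_simps by (rule diff[OF neg[OF WB] WAB1])
  show "(\<lambda>x. pdf_dd 3 3 x \<theta>) \<in> O[at_infinity](\<lambda>x. \<bar>x\<bar> powr (- (1 + \<alpha>)) * (ln \<bar>x\<bar>)\<^sup>2)"
    using W[OF dDD, of 0 "1 + \<alpha>" 1] \<alpha> by (simp add: pdf_dd_def)
  show "(\<lambda>x. pdf_dd 3 4 x \<theta>) \<in> O[at_infinity](\<lambda>x. \<bar>x\<bar> powr (- (1 + \<alpha>)) * ln \<bar>x\<bar>)"
    using W[OF dDB, of 0 "1 + \<alpha>" 1] \<alpha> by (simp add: pdf_dd_def)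
  show "(\<lambda>x. pdf_dd 4 4 x \<theta>) \<in> O[at_infinity](\<lambda>x. \<bar>x\<bar> powr (- (1 + \<alpha>)))"
    using W[OF dBB, of 0 "1 + \<alpha>" 1] \<alpha> by (simp add: pdf_dd_def)
  show "(\<lambda>x. pdf_dd 4 4 x \<theta>) \<in> O[at_infinity](\<lambda>x. \<bar>x\<bar> powr (- 3) * ln \<bar>x\<bar>)" if "\<alpha> = 1"
    using W[of mBB 3 1 0 3 1] decays_BB_1[of \<beta>] that by (simp add: pdf_dd_def)
  \<comment> \<open>The three terms must be estimated as one combination: the separate bounds for
    them give only the order \<open>\<bar>x\<bar> powr (- 2)\<close>.\<close>
  show "(\<lambda>x. pdf_dd 2 2 x \<theta>) \<in> O[at_infinity](\<lambda>x. \<bar>x\<bar> powr (- 3) * ln \<bar>x\<bar>)" if "\<alpha> = 1"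
  proof -
    let ?S = "\<lambda>m. 2 * Re (stabI mone m 1 \<beta>) + 4 * (m * Re (stabI mA m 1 \<beta>)) + m\<^sup>2 * Re (stabI mAA m 1 \<beta>)"
    have "(\<lambda>x. ?S ((\<theta> $ 1 - x) / \<theta> $ 2)) \<in> O[at_infinity](\<lambda>x. \<bar>x\<bar> powr (- 3) * ln \<bar>x\<bar>)"
      using decays_bigo[OF decays_sigma_sigma_1 Theta_D(1)[OF \<theta>], of 0 "\<theta> $ 1" \<beta>] by simp
    from cm[OF this, of "inverse ((\<theta> $ 2) ^ 3 * pi)"]
    show ?thesis
    proof (rule subst[of _ _ "\<lambda>f. f \<in> O[at_infinity](\<lambda>x. \<bar>x\<bar> powr (- 3) * ln \<bar>x\<bar>)", rotated], intro ext)
      fix x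
      show "inverse ((\<theta> $ 2) ^ 3 * pi) * ?S ((\<theta> $ 1 - x) / \<theta> $ 2) = pdf_dd 2 2 x \<theta>"
        using that unfolding pdf_dd_def Let_def sel4_simps stabW_def \<alpha>_def \<beta>_def
        by (simp add: divide_inverse algebra_simps)
    qed
  qed
qed

theorem lemma2p1:
  shows "(\<forall>x. C2_on (stable_pdf x) (interior Theta_M)) \<and>
    (\<forall>\<theta>\<in>interior Theta_M. \<forall>i. (\<lambda>x. stable_pdf_d i x \<theta>) C1_differentiable_on UNIV) \<and>
    (\<forall>i. continuous_on (UNIV \<times> interior Theta_M) (\<lambda>(x, \<theta>). stable_pdf_d i x \<theta>)) \<and>
    (\<forall>i. continuous_on (UNIV \<times> interior Theta_M) (\<lambda>(x, \<theta>). stable_pdf_d_x i x \<theta>)) \<and>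
    (\<forall>i j. continuous_on (UNIV \<times> interior Theta_M) (\<lambda>(x, \<theta>). stable_pdf_dd i j x \<theta>)) \<and>
    (\<forall>\<theta>\<in>interior Theta_M. let \<alpha> = \<theta> $ ix_alpha in
      (\<forall>x. (\<lambda>y. stable_pdf y \<theta>) field_differentiable (at x) \<and>
           stable_pdf_d ix_mu x \<theta> = - stable_pdf_x x \<theta>) \<and>
      (\<forall>i x. stable_pdf_d_x i x \<theta> = - stable_pdf_dd ix_mu i x \<theta>) \<and>
      (\<lambda>x. stable_pdf x \<theta>) \<in> O[at_infinity](\<lambda>x. \<bar>x\<bar> powr (-(1 + \<alpha>))) \<and>
      (\<lambda>x. stable_pdf_d ix_mu x \<theta>) \<in> O[at_infinity](\<lambda>x. \<bar>x\<bar> powr (-(2 + \<alpha>))) \<and>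
      (\<lambda>x. stable_pdf_d ix_sigma x \<theta>) \<in> O[at_infinity](\<lambda>x. \<bar>x\<bar> powr (-(1 + \<alpha>))) \<and>
      (\<lambda>x. stable_pdf_d ix_alpha x \<theta>) \<in> O[at_infinity](\<lambda>x. \<bar>x\<bar> powr (-(1 + \<alpha>)) * ln \<bar>x\<bar>) \<and>
      (\<lambda>x. stable_pdf_d ix_beta x \<theta>) \<in> O[at_infinity](\<lambda>x. \<bar>x\<bar> powr (-(1 + \<alpha>))) \<and>
      (\<lambda>x. stable_pdf_d_x ix_mu x \<theta>) \<in> O[at_infinity](\<lambda>x. \<bar>x\<bar> powr (-(3 + \<alpha>))) \<and>
      (\<lambda>x. stable_pdf_d_x ix_sigma x \<theta>) \<in> O[at_infinity](\<lambda>x. \<bar>x\<bar> powr (-(2 + \<alpha>))) \<and>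
      (\<lambda>x. stable_pdf_d_x ix_alpha x \<theta>) \<in> O[at_infinity](\<lambda>x. \<bar>x\<bar> powr (-(2 + \<alpha>)) * ln \<bar>x\<bar>) \<and>
      (\<lambda>x. stable_pdf_d_x ix_beta x \<theta>) \<in> O[at_infinity](\<lambda>x. \<bar>x\<bar> powr (-(2 + \<alpha>))) \<and>
      (\<lambda>x. stable_pdf_dd ix_sigma ix_sigma x \<theta>) \<in> O[at_infinity](\<lambda>x. \<bar>x\<bar> powr (-(1 + \<alpha>))) \<and>
      (\<lambda>x. stable_pdf_dd ix_sigma ix_alpha x \<theta>) \<in> O[at_infinity](\<lambda>x. \<bar>x\<bar> powr (-(1 + \<alpha>)) * ln \<bar>x\<bar>) \<and>
      (\<lambda>x. stable_pdf_dd ix_sigma ix_beta x \<theta>) \<in> O[at_infinity](\<lambda>x. \<bar>x\<bar> powr (-(1 + \<alpha>))) \<and>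
      (\<lambda>x. stable_pdf_dd ix_alpha ix_alpha x \<theta>) \<in> O[at_infinity](\<lambda>x. \<bar>x\<bar> powr (-(1 + \<alpha>)) * (ln \<bar>x\<bar>)\<^sup>2) \<and>
      (\<lambda>x. stable_pdf_dd ix_alpha ix_beta x \<theta>) \<in> O[at_infinity](\<lambda>x. \<bar>x\<bar> powr (-(1 + \<alpha>)) * ln \<bar>x\<bar>) \<and>
      (\<lambda>x. stable_pdf_dd ix_beta ix_beta x \<theta>) \<in> O[at_infinity](\<lambda>x. \<bar>x\<bar> powr (-(1 + \<alpha>))) \<and>
      (\<alpha> = 1 \<longrightarrow>
        (\<lambda>x. stable_pdf_dd ix_sigma ix_sigma x \<theta>) \<in> O[at_infinity](\<lambda>x. \<bar>x\<bar> powr (-3) * ln \<bar>x\<bar>) \<and>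
        (\<lambda>x. stable_pdf_dd ix_beta ix_beta x \<theta>) \<in> O[at_infinity](\<lambda>x. \<bar>x\<bar> powr (-3) * ln \<bar>x\<bar>)))"
  (is "_ \<and> _ \<and> _ \<and> _ \<and> _ \<and> (\<forall>\<theta>\<in>_. let \<alpha> = _ \<theta> in ?B \<theta> \<alpha>)")
proof (intro conjI allI ballI)
  show "C2_on (stable_pdf x) Theta" for x
    by (rule C2_onI[OF stable_pdf_has_derivative pdf_d_has_derivative continuous_on_slice(1)[OF continuous_on_pdf_dd]])
  show "(\<lambda>x. stable_pdf_d i x \<theta>) C1_differentiable_on UNIV" if \<theta>: "\<theta> \<in> Theta" for \<theta> i
    unfolding C1_differentiable_on_def stable_pdf_d_eq[OF \<theta>]
  proof (intro exI conjI ballI)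
    show "((\<lambda>x. pdf_d i x \<theta>) has_vector_derivative - pdf_dd i 1 x \<theta>) (at x)" for x
      using pdf_d_has_real_derivative[OF \<theta>] by (simp add: has_real_derivative_iff_has_vector_derivative)
    show "continuous_on UNIV (\<lambda>x. - pdf_dd i 1 x \<theta>)"
      by (intro continuous_intros continuous_on_slice(2)[OF continuous_on_pdf_dd \<theta>])
  qed
  show "continuous_on (UNIV \<times> Theta) (\<lambda>(x, \<theta>). stable_pdf_d i x \<theta>)" for i
    using continuous_on_pdf_d[of i] by (rule continuous_on_eq) (auto simp: stable_pdf_d_eq)
  show "continuous_on (UNIV \<times> Theta) (\<lambda>(x, \<theta>). stable_pdf_d_x i x \<theta>)" for i
    using continuous_on_minus[OF continuous_on_pdf_dd[of 1 i]] by (rule continuous_on_eq) (auto simp: stable_pdf_d_x_eq)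
  show "continuous_on (UNIV \<times> Theta) (\<lambda>(x, \<theta>). stable_pdf_dd i j x \<theta>)" for i j
    using continuous_on_pdf_dd[of i j] by (rule continuous_on_eq) (auto simp: stable_pdf_dd_eq)
next
  fix \<theta> assume \<theta>: "\<theta> \<in> Theta"
  have D: "(\<lambda>y. stable_pdf y \<theta>) field_differentiable (at x) \<and> pdf_d 1 x \<theta> = - stable_pdf_x x \<theta>" for x
    using stable_pdf_has_real_derivative[OF \<theta>, of x] unfolding stable_pdf_x_def field_differentiable_def
    by (auto simp: DERIV_imp_deriv)
  show "let \<alpha> = \<theta> $ 3 in ?B \<theta> \<alpha>"
    unfolding Let_def stable_pdf_d_eq[OF \<theta>] stable_pdf_dd_eq[OF \<theta>] stable_pdf_d_x_eq[OF \<theta>] landau_o.big.uminus_in_iff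
    by (intro conjI allI impI refl pdf_bigo[OF \<theta>]) (use D in auto)
qed

end
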